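(* Suppose that $x\nu_x\le 0$ throughout $\partial\Omega$ and that $x>0$ throughout $\Omega$. Then for any $\delta\in(0,1]$ and $z\in\mathbb C\setminus[0,\infty)$ we have \[ \big\|(1+x)^{-\frac{3+\delta}{2}}(-\Delta-z)^{-1}(1+x)^{-\frac{3+\delta}{2}}\big\|_{L^2(\Omega)\to L^2(\Omega)}\le \frac{3}{\delta}\,\big(1+|z|^{1/2}\big). \]
   Context: $\Omega\subset\mathbb R^d$, $d\ge 2$, is an open set of infinite volume. Coordinates on $\mathbb R^d$ are $(x,y)=(x,y_1,\dots,y_{d-1})\in\mathbb R\times\mathbb R^{d-1}$, and $\nu=(\nu_x,\nu_{y_1},\dots,\nu_{y_{d-1}})$ is the outward pointing unit normal vector to $\partial\Omega$. Standing regularity assumption: $\partial\Omega$ is Lipschitz, and every $p\in\partial\Omega$ has a neighborhood $U_p$ such that either $U_p\cap\Omega$ is convex or $U_p\cap\partial\Omega$ is $C^{1,1}$ (so $\nu$ is defined almost everywhere on $\partial\Omega$, and conditions on $\nu$ are understood where it is defined). $\Delta$ is the Dirichlet Laplacian on $\Omega$ (the Friedrichs extension from $C_c^\infty(\Omega)$); the spectrum of $-\Delta$ is contained in $[0,\infty)$, and $(-\Delta-z)^{-1}:L^2(\Omega)\to L^2(\Omega)$ is its resolvent. Powers of $1+x$ act as multiplication operators. *)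

theory Defs
  imports "HOL-Analysis.Analysis"
begin

section \<open>Domains with Lipschitz boundary\<close>

text \<open>
  A function of the \<open>d - 1\<close> coordinates orthogonal to a unit vector \<open>e\<close> is encoded as a function
  \<open>G\<close> on the whole space that is invariant under translations along \<open>e\<close>. Near \<open>p\<close>, the set
  \<open>\<Omega>\<close> lies strictly above the graph of \<open>G\<close> in direction \<open>e\<close>, so locally \<open>\<Omega>\<close> is on one
  side of its boundary. Taking \<open>G\<close> to be defined (and regular) globally loses no generality: a
  locally defined Lipschitz or C11 function can be modified away from \<open>p\<close> and extended.
\<close>

definition epigraph_near ::
    "'a::euclidean_space set \<Rightarrow> 'a \<Rightarrow> 'a \<Rightarrow> ('a \<Rightarrow> real) \<Rightarrow> bool" where
  "epigraph_near \<Omega> p e G \<longleftrightarrow>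
     norm e = 1 \<and> (\<forall>q t. G (q + t *\<^sub>R e) = G q) \<and>
     (\<exists>U. open U \<and> p \<in> U \<and> (\<forall>q\<in>U. q \<in> \<Omega> \<longleftrightarrow> G q < q \<bullet> e))"

definition lipschitz_boundary :: "'a::euclidean_space set \<Rightarrow> bool" where
  "lipschitz_boundary \<Omega> \<longleftrightarrow>
     (\<forall>p\<in>frontier \<Omega>. \<exists>e G L. epigraph_near \<Omega> p e G \<and> L-lipschitz_on UNIV G)"

definition C11_boundary_at :: "'a::euclidean_space set \<Rightarrow> 'a \<Rightarrow> bool" where
  "C11_boundary_at \<Omega> p \<longleftrightarrow>
     (\<exists>e G D L. epigraph_near \<Omega> p e G \<and> (\<forall>q. GDERIV G q :> D q) \<and> L-lipschitz_on UNIV D)"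

definition locally_convex_or_C11 :: "'a::euclidean_space set \<Rightarrow> bool" where
  "locally_convex_or_C11 \<Omega> \<longleftrightarrow>
     (\<forall>p\<in>frontier \<Omega>. \<exists>U. open U \<and> p \<in> U \<and>
        (convex (U \<inter> \<Omega>) \<or> (\<forall>q\<in>U \<inter> frontier \<Omega>. C11_boundary_at \<Omega> q)))"

text \<open>
  Locally \<open>\<Omega> = {q. G q - q \<bullet> e < 0}\<close>; the outward unit normal at \<open>p\<close> is the normalized gradient of
  \<open>G q - q \<bullet> e\<close>. It is defined where \<open>G\<close> is differentiable, hence almost everywhere on the
  boundary, and does not depend on the choice of \<open>e\<close> and \<open>G\<close>.
\<close>

definition outward_unit_normal :: "'a::euclidean_space set \<Rightarrow> 'a \<Rightarrow> 'a \<Rightarrow> bool" where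
  "outward_unit_normal \<Omega> p \<nu> \<longleftrightarrow>
     p \<in> frontier \<Omega> \<and>
     (\<exists>e G L D. epigraph_near \<Omega> p e G \<and> L-lipschitz_on UNIV G \<and> GDERIV G p :> D \<and>
        \<nu> = (1 / norm (D - e)) *\<^sub>R (D - e))"


section \<open>Square-integrable functions and operator norms\<close>

text \<open>
  Elements of \<open>L\<^sup>2(M)\<close> are represented by functions; equality in \<open>L\<^sup>2(M)\<close> is equality almost
  everywhere.
\<close>

definition L2 :: "'a measure \<Rightarrow> ('a \<Rightarrow> complex) set" where
  "L2 M = {f \<in> borel_measurable M. integrable M (\<lambda>x. (cmod (f x))\<^sup>2)}"

definition L2_inner :: "'a measure \<Rightarrow> ('a \<Rightarrow> complex) \<Rightarrow> ('a \<Rightarrow> complex) \<Rightarrow> complex" where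
  "L2_inner M f g = (LINT x|M. f x * cnj (g x))"

definition L2_norm :: "'a measure \<Rightarrow> ('a \<Rightarrow> complex) \<Rightarrow> real" where
  "L2_norm M f = sqrt (LINT x|M. (cmod (f x))\<^sup>2)"

text \<open>
  The norm is \<open>\<infinity>\<close> (the infimum of the empty set) if \<open>T\<close> does not map \<open>L\<^sup>2(M)\<close> into itself or is
  not bounded.
\<close>

definition L2_opnorm :: "'a measure \<Rightarrow> (('a \<Rightarrow> complex) \<Rightarrow> ('a \<Rightarrow> complex)) \<Rightarrow> ennreal" where
  "L2_opnorm M T =
     Inf {ennreal C |C. 0 \<le> C \<and> (\<forall>f\<in>L2 M. T f \<in> L2 M \<and> L2_norm M (T f) \<le> C * L2_norm M f)}"


section \<open>Friedrichs extension\<close>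

text \<open>
  Let \<open>A\<close> be a nonnegative symmetric operator with domain \<open>D\<close>. Its form is
  \<open>q(\<phi>, \<psi>) = \<langle>A \<phi>, \<psi>\<rangle>\<close>. A function \<open>u\<close> is in the domain of the closure of \<open>q\<close> iff it is the
  \<open>L\<^sup>2\<close>-limit of a \<open>q\<close>-Cauchy sequence in \<open>D\<close>, and the closed form is the limit of \<open>q\<close> along such
  sequences. The Friedrichs extension is the operator associated with the closed form;
  \<open>friedrichs_extension M D A u f\<close> says that \<open>u\<close> is in its domain and is mapped to \<open>f\<close>.
\<close>

definition form_approx ::
    "'a measure \<Rightarrow> ('a \<Rightarrow> complex) set \<Rightarrow> (('a \<Rightarrow> complex) \<Rightarrow> ('a \<Rightarrow> complex)) \<Rightarrow>
     (nat \<Rightarrow> 'a \<Rightarrow> complex) \<Rightarrow> ('a \<Rightarrow> complex) \<Rightarrow> bool" where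
  "form_approx M D A \<phi> u \<longleftrightarrow>
     u \<in> L2 M \<and> (\<forall>n. \<phi> n \<in> D) \<and>
     (\<lambda>n. L2_norm M (\<lambda>x. \<phi> n x - u x)) \<longlonglongrightarrow> 0 \<and>
     (\<forall>\<epsilon>>0. \<exists>N. \<forall>m\<ge>N. \<forall>n\<ge>N.
        cmod (L2_inner M (A (\<lambda>x. \<phi> m x - \<phi> n x)) (\<lambda>x. \<phi> m x - \<phi> n x)) < \<epsilon>)"

definition friedrichs_extension ::
    "'a measure \<Rightarrow> ('a \<Rightarrow> complex) set \<Rightarrow> (('a \<Rightarrow> complex) \<Rightarrow> ('a \<Rightarrow> complex)) \<Rightarrow>
     ('a \<Rightarrow> complex) \<Rightarrow> ('a \<Rightarrow> complex) \<Rightarrow> bool" where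
  "friedrichs_extension M D A u f \<longleftrightarrow>
     f \<in> L2 M \<and>
     (\<exists>\<phi>. form_approx M D A \<phi> u \<and>
       (\<forall>v \<psi>. form_approx M D A \<psi> v \<longrightarrow>
          (\<lambda>n. L2_inner M (A (\<phi> n)) (\<psi> n)) \<longlonglongrightarrow> L2_inner M f v))"


section \<open>The Dirichlet Laplacian\<close>

definition dir_deriv ::
    "'a::euclidean_space \<Rightarrow> ('a \<Rightarrow> complex) \<Rightarrow> 'a \<Rightarrow> complex" where
  "dir_deriv b f = (\<lambda>p. frechet_derivative f (at p) b)"

definition laplacian :: "('a::euclidean_space \<Rightarrow> complex) \<Rightarrow> 'a \<Rightarrow> complex" where
  "laplacian f = (\<lambda>p. \<Sum>b\<in>Basis. dir_deriv b (dir_deriv b f) p)"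

primrec Ck :: "nat \<Rightarrow> ('a::euclidean_space \<Rightarrow> complex) \<Rightarrow> bool" where
  "Ck 0 f \<longleftrightarrow> continuous_on UNIV f"
| "Ck (Suc k) f \<longleftrightarrow> (\<forall>p. f differentiable at p) \<and> (\<forall>b\<in>Basis. Ck k (dir_deriv b f))"

definition test_functions :: "'a::euclidean_space set \<Rightarrow> ('a \<Rightarrow> complex) set" where
  "test_functions \<Omega> =
     {\<phi>. (\<forall>k. Ck k \<phi>) \<and> compact (closure {p. \<phi> p \<noteq> 0}) \<and> closure {p. \<phi> p \<noteq> 0} \<subseteq> \<Omega>}"

text \<open>Every Lebesgue-measurable function has a Borel representative, so \<open>lborel\<close> suffices.\<close>

abbreviation vol :: "'a::euclidean_space set \<Rightarrow> 'a measure" where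
  "vol \<Omega> \<equiv> restrict_space lborel \<Omega>"

text \<open>\<open>neg_dirichlet_laplacian \<Omega> u f\<close>: \<open>u\<close> is in the domain of \<open>-\<Delta>\<close> and \<open>-\<Delta> u = f\<close>.\<close>

definition neg_dirichlet_laplacian ::
    "'a::euclidean_space set \<Rightarrow> ('a \<Rightarrow> complex) \<Rightarrow> ('a \<Rightarrow> complex) \<Rightarrow> bool" where
  "neg_dirichlet_laplacian \<Omega> =
     friedrichs_extension (vol \<Omega>) (test_functions \<Omega>) (\<lambda>\<phi> p. - laplacian \<phi> p)"

text \<open>
  For \<open>z\<close> in the resolvent set and \<open>f\<close> in \<open>L\<^sup>2(\<Omega>)\<close> this is a representative of
  \<open>(-\<Delta> - z)\<inverse> f\<close>, which is unique up to equality almost everywhere.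
\<close>

definition dirichlet_resolvent ::
    "'a::euclidean_space set \<Rightarrow> complex \<Rightarrow> ('a \<Rightarrow> complex) \<Rightarrow> ('a \<Rightarrow> complex)" where
  "dirichlet_resolvent \<Omega> z f =
     (SOME u. \<exists>g. neg_dirichlet_laplacian \<Omega> u g \<and> (AE p in vol \<Omega>. g p - z * u p = f p))"

end

(*
  The condition on the normals is only used through interior touching balls: where such a ball
  touches the boundary, the normal exists and points along the radius, so it does not point forward
  in x. Following the distance to the boundary along a ray shows that the domain is invariant under
  forward translations in x. Hence the backward difference quotients of a function in the form
  domain stay in the form domain, and the multiplier 2 w d/dx + w' with w = 1 - (1 + x)^(-delta)
  can be applied in the weak formulation with d/dx replaced by a backward difference quotient.
  Convexity of the square gives the boundary term its sign without any regularity of solutions or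
  traces up to the boundary. A Hardy inequality on the rays in direction x, and the energy identity
  for the imaginary part of z, then yield the estimate.
*)
theory Submission
  imports Defs
begin

section \<open>Square-integrable functions\<close>

text \<open>The multiplier \<open>2 w d/dx + w'\<close> is formally antisymmetric, so testing the
  equation with it removes the real part of z. Its commutator with the Laplacian leaves
  \<open>2 w' |u_x|^2 - (1/2) w''' |u|^2\<close>, with weights \<open>(1+x)^(-1-\<delta>)\<close>
  and \<open>(1+x)^(-3-\<delta>)\<close>; the second is the square of the weight in the theorem. The
  Hardy constant \<open>1 + \<delta>/2\<close> lets the first term absorb the second and leaves a
  remainder of order \<open>\<delta>\<close>, whence the factor \<open>1/\<delta>\<close>. The
  obstacle is that elements of the form domain are only limits of test functions
  \<open>\<phi> n\<close>, and the genuine derivative does not respect these limits. The step h of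
  the quotient is therefore fixed before n tends to infinity, and replacing quotient by derivative
  must cost little uniformly in n. The resolvent is a \<open>SOME\<close>-choice, and the operator
  norm is infinite unless all values are square-integrable. Hence solvability is proved for every z
  outside \<open>[0, \<infinity>)\<close>, and the estimate is proved for every weak solution, so it
  covers the chosen one.\<close>

lemma L2_D:
  assumes "f \<in> L2 M"
  shows "f \<in> borel_measurable M" "integrable M (\<lambda>x. (cmod (f x))\<^sup>2)"
  using assms by (auto simp: L2_def)

lemma L2_measurable [measurable_dest]: "f \<in> L2 M \<Longrightarrow> f \<in> borel_measurable M"
  by (rule L2_D)

lemma L2_dominated:
  assumes [measurable]: "g \<in> borel_measurable M" and f: "f \<in> L2 M"
    and le: "\<And>x. x \<in> space M \<Longrightarrow> cmod (g x) \<le> C * cmod (f x)"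
  shows "g \<in> L2 M" "0 \<le> C \<Longrightarrow> L2_norm M g \<le> C * L2_norm M f"
proof -
  have sq: "(cmod (g x))\<^sup>2 \<le> C\<^sup>2 * (cmod (f x))\<^sup>2" if "x \<in> space M" for x
    using power_mono[OF le[OF that], of 2] by (simp add: power_mult_distrib)
  have i: "integrable M (\<lambda>x. C\<^sup>2 * (cmod (f x))\<^sup>2)"
    using L2_D(2)[OF f] by simp
  have ig: "integrable M (\<lambda>x. (cmod (g x))\<^sup>2)"
    by (rule Bochner_Integration.integrable_bound[OF i]) (auto intro!: AE_I2 sq)
  then show "g \<in> L2 M" by (auto simp: L2_def)
  assume C: "0 \<le> C"
  have "(LINT x|M. (cmod (g x))\<^sup>2) \<le> (LINT x|M. C\<^sup>2 * (cmod (f x))\<^sup>2)"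
    by (rule integral_mono[OF ig i]) (use sq in auto)
  then have "L2_norm M g \<le> sqrt (C\<^sup>2 * (LINT x|M. (cmod (f x))\<^sup>2))"
    by (simp add: L2_norm_def)
  then show "L2_norm M g \<le> C * L2_norm M f"
    using C by (simp add: L2_norm_def real_sqrt_mult)
qed

lemma L2_norm_nonneg [simp]: "0 \<le> L2_norm M f"
  by (simp add: L2_norm_def)

lemma L2_norm_sq: "(L2_norm M f)\<^sup>2 = (LINT x|M. (cmod (f x))\<^sup>2)"
  by (simp add: L2_norm_def)

lemma L2_scale: "f \<in> L2 M \<Longrightarrow> (\<lambda>x. c * f x) \<in> L2 M"
  by (rule L2_dominated(1)[where C="cmod c" and f=f]) (auto simp: norm_mult L2_D)

lemma L2_norm_scale: "L2_norm M (\<lambda>x. c * f x) = cmod c * L2_norm M f"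
  by (simp add: L2_norm_def norm_mult power_mult_distrib real_sqrt_mult)

lemma L2_add:
  assumes f: "f \<in> L2 M" and g: "g \<in> L2 M"
  shows "(\<lambda>x. f x + g x) \<in> L2 M"
proof -
  note [measurable] = L2_D(1)[OF f] L2_D(1)[OF g]
  have i: "integrable M (\<lambda>x. 2 * (cmod (f x))\<^sup>2 + 2 * (cmod (g x))\<^sup>2)"
    using L2_D(2)[OF f] L2_D(2)[OF g] by simp
  have "(cmod (f x + g x))\<^sup>2 \<le> 2 * (cmod (f x))\<^sup>2 + 2 * (cmod (g x))\<^sup>2" for x
    using power_mono[OF norm_triangle_ineq[of "f x" "g x"], of 2]
      sum_squares_bound[of "cmod (f x)" "cmod (g x)"] by (simp add: power2_sum)
  then have "integrable M (\<lambda>x. (cmod (f x + g x))\<^sup>2)"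
    by (intro Bochner_Integration.integrable_bound[OF i]) auto
  then show ?thesis by (simp add: L2_def)
qed

lemma L2_diff: "f \<in> L2 M \<Longrightarrow> g \<in> L2 M \<Longrightarrow> (\<lambda>x. f x - g x) \<in> L2 M"
  using L2_add[of f M "\<lambda>x. (-1) * g x"] L2_scale[of g M "-1"] by simp

lemma L2_norm_minus: "L2_norm M (\<lambda>x. f x - g x) = L2_norm M (\<lambda>x. g x - f x)"
  by (simp add: L2_norm_def norm_minus_commute)

lemma L2_zero [simp]: "(\<lambda>x. 0) \<in> L2 M"
  by (simp add: L2_def)

section \<open>Cauchy-Schwarz, triangle inequality, sesquilinearity and completeness\<close>

lemma integrable_L2_cmod:
  assumes f: "f \<in> L2 M" and g: "g \<in> L2 M"
  shows "integrable M (\<lambda>x. cmod (f x) * cmod (g x))"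
proof -
  note [measurable] = L2_D(1)[OF f] L2_D(1)[OF g]
  have i: "integrable M (\<lambda>x. (cmod (f x))\<^sup>2 + (cmod (g x))\<^sup>2)"
    using L2_D(2)[OF f] L2_D(2)[OF g] by simp
  have "cmod (f x) * cmod (g x) \<le> (cmod (f x))\<^sup>2 + (cmod (g x))\<^sup>2" for x
    using sum_squares_bound[of "cmod (f x)" "cmod (g x)"] mult_nonneg_nonneg[of "cmod (f x)" "cmod (g x)"]
    using norm_ge_zero[of "f x"] norm_ge_zero[of "g x"] by linarith
  then show ?thesis
    by (intro Bochner_Integration.integrable_bound[OF i]) auto
qed

lemma integrable_L2_mult:
  assumes f: "f \<in> L2 M" and g: "g \<in> L2 M"
  shows "integrable M (\<lambda>x. f x * cnj (g x))"
proof -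
  note [measurable] = L2_D(1)[OF f] L2_D(1)[OF g]
  have "(\<lambda>x. cnj (g x)) \<in> borel_measurable M"
    by (rule borel_measurable_continuous_on[OF _ L2_D(1)[OF g], of cnj]) (auto intro!: continuous_intros)
  then show ?thesis
    by (intro Bochner_Integration.integrable_bound[OF integrable_L2_cmod[OF f g]]) (auto simp: norm_mult)
qed

text \<open>Discriminant criterion, shared by the Cauchy-Schwarz inequality and by the defect bound
  for near-minimizers in the existence proof. The leading coefficient may vanish in both uses, so
  \<open>a = 0\<close> is included.\<close>

lemma square_le_mult_if_quadratic_nonneg:
  fixes a b c :: real
  assumes q: "\<And>t. 0 \<le> t\<^sup>2 * a - 2 * t * c + b" and "0 \<le> a" and "0 \<le> b"
  shows "c\<^sup>2 \<le> a * b"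
proof (cases "a = 0")
  case True
  have "c = 0"
  proof (rule ccontr)
    assume "c \<noteq> 0"
    \<comment> \<open>For \<open>a = 0\<close> the polynomial is affine; at this argument it equals
      \<open>- b - 2\<close>.\<close>
    then show False using q[of "(b + 1) / c"] True \<open>0 \<le> b\<close> by simp
  qed
  then show ?thesis using True by simp
next
  case False
  then have a: "a > 0" using assms(2) by simp
  \<comment> \<open>The minimum lies at \<open>t = c / a\<close>; the factor \<open>a\<close> clears
    the denominator.\<close>
  have "0 \<le> ((c / a)\<^sup>2 * a - 2 * (c / a) * c + b) * a"
    using q[of "c / a"] a by simp
  also have "\<dots> = a * b - c\<^sup>2"
    using a by (simp add: power2_eq_square field_simps)
  finally show ?thesis by simp
qed

lemma integral_cmod_mult_le:
  assumes f: "f \<in> L2 M" and g: "g \<in> L2 M"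
  shows "(LINT x|M. cmod (f x) * cmod (g x)) \<le> L2_norm M f * L2_norm M g"
proof -
  let ?a = "LINT x|M. (cmod (f x))\<^sup>2" and ?b = "LINT x|M. (cmod (g x))\<^sup>2"
  let ?c = "LINT x|M. cmod (f x) * cmod (g x)"
  note i = L2_D(2)[OF f] L2_D(2)[OF g] integrable_L2_cmod[OF f g]
  have q: "0 \<le> t\<^sup>2 * ?a - 2 * t * ?c + ?b" for t :: real
  proof -
    have "0 \<le> (LINT x|M. (t * cmod (f x) - cmod (g x))\<^sup>2)" by (rule integral_nonneg_AE) auto
    also have "\<dots> = (LINT x|M. t\<^sup>2 * (cmod (f x))\<^sup>2 - 2 * t * (cmod (f x) * cmod (g x)) + (cmod (g x))\<^sup>2)"
      by (rule Bochner_Integration.integral_cong) (auto simp: power2_eq_square algebra_simps)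
    also have "\<dots> = t\<^sup>2 * ?a - 2 * t * ?c + ?b"
      using i by simp
    finally show ?thesis .
  qed
  have a0: "0 \<le> ?a" and b0: "0 \<le> ?b" and c0: "0 \<le> ?c" by (auto intro!: integral_nonneg_AE)
  have "?c\<^sup>2 \<le> ?a * ?b"
    by (rule square_le_mult_if_quadratic_nonneg[OF q a0 b0])
  then have "sqrt (?c\<^sup>2) \<le> sqrt (?a * ?b)" by (rule real_sqrt_le_mono)
  then show ?thesis using c0 by (simp add: L2_norm_def real_sqrt_mult)
qed

lemma cmod_L2_inner_le:
  assumes f: "f \<in> L2 M" and g: "g \<in> L2 M"
  shows "cmod (L2_inner M f g) \<le> L2_norm M f * L2_norm M g"
proof -
  have "cmod (L2_inner M f g) \<le> (LINT x|M. cmod (f x * cnj (g x)))"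
    unfolding L2_inner_def by (rule integral_norm_bound)
  then show ?thesis using integral_cmod_mult_le[OF f g] by (simp add: norm_mult)
qed

lemma L2_norm_triangle:
  assumes f: "f \<in> L2 M" and g: "g \<in> L2 M"
  shows "L2_norm M (\<lambda>x. f x + g x) \<le> L2_norm M f + L2_norm M g"
proof (rule power2_le_imp_le)
  have "(L2_norm M (\<lambda>x. f x + g x))\<^sup>2 \<le>
      (LINT x|M. (cmod (f x))\<^sup>2 + (cmod (g x))\<^sup>2 + 2 * (cmod (f x) * cmod (g x)))"
    unfolding L2_norm_sq
  proof (rule integral_mono)
    show "(cmod (f x + g x))\<^sup>2 \<le> (cmod (f x))\<^sup>2 + (cmod (g x))\<^sup>2 + 2 * (cmod (f x) * cmod (g x))" for x
      using power_mono[OF norm_triangle_ineq[of "f x" "g x"], of 2] by (simp add: power2_sum)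
  qed (use L2_D(2)[OF L2_add[OF f g]] L2_D(2)[OF f] L2_D(2)[OF g] integrable_L2_cmod[OF f g] in auto)
  also have "\<dots> = (L2_norm M f)\<^sup>2 + (L2_norm M g)\<^sup>2 + 2 * (LINT x|M. cmod (f x) * cmod (g x))"
    using L2_D(2)[OF f] L2_D(2)[OF g] integrable_L2_cmod[OF f g] by (simp add: L2_norm_sq)
  also have "\<dots> \<le> (L2_norm M f + L2_norm M g)\<^sup>2"
    using integral_cmod_mult_le[OF f g] by (simp add: power2_sum)
  finally show "(L2_norm M (\<lambda>x. f x + g x))\<^sup>2 \<le> (L2_norm M f + L2_norm M g)\<^sup>2" .
qed simp

lemma L2_norm_triangle_diff:
  assumes f: "f \<in> L2 M" and g: "g \<in> L2 M"
  shows "L2_norm M (\<lambda>x. f x - g x) \<le> L2_norm M f + L2_norm M g"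
  using L2_norm_triangle[OF f L2_scale[OF g, of "-1"]] L2_norm_scale[of M "-1" g] by simp

lemma L2_norm_triangle_sub:
  assumes f: "f \<in> L2 M" and g: "g \<in> L2 M"
  shows "L2_norm M f \<le> L2_norm M g + L2_norm M (\<lambda>x. f x - g x)"
  using L2_norm_triangle[OF g L2_diff[OF f g]] by simp

lemma L2_inner_add_left:
  "f \<in> L2 M \<Longrightarrow> g \<in> L2 M \<Longrightarrow> h \<in> L2 M \<Longrightarrow>
    L2_inner M (\<lambda>x. f x + g x) h = L2_inner M f h + L2_inner M g h"
  unfolding L2_inner_def by (simp add: distrib_right integrable_L2_mult)

lemma L2_inner_scale_left: "L2_inner M (\<lambda>x. c * f x) h = c * L2_inner M f h"
  unfolding L2_inner_def by (simp add: mult.assoc)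

lemma L2_inner_cnj: "cnj (L2_inner M f g) = L2_inner M g f"
  unfolding L2_inner_def Bochner_Integration.integral_cnj[symmetric] by (simp add: mult.commute)

lemma L2_inner_diff_left:
  "f \<in> L2 M \<Longrightarrow> g \<in> L2 M \<Longrightarrow> h \<in> L2 M \<Longrightarrow>
    L2_inner M (\<lambda>x. f x - g x) h = L2_inner M f h - L2_inner M g h"
  unfolding L2_inner_def by (simp add: left_diff_distrib integrable_L2_mult)

lemma L2_inner_add_right:
  "f \<in> L2 M \<Longrightarrow> g \<in> L2 M \<Longrightarrow> h \<in> L2 M \<Longrightarrow>
    L2_inner M h (\<lambda>x. f x + g x) = L2_inner M h f + L2_inner M h g"
  unfolding L2_inner_def by (simp add: distrib_left integrable_L2_mult)

lemma L2_inner_diff_right: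
  "f \<in> L2 M \<Longrightarrow> g \<in> L2 M \<Longrightarrow> h \<in> L2 M \<Longrightarrow>
    L2_inner M h (\<lambda>x. f x - g x) = L2_inner M h f - L2_inner M h g"
  unfolding L2_inner_def by (simp add: right_diff_distrib integrable_L2_mult)

lemma L2_inner_scale_right: "L2_inner M h (\<lambda>x. c * f x) = cnj c * L2_inner M h f"
  unfolding L2_inner_def by (simp add: mult.assoc mult.left_commute)

lemma L2_inner_self: "L2_inner M f f = of_real ((L2_norm M f)\<^sup>2)"
  unfolding L2_inner_def L2_norm_sq integral_complex_of_real[symmetric]
  by (simp only: complex_norm_square)

lemma L2_inner_cong_AE:
  assumes f: "f \<in> L2 M" and g: "g \<in> L2 M" and h: "h \<in> L2 M" and ae: "AE x in M. f x = g x"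
  shows "L2_inner M f h = L2_inner M g h"
  unfolding L2_inner_def
  by (rule integral_cong_AE)
    (use ae integrable_L2_mult[OF f h] integrable_L2_mult[OF g h] in \<open>auto dest: borel_measurable_integrable\<close>)

lemma L2_norm_eq_0_AE:
  assumes f: "f \<in> L2 M" and "L2_norm M f = 0"
  shows "AE x in M. f x = 0"
proof -
  have "(LINT x|M. (cmod (f x))\<^sup>2) = 0" using assms(2) by (simp add: L2_norm_def)
  then have "AE x in M. (cmod (f x))\<^sup>2 = 0"
    using integral_nonneg_eq_0_iff_AE[OF L2_D(2)[OF f]] by simp
  then show ?thesis by simp
qed

lemma nn_integral_L2:
  "f \<in> L2 M \<Longrightarrow> (\<integral>\<^sup>+x. ennreal ((cmod (f x))\<^sup>2) \<partial>M) = ennreal ((L2_norm M f)\<^sup>2)"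
  unfolding L2_norm_sq by (rule nn_integral_eq_integral) (auto simp: L2_D)

text \<open>Riesz-Fischer: along a subsequence with increments of norm below \<open>(1/4)^k\<close>,
  the sum of \<open>4^k\<close> times the squared increments has finite integral, so almost
  everywhere the increments decay geometrically. Fatou's lemma turns the pointwise limit into a
  limit in norm.\<close>

lemma L2_complete:
  assumes f: "\<And>n. f n \<in> L2 M"
    and cau: "\<And>\<epsilon>. \<epsilon> > 0 \<Longrightarrow> \<exists>N. \<forall>m\<ge>N. \<forall>n\<ge>N. L2_norm M (\<lambda>x. f m x - f n x) < \<epsilon>"
  shows "\<exists>u\<in>L2 M. (\<lambda>n. L2_norm M (\<lambda>x. f n x - u x)) \<longlonglongrightarrow> 0"
proof -
  note [measurable] = L2_D(1)[OF f]
  have "\<forall>k. \<exists>N. \<forall>m\<ge>N. \<forall>n\<ge>N. L2_norm M (\<lambda>x. f m x - f n x) < (1/4)^k"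
    using cau by auto
  then obtain N where N: "\<And>k m n. m \<ge> N k \<Longrightarrow> n \<ge> N k \<Longrightarrow> L2_norm M (\<lambda>x. f m x - f n x) < (1/4)^k"
    by metis
  \<comment> \<open>The partial sums put both \<open>r k\<close> and \<open>r (Suc k)\<close> beyond
    \<open>N k\<close>; the summand \<open>k\<close> ensures \<open>k \<le> r k\<close>.\<close>
  define r where "r = (\<lambda>k. k + (\<Sum>j\<le>k. N j))"
  have rN: "N k \<le> r k" for k
    unfolding r_def using member_le_sum[of k "{..k}" N] by (simp add: trans_le_add2)
  have rS: "N k \<le> r (Suc k)" for k
    using rN[of k] by (simp add: r_def)
  have rk: "k \<le> r k" for k by (simp add: r_def)
  define d where "d = (\<lambda>k x. f (r (Suc k)) x - f (r k) x)"
  have dL: "d k \<in> L2 M" for k unfolding d_def by (intro L2_diff f)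
  note [measurable] = L2_D(1)[OF dL]
  have dn: "(L2_norm M (d k))\<^sup>2 \<le> (1/16)^k" for k
  proof -
    have "L2_norm M (d k) \<le> (1/4)^k" unfolding d_def using N[OF rS rN, of k] by simp
    then have "(L2_norm M (d k))\<^sup>2 \<le> ((1/4)^k)\<^sup>2" by (rule power_mono) simp
    also have "((1/4::real)^k)\<^sup>2 = (1/16)^k"
      by (subst power_mult[symmetric], subst mult.commute, subst power_mult) (simp add: power2_eq_square)
    finally show ?thesis .
  qed
  have "(\<integral>\<^sup>+x. (\<Sum>k. ennreal (4^k * (cmod (d k x))\<^sup>2)) \<partial>M)
      = (\<Sum>k. \<integral>\<^sup>+x. ennreal (4^k * (cmod (d k x))\<^sup>2) \<partial>M)"
    by (rule nn_integral_suminf) measurable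
  also have "\<dots> = (\<Sum>k. ennreal (4^k) * ennreal ((L2_norm M (d k))\<^sup>2))"
    by (simp add: ennreal_mult nn_integral_cmult nn_integral_L2[OF dL])
  also have "\<dots> \<le> (\<Sum>k. ennreal ((1/4)^k))"
  proof (rule suminf_le)
    show "ennreal (4^k) * ennreal ((L2_norm M (d k))\<^sup>2) \<le> ennreal ((1/4)^k)" for k
    proof -
      have "4^k * (L2_norm M (d k))\<^sup>2 \<le> 4^k * (1/16)^k" using dn[of k] by simp
      also have "\<dots> = (1/4)^k" by (subst power_mult_distrib[symmetric]) simp
      finally have "ennreal (4^k * (L2_norm M (d k))\<^sup>2) \<le> ennreal ((1/4)^k)"
        by (rule ennreal_leI)
      then show ?thesis by (subst ennreal_mult[symmetric]) auto
    qed
  qed (rule summableI)+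
  also have "(\<Sum>k. ennreal ((1/4)^k)) = ennreal (1 / (1 - 1/4))"
    by (rule suminf_ennreal_eq) (simp, rule geometric_sums, simp)
  also have "\<dots> < \<infinity>" by simp
  finally have "AE x in M. (\<Sum>k. ennreal (4^k * (cmod (d k x))\<^sup>2)) \<noteq> \<infinity>"
    by (intro nn_integral_PInf_AE) auto
  then have conv: "AE x in M. convergent (\<lambda>k. f (r k) x)"
  proof eventually_elim
    case (elim x)
    define S where "S = (\<Sum>k. ennreal (4^k * (cmod (d k x))\<^sup>2))"
    have "S \<noteq> \<infinity>" using elim unfolding S_def .
    then obtain C where C: "S = ennreal C" "C \<ge> 0"
      by (cases S) auto
    have b: "cmod (d k x) \<le> sqrt C * (1/2)^k" for k
    proof (rule power2_le_imp_le)
      have "sum (\<lambda>k. ennreal (4^k * (cmod (d k x))\<^sup>2)) {k} \<le> S"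
        unfolding S_def by (rule sum_le_suminf[OF summableI]) auto
      then have "ennreal (4^k * (cmod (d k x))\<^sup>2) \<le> ennreal C" unfolding C(1) by simp
      then have "4^k * (cmod (d k x))\<^sup>2 \<le> C" using C(2) ennreal_le_iff by blast
      moreover have "((1/2::real)^k)\<^sup>2 = 1 / 4^k"
        by (subst power_mult[symmetric], subst mult.commute, subst power_mult)
          (simp add: power2_eq_square power_one_over)
      ultimately show "(cmod (d k x))\<^sup>2 \<le> (sqrt C * (1/2)^k)\<^sup>2"
        using C(2) by (simp add: power_mult_distrib field_simps)
    qed (use C in simp)
    have "summable (\<lambda>k. d k x)"
      by (rule summable_comparison_test'[where g="\<lambda>k. sqrt C * (1/2)^k" and N=0])
        (use b in \<open>auto intro!: summable_mult summable_geometric\<close>)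
    then have "(\<lambda>n. \<Sum>k<n. d k x) \<longlonglongrightarrow> suminf (\<lambda>k. d k x)" by (rule summable_LIMSEQ)
    moreover have "(\<Sum>k<n. d k x) = f (r n) x - f (r 0) x" for n
      unfolding d_def by (rule sum_lessThan_telescope[of "\<lambda>k. f (r k) x"])
    ultimately have "(\<lambda>n. f (r n) x - f (r 0) x) \<longlonglongrightarrow> suminf (\<lambda>k. d k x)" by simp
    from tendsto_add[OF this tendsto_const[of "f (r 0) x"]]
    have "(\<lambda>n. f (r n) x) \<longlonglongrightarrow> suminf (\<lambda>k. d k x) + f (r 0) x" by simp
    then show ?case by (auto simp: convergent_def)
  qed
  define u where "u = (\<lambda>x. lim (\<lambda>k. f (r k) x))"
  have um[measurable]: "u \<in> borel_measurable M" unfolding u_def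
    by (rule borel_measurable_lim_metric) simp
  have lim: "AE x in M. (\<lambda>k. f (r k) x) \<longlonglongrightarrow> u x"
    using conv by eventually_elim (simp add: u_def convergent_LIMSEQ_iff)
  \<comment> \<open>Only the index \<open>m\<close> is sent to infinity along the subsequence;
    \<open>n\<close> remains an arbitrary index, so the full sequence converges.\<close>
  have fatou: "(\<integral>\<^sup>+x. ennreal ((cmod (f n x - u x))\<^sup>2) \<partial>M) \<le> ennreal (\<epsilon>\<^sup>2)"
    if \<epsilon>: "\<epsilon> \<ge> 0" "\<And>m. m \<ge> K \<Longrightarrow> L2_norm M (\<lambda>x. f n x - f m x) \<le> \<epsilon>" for n K \<epsilon>
  proof -
    have "(\<integral>\<^sup>+x. ennreal ((cmod (f n x - u x))\<^sup>2) \<partial>M)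
        = (\<integral>\<^sup>+x. liminf (\<lambda>k. ennreal ((cmod (f n x - f (r k) x))\<^sup>2)) \<partial>M)"
    proof (rule nn_integral_cong_AE, use lim in eventually_elim)
      case (elim x)
      then have "(\<lambda>k. ennreal ((cmod (f n x - f (r k) x))\<^sup>2)) \<longlonglongrightarrow> ennreal ((cmod (f n x - u x))\<^sup>2)"
        by (intro tendsto_intros)
      then show ?case by (intro lim_imp_Liminf[symmetric]) auto
    qed
    also have "\<dots> \<le> liminf (\<lambda>k. \<integral>\<^sup>+x. ennreal ((cmod (f n x - f (r k) x))\<^sup>2) \<partial>M)"
      by (rule nn_integral_liminf) simp
    also have "\<dots> \<le> ennreal (\<epsilon>\<^sup>2)"
    proof (rule Liminf_le)
      have "(\<integral>\<^sup>+x. ennreal ((cmod (f n x - f (r k) x))\<^sup>2) \<partial>M) \<le> ennreal (\<epsilon>\<^sup>2)" if "k \<ge> K" for k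
        unfolding nn_integral_L2[OF L2_diff[OF f f], of n "r k"]
        by (intro ennreal_leI power_mono \<epsilon>(2)) (use rk[of k] that in auto)
      then show "\<forall>\<^sub>F k in sequentially. (\<integral>\<^sup>+x. ennreal ((cmod (f n x - f (r k) x))\<^sup>2) \<partial>M) \<le> ennreal (\<epsilon>\<^sup>2)"
        by (auto simp: eventually_sequentially)
    qed simp
    finally show ?thesis .
  qed
  have est: "(\<lambda>x. f n x - u x) \<in> L2 M \<and> L2_norm M (\<lambda>x. f n x - u x) \<le> \<epsilon>"
    if \<epsilon>: "\<epsilon> \<ge> 0" "\<And>m. m \<ge> K \<Longrightarrow> L2_norm M (\<lambda>x. f n x - f m x) \<le> \<epsilon>" for n K \<epsilon>
  proof -
    have le: "(\<integral>\<^sup>+x. ennreal ((cmod (f n x - u x))\<^sup>2) \<partial>M) \<le> ennreal (\<epsilon>\<^sup>2)"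
      using fatou[of \<epsilon> K n] \<epsilon> by blast
    have "integrable M (\<lambda>x. (cmod (f n x - u x))\<^sup>2)"
      by (rule integrableI_bounded) (use le_less_trans[OF le] in auto)
    then have L: "(\<lambda>x. f n x - u x) \<in> L2 M" by (simp add: L2_def)
    have "(L2_norm M (\<lambda>x. f n x - u x))\<^sup>2 \<le> \<epsilon>\<^sup>2"
      using le unfolding nn_integral_L2[OF L] by (simp add: ennreal_le_iff)
    then show ?thesis using L \<epsilon>(1) power2_le_imp_le by blast
  qed
  have "(\<lambda>x. f (N 0) x - u x) \<in> L2 M"
    using est[of 1 "N 0" "N 0"] N[of 0 "N 0"] by (auto simp: less_imp_le)
  from L2_diff[OF f[of "N 0"] this] have uL: "u \<in> L2 M" by simp
  have "(\<lambda>n. L2_norm M (\<lambda>x. f n x - u x)) \<longlonglongrightarrow> 0"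
  proof (rule LIMSEQ_I)
    fix \<epsilon> :: real assume e: "\<epsilon> > 0"
    from cau[of "\<epsilon>/2"] e obtain K where K: "\<And>m n. m \<ge> K \<Longrightarrow> n \<ge> K \<Longrightarrow> L2_norm M (\<lambda>x. f m x - f n x) < \<epsilon>/2"
      by auto
    have "L2_norm M (\<lambda>x. f n x - u x) < \<epsilon>" if "n \<ge> K" for n
      using est[of "\<epsilon>/2" K n] K[OF that] e by (force simp: less_imp_le)
    then show "\<exists>no. \<forall>n\<ge>no. norm (L2_norm M (\<lambda>x. f n x - u x) - 0) < \<epsilon>" by auto
  qed
  with uL show ?thesis by blast
qed

section \<open>Resolvents of Friedrichs extensions\<close>

lemma L2_inner_tendsto:
  assumes \<phi>: "\<And>n. \<phi> n \<in> L2 M" "u \<in> L2 M" "(\<lambda>n. L2_norm M (\<lambda>x. \<phi> n x - u x)) \<longlonglongrightarrow> 0"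
    and \<psi>: "\<And>n. \<psi> n \<in> L2 M" "v \<in> L2 M" "(\<lambda>n. L2_norm M (\<lambda>x. \<psi> n x - v x)) \<longlonglongrightarrow> 0"
  shows "(\<lambda>n. L2_inner M (\<phi> n) (\<psi> n)) \<longlonglongrightarrow> L2_inner M u v"
proof -
  let ?a = "\<lambda>n. L2_norm M (\<lambda>x. \<phi> n x - u x)" and ?b = "\<lambda>n. L2_norm M (\<lambda>x. \<psi> n x - v x)"
  have "cmod (L2_inner M (\<phi> n) (\<psi> n) - L2_inner M u v)
      \<le> ?a n * ?b n + ?a n * L2_norm M v + L2_norm M u * ?b n" for n
  proof -
    have d: "(\<lambda>x. \<phi> n x - u x) \<in> L2 M" "(\<lambda>x. \<psi> n x - v x) \<in> L2 M" by (intro L2_diff \<phi> \<psi>)+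
    have eq: "L2_inner M (\<phi> n) (\<psi> n) - L2_inner M u v =
        L2_inner M (\<lambda>x. \<phi> n x - u x) (\<lambda>x. \<psi> n x - v x)
        + L2_inner M (\<lambda>x. \<phi> n x - u x) v + L2_inner M u (\<lambda>x. \<psi> n x - v x)"
      using \<phi>(1,2) \<psi>(1,2) d
      by (simp add: L2_inner_diff_left L2_inner_diff_right)
    have "cmod (L2_inner M (\<phi> n) (\<psi> n) - L2_inner M u v) \<le> cmod (L2_inner M (\<lambda>x. \<phi> n x - u x) (\<lambda>x. \<psi> n x - v x))
        + cmod (L2_inner M (\<lambda>x. \<phi> n x - u x) v) + cmod (L2_inner M u (\<lambda>x. \<psi> n x - v x))"
      unfolding eq by (rule order_trans[OF norm_triangle_ineq add_right_mono[OF norm_triangle_ineq]])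
    also have "\<dots> \<le> ?a n * ?b n + ?a n * L2_norm M v + L2_norm M u * ?b n"
      by (intro add_mono cmod_L2_inner_le d \<phi> \<psi>)
    finally show ?thesis .
  qed
  moreover have "(\<lambda>n. ?a n * ?b n + ?a n * L2_norm M v + L2_norm M u * ?b n) \<longlonglongrightarrow> 0"
    using tendsto_add[OF tendsto_add[OF tendsto_mult[OF \<phi>(3) \<psi>(3)] tendsto_mult_right[OF \<phi>(3), of "L2_norm M v"]]
        tendsto_mult_left[OF \<psi>(3), of "L2_norm M u"]] by simp
  ultimately have "(\<lambda>n. L2_inner M (\<phi> n) (\<psi> n) - L2_inner M u v) \<longlonglongrightarrow> 0"
    by (intro Lim_null_comparison[where f="\<lambda>n. L2_inner M (\<phi> n) (\<psi> n) - L2_inner M u v"])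
      (auto intro: always_eventually)
  then show ?thesis by (rule LIM_zero_cancel)
qed

lemma L2_norm_tendsto:
  assumes \<phi>: "\<And>n. \<phi> n \<in> L2 M" "u \<in> L2 M" "(\<lambda>n. L2_norm M (\<lambda>x. \<phi> n x - u x)) \<longlonglongrightarrow> 0"
  shows "(\<lambda>n. L2_norm M (\<phi> n)) \<longlonglongrightarrow> L2_norm M u"
proof -
  have "\<bar>L2_norm M (\<phi> n) - L2_norm M u\<bar> \<le> L2_norm M (\<lambda>x. \<phi> n x - u x)" for n
    using L2_norm_triangle_sub[OF \<phi>(1)[of n] \<phi>(2)] L2_norm_triangle_sub[OF \<phi>(2) \<phi>(1)[of n]]
    by (simp add: L2_norm_minus[of M u] abs_le_iff)
  then have "(\<lambda>n. L2_norm M (\<phi> n) - L2_norm M u) \<longlonglongrightarrow> 0"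
    by (intro Lim_null_comparison[OF _ \<phi>(3)]) (auto intro: always_eventually)
  then show ?thesis by (rule LIM_zero_cancel)
qed

text \<open>The abstract setting of the Friedrichs construction. Linearity of \<open>A\<close> is
  equality of functions, not just almost everywhere, so sums can be rewritten inside the
  form.\<close>

locale nonneg_form =
  fixes M :: "'a measure" and D :: "('a \<Rightarrow> complex) set" and A :: "('a \<Rightarrow> complex) \<Rightarrow> ('a \<Rightarrow> complex)"
  assumes D_L2: "\<phi> \<in> D \<Longrightarrow> \<phi> \<in> L2 M"
    and A_L2: "\<phi> \<in> D \<Longrightarrow> A \<phi> \<in> L2 M"
    and D_zero: "(\<lambda>x. 0) \<in> D"
    and D_add: "\<phi> \<in> D \<Longrightarrow> \<psi> \<in> D \<Longrightarrow> (\<lambda>x. \<phi> x + \<psi> x) \<in> D"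
    and D_scale: "\<phi> \<in> D \<Longrightarrow> (\<lambda>x. c * \<phi> x) \<in> D"
    and A_add: "\<phi> \<in> D \<Longrightarrow> \<psi> \<in> D \<Longrightarrow> A (\<lambda>x. \<phi> x + \<psi> x) = (\<lambda>x. A \<phi> x + A \<psi> x)"
    and A_scale: "\<phi> \<in> D \<Longrightarrow> A (\<lambda>x. c * \<phi> x) = (\<lambda>x. c * A \<phi> x)"
    and A_sym: "\<phi> \<in> D \<Longrightarrow> \<psi> \<in> D \<Longrightarrow> L2_inner M (A \<phi>) \<psi> = cnj (L2_inner M (A \<psi>) \<phi>)"
    and A_nonneg: "\<phi> \<in> D \<Longrightarrow> 0 \<le> Re (L2_inner M (A \<phi>) \<phi>)"
begin

abbreviation q where "q \<phi> \<psi> \<equiv> L2_inner M (A \<phi>) \<psi>"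
abbreviation Q where "Q \<phi> \<equiv> Re (q \<phi> \<phi>)"

lemma D_diff: "\<phi> \<in> D \<Longrightarrow> \<psi> \<in> D \<Longrightarrow> (\<lambda>x. \<phi> x - \<psi> x) \<in> D"
  using D_add[of \<phi> "\<lambda>x. (-1) * \<psi> x"] D_scale[of \<psi> "-1"] by simp

lemma A_diff: "\<phi> \<in> D \<Longrightarrow> \<psi> \<in> D \<Longrightarrow> A (\<lambda>x. \<phi> x - \<psi> x) = (\<lambda>x. A \<phi> x - A \<psi> x)"
  using A_add[of \<phi> "\<lambda>x. (-1) * \<psi> x"] D_scale[of \<psi> "-1"] A_scale[of \<psi> "-1"] by simp

lemma q_self: "\<phi> \<in> D \<Longrightarrow> q \<phi> \<phi> = of_real (Q \<phi>)"
  using A_sym[of \<phi> \<phi>] by (metis Reals_cnj_iff complex_is_Real_iff of_real_Re)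

lemma cmod_q_self: "\<phi> \<in> D \<Longrightarrow> cmod (q \<phi> \<phi>) = Q \<phi>"
  using q_self[of \<phi>] A_nonneg[of \<phi>] by (metis abs_of_nonneg norm_of_real)

lemma q_bilinear:
  assumes "\<phi> \<in> D" "\<psi> \<in> D" "\<eta> \<in> D"
  shows "q (\<lambda>x. \<phi> x + \<psi> x) \<eta> = q \<phi> \<eta> + q \<psi> \<eta>" "q (\<lambda>x. \<phi> x - \<psi> x) \<eta> = q \<phi> \<eta> - q \<psi> \<eta>"
    "q \<eta> (\<lambda>x. \<phi> x + \<psi> x) = q \<eta> \<phi> + q \<eta> \<psi>" "q \<eta> (\<lambda>x. \<phi> x - \<psi> x) = q \<eta> \<phi> - q \<eta> \<psi>"
    "q (\<lambda>x. c * \<phi> x) \<eta> = c * q \<phi> \<eta>" "q \<eta> (\<lambda>x. c * \<phi> x) = cnj c * q \<eta> \<phi>"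
  using assms
  by (simp_all add: A_add A_diff A_scale D_L2 A_L2 L2_inner_add_left L2_inner_diff_left
      L2_inner_add_right L2_inner_diff_right L2_inner_scale_left L2_inner_scale_right)

text \<open>Parallelogram law, with the nonnegative form of the difference dropped.\<close>

lemma Q_add_le:
  assumes "\<phi> \<in> D" "\<psi> \<in> D"
  shows "Q (\<lambda>x. \<phi> x + \<psi> x) \<le> 2 * Q \<phi> + 2 * Q \<psi>"
  using A_nonneg[OF D_diff[OF assms]] assms by (simp add: q_bilinear D_add D_diff)

lemma Q_scale: "\<phi> \<in> D \<Longrightarrow> Q (\<lambda>x. c * \<phi> x) = (cmod c)\<^sup>2 * Q \<phi>"
  by (simp add: q_bilinear D_scale mult.assoc[symmetric] complex_norm_square[symmetric] del: of_real_power)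

section \<open>Approximating sequences and weak solutions\<close>

abbreviation fa where "fa \<equiv> form_approx M D A"

lemma fa_D:
  assumes "fa \<phi> u"
  shows "u \<in> L2 M" "\<phi> n \<in> D" "\<phi> n \<in> L2 M" "(\<lambda>n. L2_norm M (\<lambda>x. \<phi> n x - u x)) \<longlonglongrightarrow> 0"
  using assms D_L2 by (auto simp: form_approx_def)

lemma fa_Cauchy:
  assumes "fa \<phi> u" "\<epsilon> > 0"
  shows "\<exists>N. \<forall>m\<ge>N. \<forall>n\<ge>N. Q (\<lambda>x. \<phi> m x - \<phi> n x) < \<epsilon>"
  using assms cmod_q_self[OF D_diff[OF fa_D(2) fa_D(2), OF assms(1) assms(1)]] by (auto simp: form_approx_def)

lemma fa_I:
  assumes "u \<in> L2 M" "\<And>n. \<phi> n \<in> D" "(\<lambda>n. L2_norm M (\<lambda>x. \<phi> n x - u x)) \<longlonglongrightarrow> 0"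
    "\<And>\<epsilon>. \<epsilon> > 0 \<Longrightarrow> \<exists>N. \<forall>m\<ge>N. \<forall>n\<ge>N. Q (\<lambda>x. \<phi> m x - \<phi> n x) < \<epsilon>"
  shows "fa \<phi> u"
  using assms cmod_q_self[OF D_diff] by (auto simp: form_approx_def)

text \<open>Late members are compared with the fixed member \<open>\<phi> N1\<close>, so the bound
  holds from some index on.\<close>

lemma fa_bounded:
  assumes "fa \<phi> u"
  shows "\<exists>B N. \<forall>n\<ge>N. Q (\<phi> n) + (L2_norm M (\<phi> n))\<^sup>2 \<le> B"
proof -
  obtain N1 where N1: "\<And>n. n \<ge> N1 \<Longrightarrow> Q (\<lambda>x. \<phi> n x - \<phi> N1 x) < 1"
    using fa_Cauchy[OF assms, of 1] by auto
  have "(\<lambda>n. L2_norm M (\<phi> n)) \<longlonglongrightarrow> L2_norm M u"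
    by (rule L2_norm_tendsto) (use fa_D[OF assms] in auto)
  from order_tendstoD(2)[OF this, of "L2_norm M u + 1"]
  obtain N2 where N2: "\<And>n. n \<ge> N2 \<Longrightarrow> L2_norm M (\<phi> n) < L2_norm M u + 1"
    by (auto simp: eventually_sequentially)
  have "Q (\<phi> n) + (L2_norm M (\<phi> n))\<^sup>2 \<le> 2 + 2 * Q (\<phi> N1) + (L2_norm M u + 1)\<^sup>2"
    if n: "n \<ge> max N1 N2" for n
  proof -
    have "Q (\<lambda>x. (\<phi> n x - \<phi> N1 x) + \<phi> N1 x) \<le> 2 * Q (\<lambda>x. \<phi> n x - \<phi> N1 x) + 2 * Q (\<phi> N1)"
      by (intro Q_add_le D_diff fa_D[OF assms])
    then have "Q (\<phi> n) \<le> 2 + 2 * Q (\<phi> N1)" using N1[of n] n by simp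
    moreover have "(L2_norm M (\<phi> n))\<^sup>2 \<le> (L2_norm M u + 1)\<^sup>2"
      by (rule power_mono) (use N2[of n] n in auto)
    ultimately show ?thesis by (rule add_mono)
  qed
  then show ?thesis by blast
qed

text \<open>Operations on test functions that are bounded in the norm and in the form norm preserve
  approximating sequences; only their effect on differences enters. This serves for scaling,
  translations and weights.\<close>

lemma fa_map:
  assumes "fa \<phi> u" "v \<in> L2 M" "\<And>n. \<psi> n \<in> D" "0 \<le> C" "0 \<le> K"
    and "\<And>n. L2_norm M (\<lambda>x. \<psi> n x - v x) \<le> C * L2_norm M (\<lambda>x. \<phi> n x - u x)"
    and Q: "\<And>m n. Q (\<lambda>x. \<psi> m x - \<psi> n x) \<le> K * (Q (\<lambda>x. \<phi> m x - \<phi> n x) + (L2_norm M (\<lambda>x. \<phi> m x - \<phi> n x))\<^sup>2)"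
  shows "fa \<psi> v"
proof (rule fa_I)
  have "(\<lambda>n. C * L2_norm M (\<lambda>x. \<phi> n x - u x)) \<longlonglongrightarrow> 0"
    using tendsto_mult_right_zero[OF fa_D(4)[OF assms(1)]] .
  then show "(\<lambda>n. L2_norm M (\<lambda>x. \<psi> n x - v x)) \<longlonglongrightarrow> 0"
    by (rule Lim_null_comparison[rotated]) (auto intro!: always_eventually assms(6))
  fix \<epsilon> :: real assume "\<epsilon> > 0"
  \<comment> \<open>\<open>K + 1\<close> instead of \<open>K\<close> covers \<open>K = 0\<close> and
    makes \<open>K * (2 * e)\<close> strictly smaller than \<open>\<epsilon>\<close>.\<close>
  define e where "e = \<epsilon> / (2 * (K + 1))"
  have e: "e > 0" using \<open>\<epsilon> > 0\<close> \<open>0 \<le> K\<close> by (simp add: e_def)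
  have "2 * (K + 1) * e = \<epsilon>" using \<open>0 \<le> K\<close> by (simp add: e_def)
  then have e2: "K * (2 * e) < \<epsilon>" using e by (simp add: algebra_simps)
  obtain N1 where N1: "\<And>m n. m \<ge> N1 \<Longrightarrow> n \<ge> N1 \<Longrightarrow> Q (\<lambda>x. \<phi> m x - \<phi> n x) < e"
    using fa_Cauchy[OF assms(1) e] by blast
  have "\<forall>\<^sub>F n in sequentially. L2_norm M (\<lambda>x. \<phi> n x - u x) < sqrt e / 2"
    by (rule order_tendstoD(2)[OF fa_D(4)[OF assms(1)]]) (use e in simp)
  then obtain N2 where N2: "\<And>n. n \<ge> N2 \<Longrightarrow> L2_norm M (\<lambda>x. \<phi> n x - u x) < sqrt e / 2"
    by (auto simp: eventually_sequentially)
  have "Q (\<lambda>x. \<psi> m x - \<psi> n x) < \<epsilon>" if mn: "m \<ge> max N1 N2" "n \<ge> max N1 N2" for m n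
  proof -
    have "L2_norm M (\<lambda>x. (\<phi> m x - u x) - (\<phi> n x - u x)) \<le> L2_norm M (\<lambda>x. \<phi> m x - u x) + L2_norm M (\<lambda>x. \<phi> n x - u x)"
      by (intro L2_norm_triangle_diff L2_diff fa_D[OF assms(1)])
    also have "\<dots> \<le> sqrt e" using N2[of m] N2[of n] mn by simp
    finally have "(L2_norm M (\<lambda>x. \<phi> m x - \<phi> n x))\<^sup>2 \<le> (sqrt e)\<^sup>2"
      by (intro power_mono) auto
    then have "Q (\<lambda>x. \<phi> m x - \<phi> n x) + (L2_norm M (\<lambda>x. \<phi> m x - \<phi> n x))\<^sup>2 \<le> 2 * e"
      using N1[of m n] mn e by simp
    then have "Q (\<lambda>x. \<psi> m x - \<psi> n x) \<le> K * (2 * e)"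
      using mult_left_mono[OF _ \<open>0 \<le> K\<close>] Q[of m n] by (meson order_trans)
    then show ?thesis using e2 by simp
  qed
  then show "\<exists>N. \<forall>m\<ge>N. \<forall>n\<ge>N. Q (\<lambda>x. \<psi> m x - \<psi> n x) < \<epsilon>" by blast
qed (use assms in auto)

lemma fa_add:
  assumes "fa \<phi> u" "fa \<psi> v"
  shows "fa (\<lambda>n x. \<phi> n x + \<psi> n x) (\<lambda>x. u x + v x)"
proof (rule fa_I)
  show "(\<lambda>n. L2_norm M (\<lambda>x. \<phi> n x + \<psi> n x - (u x + v x))) \<longlonglongrightarrow> 0"
  proof (rule Lim_null_comparison)
    show "(\<lambda>n. L2_norm M (\<lambda>x. \<phi> n x - u x) + L2_norm M (\<lambda>x. \<psi> n x - v x)) \<longlonglongrightarrow> 0"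
      using tendsto_add[OF fa_D(4)[OF assms(1)] fa_D(4)[OF assms(2)]] by simp
    have "L2_norm M (\<lambda>x. (\<phi> n x - u x) + (\<psi> n x - v x)) \<le> L2_norm M (\<lambda>x. \<phi> n x - u x) + L2_norm M (\<lambda>x. \<psi> n x - v x)" for n
      by (intro L2_norm_triangle L2_diff fa_D[OF assms(1)] fa_D[OF assms(2)])
    then show "\<forall>\<^sub>F n in sequentially. norm (L2_norm M (\<lambda>x. \<phi> n x + \<psi> n x - (u x + v x)))
        \<le> L2_norm M (\<lambda>x. \<phi> n x - u x) + L2_norm M (\<lambda>x. \<psi> n x - v x)"
      by (auto simp: algebra_simps)
  qed
  fix \<epsilon> :: real assume "\<epsilon> > 0"
  then have "\<epsilon> / 4 > 0" by simp
  from fa_Cauchy[OF assms(1) this] fa_Cauchy[OF assms(2) this]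
  obtain N1 N2 where N1: "\<And>m n. m \<ge> N1 \<Longrightarrow> n \<ge> N1 \<Longrightarrow> Q (\<lambda>x. \<phi> m x - \<phi> n x) < \<epsilon> / 4"
    and N2: "\<And>m n. m \<ge> N2 \<Longrightarrow> n \<ge> N2 \<Longrightarrow> Q (\<lambda>x. \<psi> m x - \<psi> n x) < \<epsilon> / 4"
    by blast
  have "Q (\<lambda>x. \<phi> m x + \<psi> m x - (\<phi> n x + \<psi> n x)) < \<epsilon>" if mn: "m \<ge> max N1 N2" "n \<ge> max N1 N2" for m n
  proof -
    have "Q (\<lambda>x. (\<phi> m x - \<phi> n x) + (\<psi> m x - \<psi> n x)) \<le> 2 * Q (\<lambda>x. \<phi> m x - \<phi> n x) + 2 * Q (\<lambda>x. \<psi> m x - \<psi> n x)"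
      by (intro Q_add_le D_diff fa_D[OF assms(1)] fa_D[OF assms(2)])
    also have "\<dots> < \<epsilon>" using N1[of m n] N2[of m n] mn by simp
    finally show ?thesis by (simp add: algebra_simps)
  qed
  then show "\<exists>N. \<forall>m\<ge>N. \<forall>n\<ge>N. Q (\<lambda>x. \<phi> m x + \<psi> m x - (\<phi> n x + \<psi> n x)) < \<epsilon>" by blast
qed (use L2_add D_add fa_D[OF assms(1)] fa_D[OF assms(2)] in auto)

lemma fa_scale:
  assumes "fa \<phi> u"
  shows "fa (\<lambda>n x. c * \<phi> n x) (\<lambda>x. c * u x)"
proof (rule fa_map[OF assms, where C="cmod c" and K="(cmod c)\<^sup>2"])
  fix m n
  have "Q (\<lambda>x. c * (\<phi> m x - \<phi> n x)) = (cmod c)\<^sup>2 * Q (\<lambda>x. \<phi> m x - \<phi> n x)"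
    by (intro Q_scale D_diff fa_D[OF assms])
  also have "\<dots> \<le> (cmod c)\<^sup>2 * (Q (\<lambda>x. \<phi> m x - \<phi> n x) + (L2_norm M (\<lambda>x. \<phi> m x - \<phi> n x))\<^sup>2)"
    by (intro mult_left_mono) auto
  finally show "Q (\<lambda>x. c * \<phi> m x - c * \<phi> n x)
      \<le> (cmod c)\<^sup>2 * (Q (\<lambda>x. \<phi> m x - \<phi> n x) + (L2_norm M (\<lambda>x. \<phi> m x - \<phi> n x))\<^sup>2)"
    by (simp add: right_diff_distrib)
  show "L2_norm M (\<lambda>x. c * \<phi> n x - c * u x) \<le> cmod c * L2_norm M (\<lambda>x. \<phi> n x - u x)"
    using L2_norm_scale[of M c "\<lambda>x. \<phi> n x - u x"] by (simp add: right_diff_distrib)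
qed (use fa_D[OF assms] L2_scale D_scale in auto)

lemma fa_diff:
  assumes "fa \<phi> u" "fa \<psi> v"
  shows "fa (\<lambda>n x. \<phi> n x - \<psi> n x) (\<lambda>x. u x - v x)"
  using fa_add[OF assms(1) fa_scale[OF assms(2), of "-1"]] by simp

text \<open>The equation with the spectral parameter on the form side, so that \<open>f\<close> is
  the given source itself. One sequence \<open>\<phi>\<close> has to serve against all approximating
  sequences \<open>\<psi>\<close>.\<close>

definition weak_solution :: "complex \<Rightarrow> ('a \<Rightarrow> complex) \<Rightarrow> ('a \<Rightarrow> complex) \<Rightarrow> bool" where
  "weak_solution z u f \<longleftrightarrow> f \<in> L2 M \<and> (\<exists>\<phi>. fa \<phi> u \<and>
     (\<forall>\<psi> v. fa \<psi> v \<longrightarrow> (\<lambda>n. q (\<phi> n) (\<psi> n) - z * L2_inner M (\<phi> n) (\<psi> n)) \<longlonglongrightarrow> L2_inner M f v))"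

lemma fa_inner_tendsto:
  assumes "fa \<phi> u" "fa \<psi> v"
  shows "(\<lambda>n. L2_inner M (\<phi> n) (\<psi> n)) \<longlonglongrightarrow> L2_inner M u v"
  by (rule L2_inner_tendsto) (use fa_D[OF assms(1)] fa_D[OF assms(2)] in auto)

text \<open>In one direction \<open>g = f + z u\<close> is the image under the extension; in the
  other, an identity almost everywhere suffices because only inner products with \<open>g\<close>
  are taken.\<close>

lemma weak_solution_iff:
  assumes "f \<in> L2 M"
  shows "weak_solution z u f \<longleftrightarrow> (\<exists>g. friedrichs_extension M D A u g \<and> (AE x in M. g x - z * u x = f x))"
proof
  assume "weak_solution z u f"
  then obtain \<phi> where \<phi>: "fa \<phi> u" and
    lim: "\<And>\<psi> v. fa \<psi> v \<Longrightarrow> (\<lambda>n. q (\<phi> n) (\<psi> n) - z * L2_inner M (\<phi> n) (\<psi> n)) \<longlonglongrightarrow> L2_inner M f v"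
    by (auto simp: weak_solution_def)
  have u: "u \<in> L2 M" by (rule fa_D[OF \<phi>])
  let ?g = "\<lambda>x. f x + z * u x"
  have "(\<lambda>n. q (\<phi> n) (\<psi> n)) \<longlonglongrightarrow> L2_inner M ?g v" if "fa \<psi> v" for \<psi> v
  proof -
    have "(\<lambda>n. (q (\<phi> n) (\<psi> n) - z * L2_inner M (\<phi> n) (\<psi> n)) + z * L2_inner M (\<phi> n) (\<psi> n))
        \<longlonglongrightarrow> L2_inner M f v + z * L2_inner M u v"
      by (intro tendsto_add tendsto_mult_left lim fa_inner_tendsto \<phi> that)
    moreover have "L2_inner M ?g v = L2_inner M f v + z * L2_inner M u v"
      using assms u fa_D(1)[OF that] by (simp add: L2_inner_add_left L2_inner_scale_left L2_scale)
    ultimately show ?thesis by simp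
  qed
  then have "friedrichs_extension M D A u ?g"
    using \<phi> L2_add[OF assms L2_scale[OF u]] by (auto simp: friedrichs_extension_def)
  then show "\<exists>g. friedrichs_extension M D A u g \<and> (AE x in M. g x - z * u x = f x)"
    by (intro exI[of _ ?g]) auto
next
  assume "\<exists>g. friedrichs_extension M D A u g \<and> (AE x in M. g x - z * u x = f x)"
  then obtain g \<phi> where g: "g \<in> L2 M" "AE x in M. g x - z * u x = f x" and \<phi>: "fa \<phi> u"
    and lim: "\<And>\<psi> v. fa \<psi> v \<Longrightarrow> (\<lambda>n. q (\<phi> n) (\<psi> n)) \<longlonglongrightarrow> L2_inner M g v"
    by (auto simp: friedrichs_extension_def)
  have u: "u \<in> L2 M" by (rule fa_D[OF \<phi>])
  have "(\<lambda>n. q (\<phi> n) (\<psi> n) - z * L2_inner M (\<phi> n) (\<psi> n)) \<longlonglongrightarrow> L2_inner M f v" if "fa \<psi> v" for \<psi> v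
  proof -
    have "(\<lambda>n. q (\<phi> n) (\<psi> n) - z * L2_inner M (\<phi> n) (\<psi> n)) \<longlonglongrightarrow> L2_inner M g v - z * L2_inner M u v"
      by (intro tendsto_diff tendsto_mult_left lim fa_inner_tendsto \<phi> that)
    moreover have "L2_inner M f v = L2_inner M (\<lambda>x. g x - z * u x) v"
      using assms g u fa_D(1)[OF that] by (intro L2_inner_cong_AE L2_diff L2_scale) auto
    moreover have "\<dots> = L2_inner M g v - z * L2_inner M u v"
      using g u fa_D(1)[OF that] by (simp add: L2_inner_diff_left L2_inner_scale_left L2_scale)
    ultimately show ?thesis by simp
  qed
  then show "weak_solution z u f" using \<phi> assms by (auto simp: weak_solution_def)
qed

lemma weak_solution_L2: "weak_solution z u f \<Longrightarrow> u \<in> L2 M"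
  using fa_D(1) by (auto simp: weak_solution_def)

lemma weak_solution_diff:
  assumes "weak_solution z u f" "weak_solution z v g"
  shows "weak_solution z (\<lambda>x. u x - v x) (\<lambda>x. f x - g x)"
proof -
  obtain \<phi> \<psi> where f: "f \<in> L2 M" "fa \<phi> u"
    and lf: "\<And>\<eta> w. fa \<eta> w \<Longrightarrow> (\<lambda>n. q (\<phi> n) (\<eta> n) - z * L2_inner M (\<phi> n) (\<eta> n)) \<longlonglongrightarrow> L2_inner M f w"
    and g: "g \<in> L2 M" "fa \<psi> v"
    and lg: "\<And>\<eta> w. fa \<eta> w \<Longrightarrow> (\<lambda>n. q (\<psi> n) (\<eta> n) - z * L2_inner M (\<psi> n) (\<eta> n)) \<longlonglongrightarrow> L2_inner M g w"
    using assms by (auto simp: weak_solution_def)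
  have "(\<lambda>n. q (\<lambda>x. \<phi> n x - \<psi> n x) (\<eta> n) - z * L2_inner M (\<lambda>x. \<phi> n x - \<psi> n x) (\<eta> n))
      \<longlonglongrightarrow> L2_inner M (\<lambda>x. f x - g x) w" if "fa \<eta> w" for \<eta> w
  proof -
    note D = fa_D[OF f(2)] fa_D[OF g(2)] fa_D[OF that]
    have e: "q (\<lambda>x. \<phi> n x - \<psi> n x) (\<eta> n) - z * L2_inner M (\<lambda>x. \<phi> n x - \<psi> n x) (\<eta> n)
      = (q (\<phi> n) (\<eta> n) - z * L2_inner M (\<phi> n) (\<eta> n)) - (q (\<psi> n) (\<eta> n) - z * L2_inner M (\<psi> n) (\<eta> n))" for n
      using D by (simp add: q_bilinear L2_inner_diff_left right_diff_distrib)
    have "L2_inner M (\<lambda>x. f x - g x) w = L2_inner M f w - L2_inner M g w"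
      using D f g by (simp add: L2_inner_diff_left)
    then show ?thesis unfolding e using tendsto_diff[OF lf[OF that] lg[OF that]] by simp
  qed
  then show ?thesis
    unfolding weak_solution_def using L2_diff[OF f(1) g(1)] fa_diff[OF f(2) g(2)] by blast
qed

lemma weak_solution_energy:
  assumes "weak_solution z u f"
  shows "\<exists>\<phi>. fa \<phi> u \<and> (\<lambda>n. of_real (Q (\<phi> n)) - z * of_real ((L2_norm M (\<phi> n))\<^sup>2)) \<longlonglongrightarrow> L2_inner M f u"
proof -
  obtain \<phi> where \<phi>: "fa \<phi> u"
    and "\<And>\<eta> w. fa \<eta> w \<Longrightarrow> (\<lambda>n. q (\<phi> n) (\<eta> n) - z * L2_inner M (\<phi> n) (\<eta> n)) \<longlonglongrightarrow> L2_inner M f w"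
    using assms by (auto simp: weak_solution_def)
  from this(2)[OF \<phi>] have
    "(\<lambda>n. of_real (Q (\<phi> n)) - z * of_real ((L2_norm M (\<phi> n))\<^sup>2)) \<longlonglongrightarrow> L2_inner M f u"
    by (simp only: q_self[OF fa_D(2)[OF \<phi>], symmetric] L2_inner_self)
  with \<phi> show ?thesis by blast
qed

text \<open>Imaginary and real part of the energy identity, the nonnegative form being dropped in
  the latter. These a priori bounds determine the admissible step lengths in
  \<open>solvable_step\<close>.\<close>

lemma weak_solution_bound:
  assumes "weak_solution z u f"
  shows "\<bar>Im z\<bar> * L2_norm M u \<le> L2_norm M f" "- Re z * L2_norm M u \<le> L2_norm M f"
proof -
  obtain \<phi> where \<phi>: "fa \<phi> u" and
    l: "(\<lambda>n. of_real (Q (\<phi> n)) - z * of_real ((L2_norm M (\<phi> n))\<^sup>2)) \<longlonglongrightarrow> L2_inner M f u"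
    using weak_solution_energy[OF assms] by blast
  have u: "u \<in> L2 M" and f: "f \<in> L2 M"
    using assms weak_solution_L2 by (auto simp: weak_solution_def)
  have n: "(\<lambda>n. (L2_norm M (\<phi> n))\<^sup>2) \<longlonglongrightarrow> (L2_norm M u)\<^sup>2"
    by (intro tendsto_power L2_norm_tendsto) (use fa_D[OF \<phi>] in auto)
  have le: "cmod (L2_inner M f u) \<le> L2_norm M f * L2_norm M u"
    by (rule cmod_L2_inner_le[OF f u])
  have div: "c * L2_norm M u \<le> L2_norm M f" if "c * (L2_norm M u)\<^sup>2 \<le> L2_norm M f * L2_norm M u" for c
    using that L2_norm_nonneg[of M u] L2_norm_nonneg[of M f]
    by (cases "L2_norm M u = 0") (auto simp: power2_eq_square mult.assoc[symmetric] less_le)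
  have "(\<lambda>n. - Im z * (L2_norm M (\<phi> n))\<^sup>2) \<longlonglongrightarrow> Im (L2_inner M f u)"
    using tendsto_Im[OF l] by simp
  from LIMSEQ_unique[OF this tendsto_mult_left[OF n]]
  have "Im (L2_inner M f u) = - Im z * (L2_norm M u)\<^sup>2" .
  then have "\<bar>Im z\<bar> * (L2_norm M u)\<^sup>2 \<le> L2_norm M f * L2_norm M u"
    using order_trans[OF abs_Im_le_cmod le] by (simp add: abs_mult)
  then show "\<bar>Im z\<bar> * L2_norm M u \<le> L2_norm M f" by (rule div)
  have "(\<lambda>n. Q (\<phi> n) - Re z * (L2_norm M (\<phi> n))\<^sup>2) \<longlonglongrightarrow> Re (L2_inner M f u)"
    using tendsto_Re[OF l] by simp
  moreover have "Q (\<phi> n) - Re z * (L2_norm M (\<phi> n))\<^sup>2 \<ge> - Re z * (L2_norm M (\<phi> n))\<^sup>2" for n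
    using A_nonneg[OF fa_D(2)[OF \<phi>]] by simp
  ultimately have "- Re z * (L2_norm M u)\<^sup>2 \<le> Re (L2_inner M f u)"
    by (intro LIMSEQ_le[OF tendsto_mult_left[OF n]]) auto
  from order_trans[OF this order_trans[OF complex_Re_le_cmod le]]
  have "- Re z * (L2_norm M u)\<^sup>2 \<le> L2_norm M f * L2_norm M u" .
  then show "- Re z * L2_norm M u \<le> L2_norm M f" by (rule div)
qed


text \<open>For \<open>z < 0\<close> the equation is the Euler-Lagrange equation of
  \<open>J \<phi> = Q \<phi> + \<lambda> \<parallel>\<phi>\<parallel>\<^sup>2 - 2 Re \<langle>f, \<phi>\<rangle>\<close> with \<open>\<lambda> = - z\<close>; the defect of a near-minimizer
  in the equation is controlled by its excess energy.\<close>

lemma weak_solution_exists_negative: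
  assumes l: "l > 0" and f: "f \<in> L2 M"
  shows "\<exists>u. weak_solution (of_real (- l)) u f"
proof -
  define Ql where "Ql = (\<lambda>\<phi>. Q \<phi> + l * (L2_norm M \<phi>)\<^sup>2)"
  define J where "J = (\<lambda>\<phi>. Ql \<phi> - 2 * Re (L2_inner M f \<phi>))"
  define G where "G = (\<lambda>\<phi> \<psi>. q \<phi> \<psi> + of_real l * L2_inner M \<phi> \<psi> - L2_inner M f \<psi>)"
  define m where "m = Inf (J ` D)"
  have Ql0: "0 \<le> Ql \<phi>" and Ql1: "l * (L2_norm M \<phi>)\<^sup>2 \<le> Ql \<phi>" and Ql2: "Q \<phi> \<le> Ql \<phi>" if "\<phi> \<in> D" for \<phi>
    using A_nonneg[OF that] l by (auto simp: Ql_def)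
  have lower: "- ((L2_norm M f)\<^sup>2 / l) \<le> J \<phi>" if "\<phi> \<in> D" for \<phi>
  proof -
    let ?a = "L2_norm M f" and ?b = "L2_norm M \<phi>"
    have "Re (L2_inner M f \<phi>) \<le> ?a * ?b"
      using complex_Re_le_cmod cmod_L2_inner_le[OF f D_L2[OF that]] order_trans by metis
    \<comment> \<open>Completing the square bounds the linear term of \<open>J\<close> by its
      quadratic part.\<close>
    moreover have "0 \<le> (l * ?b - ?a)\<^sup>2 / l" using l by simp
    then have "2 * (?a * ?b) - ?a\<^sup>2 / l \<le> l * ?b\<^sup>2"
      using l by (simp add: power2_eq_square field_simps)
    ultimately show ?thesis using Ql1[OF that] by (simp add: J_def)
  qed
  then have bdd: "bdd_below (J ` D)" by (auto intro!: bdd_belowI2)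
  have ne: "J ` D \<noteq> {}" using D_zero by auto
  have mJ: "m \<le> J \<phi>" if "\<phi> \<in> D" for \<phi> unfolding m_def by (rule cINF_lower[OF bdd that])
  \<comment> \<open>\<open>G \<phi> \<psi>\<close> appears as the coefficient of the linear term: it
    is the defect of \<open>\<phi>\<close> in the equation tested with
    \<open>\<psi>\<close>.\<close>
  have expand: "J (\<lambda>x. \<phi> x + c * \<psi> x) = J \<phi> + 2 * Re (cnj c * G \<phi> \<psi>) + (cmod c)\<^sup>2 * Ql \<psi>"
    if \<phi>: "\<phi> \<in> D" and \<psi>: "\<psi> \<in> D" for \<phi> \<psi> c
  proof -
    have c\<psi>: "(\<lambda>x. c * \<psi> x) \<in> D" by (rule D_scale[OF \<psi>])
    note L = D_L2[OF \<phi>] D_L2[OF \<psi>] D_L2[OF c\<psi>] f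
    have s: "(\<lambda>x. \<phi> x + c * \<psi> x) \<in> D" by (rule D_add[OF \<phi> c\<psi>])
    have "q (\<lambda>x. \<phi> x + c * \<psi> x) (\<lambda>x. \<phi> x + c * \<psi> x)
        = q \<phi> \<phi> + cnj c * q \<phi> \<psi> + cnj (cnj c * q \<phi> \<psi>) + (c * cnj c) * q \<psi> \<psi>"
      using \<phi> \<psi> c\<psi> s A_sym[OF \<psi> \<phi>] by (simp add: q_bilinear ring_distribs)
    then have Qe: "Q (\<lambda>x. \<phi> x + c * \<psi> x) = Q \<phi> + 2 * Re (cnj c * q \<phi> \<psi>) + (cmod c)\<^sup>2 * Q \<psi>"
      by (simp add: complex_norm_square[symmetric] del: of_real_power)
    have "L2_inner M (\<lambda>x. \<phi> x + c * \<psi> x) (\<lambda>x. \<phi> x + c * \<psi> x)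
        = L2_inner M \<phi> \<phi> + cnj c * L2_inner M \<phi> \<psi> + cnj (cnj c * L2_inner M \<phi> \<psi>) + (c * cnj c) * L2_inner M \<psi> \<psi>"
      using L D_L2[OF s] L2_inner_cnj[of M \<phi> \<psi>]
      by (simp add: L2_inner_add_left L2_inner_add_right L2_inner_scale_left L2_inner_scale_right ring_distribs)
    then have "Re (L2_inner M (\<lambda>x. \<phi> x + c * \<psi> x) (\<lambda>x. \<phi> x + c * \<psi> x))
        = Re (L2_inner M \<phi> \<phi>) + 2 * Re (cnj c * L2_inner M \<phi> \<psi>) + (cmod c)\<^sup>2 * Re (L2_inner M \<psi> \<psi>)"
      by (simp add: complex_norm_square[symmetric] L2_inner_self del: of_real_power)
    then have Ne: "(L2_norm M (\<lambda>x. \<phi> x + c * \<psi> x))\<^sup>2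
        = (L2_norm M \<phi>)\<^sup>2 + 2 * Re (cnj c * L2_inner M \<phi> \<psi>) + (cmod c)\<^sup>2 * (L2_norm M \<psi>)\<^sup>2"
      by (simp only: L2_inner_self Re_complex_of_real)
    have Fe: "L2_inner M f (\<lambda>x. \<phi> x + c * \<psi> x) = L2_inner M f \<phi> + cnj c * L2_inner M f \<psi>"
      using L by (simp add: L2_inner_add_right L2_inner_scale_right)
    have Gr: "Re (cnj c * G \<phi> \<psi>) = Re (cnj c * q \<phi> \<psi>) + l * Re (cnj c * L2_inner M \<phi> \<psi>) - Re (cnj c * L2_inner M f \<psi>)"
      unfolding G_def by (simp add: algebra_simps)
    show ?thesis unfolding J_def Ql_def Qe Ne Fe Gr by (simp add: algebra_simps)
  qed
  have defect: "(cmod (G \<phi> \<psi>))\<^sup>2 \<le> Ql \<psi> * (J \<phi> - m)" if \<phi>: "\<phi> \<in> D" and \<psi>: "\<psi> \<in> D" for \<phi> \<psi>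
  proof (rule square_le_mult_if_quadratic_nonneg)
    fix t :: real
    \<comment> \<open>The phase makes the linear term real, so that the expansion becomes a
      quadratic in \<open>t\<close> with the modulus of \<open>G \<phi> \<psi>\<close> in its middle
      coefficient.\<close>
    let ?e = "sgn (G \<phi> \<psi>)" let ?c = "of_real (- t) * ?e"
    have "cnj ?c * G \<phi> \<psi> = of_real (- t) * (cnj ?e * G \<phi> \<psi>)" by simp
    also have "cnj ?e * G \<phi> \<psi> = of_real (cmod (G \<phi> \<psi>))"
    proof (cases "G \<phi> \<psi> = 0")
      case False
      have "cnj ?e * G \<phi> \<psi> = (G \<phi> \<psi> * cnj (G \<phi> \<psi>)) / of_real (cmod (G \<phi> \<psi>))"
        by (simp add: sgn_eq)
      also have "\<dots> = of_real (cmod (G \<phi> \<psi>))"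
        using False by (simp add: complex_norm_square[symmetric] power2_eq_square)
      finally show ?thesis .
    qed simp
    finally have 1: "Re (cnj ?c * G \<phi> \<psi>) = - t * cmod (G \<phi> \<psi>)"
      by (simp only: of_real_mult[symmetric] Re_complex_of_real)
    have "(cmod ?c)\<^sup>2 \<le> t\<^sup>2" by (simp add: norm_mult norm_sgn)
    then have 2: "(cmod ?c)\<^sup>2 * Ql \<psi> \<le> t\<^sup>2 * Ql \<psi>" by (rule mult_right_mono[OF _ Ql0[OF \<psi>]])
    have "m \<le> J (\<lambda>x. \<phi> x + ?c * \<psi> x)" by (intro mJ D_add D_scale \<phi> \<psi>)
    then show "0 \<le> t\<^sup>2 * Ql \<psi> - 2 * t * cmod (G \<phi> \<psi>) + (J \<phi> - m)"
      unfolding expand[OF \<phi> \<psi>] 1 using 2 by simp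
  qed (use Ql0[OF \<psi>] mJ[OF \<phi>] in auto)
  have "\<exists>\<phi>\<in>D. J \<phi> < m + (1 / Suc n)" for n
  proof -
    have "Inf (J ` D) < m + (1 / Suc n)" by (simp add: m_def)
    from cInf_lessD[OF ne this] show ?thesis by auto
  qed
  then obtain \<phi> where \<phi>: "\<And>n. \<phi> n \<in> D" and J\<phi>: "\<And>n. J (\<phi> n) < m + 1 / Suc n" by metis
  define s where "s = (\<lambda>n. sqrt (1 / Suc n))"
  have s0: "s \<longlonglongrightarrow> 0"
    using tendsto_real_sqrt[OF LIMSEQ_inverse_real_of_nat] unfolding s_def by (simp add: inverse_eq_divide)
  have G\<phi>: "cmod (G (\<phi> n) \<psi>) \<le> s n * sqrt (Ql \<psi>)" if "\<psi> \<in> D" for n \<psi>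
  proof -
    have "(cmod (G (\<phi> n) \<psi>))\<^sup>2 \<le> Ql \<psi> * (1 / Suc n)"
      by (rule order_trans[OF defect[OF \<phi> that]], rule mult_left_mono)
        (use J\<phi>[of n] Ql0[OF that] in auto)
    from real_sqrt_le_mono[OF this] show ?thesis
      by (simp only: real_sqrt_mult s_def real_sqrt_abs abs_norm_cancel mult.commute)
  qed
  \<comment> \<open>The difference of two defects, tested with the difference of the
    near-minimizers, equals the energy \<open>Ql\<close> of that difference.\<close>
  have cau: "sqrt (Ql (\<lambda>x. \<phi> i x - \<phi> j x)) \<le> s i + s j" for i j
  proof -
    let ?d = "\<lambda>x. \<phi> i x - \<phi> j x"
    have d: "?d \<in> D" by (intro D_diff \<phi>)
    note L = D_L2[OF \<phi>] D_L2[OF d]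
    have "G (\<phi> i) ?d - G (\<phi> j) ?d = q ?d ?d + of_real l * L2_inner M ?d ?d"
      unfolding G_def q_bilinear(2)[OF \<phi> \<phi> d] L2_inner_diff_left[OF L(1) L(1) L(2)]
      by (simp add: algebra_simps)
    also have "\<dots> = of_real (Ql ?d)"
      by (simp only: Ql_def L2_inner_self of_real_add of_real_mult q_self[OF d, symmetric])
    finally have "Ql ?d = cmod (G (\<phi> i) ?d - G (\<phi> j) ?d)" using Ql0[OF d] by simp
    also have "\<dots> \<le> cmod (G (\<phi> i) ?d) + cmod (G (\<phi> j) ?d)" by (rule norm_triangle_ineq4)
    also have "\<dots> \<le> (s i + s j) * sqrt (Ql ?d)"
      using add_mono[OF G\<phi>[OF d, of i] G\<phi>[OF d, of j]] by (simp add: distrib_right)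
    finally have "sqrt (Ql ?d) * sqrt (Ql ?d) \<le> (s i + s j) * sqrt (Ql ?d)" using Ql0[OF d] by simp
    moreover have "0 \<le> s i + s j" by (simp add: s_def)
    ultimately show ?thesis using Ql0[OF d]
      by (metis mult_le_cancel_right real_sqrt_ge_zero less_le)
  qed
  have cauQ: "\<exists>N. \<forall>i\<ge>N. \<forall>j\<ge>N. Ql (\<lambda>x. \<phi> i x - \<phi> j x) < \<epsilon>" if e: "\<epsilon> > 0" for \<epsilon>
  proof -
    have "\<forall>\<^sub>F n in sequentially. s n < sqrt \<epsilon> / 2"
      by (rule order_tendstoD(2)[OF s0]) (use e in simp)
    then obtain N where N: "\<And>n. n \<ge> N \<Longrightarrow> s n < sqrt \<epsilon> / 2" by (auto simp: eventually_sequentially)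
    have "Ql (\<lambda>x. \<phi> i x - \<phi> j x) < \<epsilon>" if "i \<ge> N" "j \<ge> N" for i j
    proof -
      have "sqrt (Ql (\<lambda>x. \<phi> i x - \<phi> j x)) < sqrt \<epsilon>"
        using cau[of i j] N[OF that(1)] N[OF that(2)] by linarith
      then show ?thesis by (simp only: real_sqrt_less_iff)
    qed
    then show ?thesis by blast
  qed
  have "\<exists>u\<in>L2 M. (\<lambda>n. L2_norm M (\<lambda>x. \<phi> n x - u x)) \<longlonglongrightarrow> 0"
  proof (rule L2_complete[OF D_L2[OF \<phi>]])
    fix \<epsilon> :: real assume "\<epsilon> > 0"
    then have "l * \<epsilon>\<^sup>2 > 0" using l by simp
    from cauQ[OF this] obtain N where
      N: "\<And>i j. i \<ge> N \<Longrightarrow> j \<ge> N \<Longrightarrow> Ql (\<lambda>x. \<phi> i x - \<phi> j x) < l * \<epsilon>\<^sup>2" by blast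
    have "L2_norm M (\<lambda>x. \<phi> i x - \<phi> j x) < \<epsilon>" if "i \<ge> N" "j \<ge> N" for i j
    proof -
      have "l * (L2_norm M (\<lambda>x. \<phi> i x - \<phi> j x))\<^sup>2 < l * \<epsilon>\<^sup>2"
        using Ql1[OF D_diff[OF \<phi> \<phi>], of i j] N[OF that] by linarith
      then have "(L2_norm M (\<lambda>x. \<phi> i x - \<phi> j x))\<^sup>2 < \<epsilon>\<^sup>2" using l by simp
      then show ?thesis by (rule power2_less_imp_less) (use \<open>\<epsilon> > 0\<close> in simp)
    qed
    then show "\<exists>N. \<forall>m\<ge>N. \<forall>n\<ge>N. L2_norm M (\<lambda>x. \<phi> m x - \<phi> n x) < \<epsilon>" by blast
  qed
  then obtain u where u: "u \<in> L2 M" "(\<lambda>n. L2_norm M (\<lambda>x. \<phi> n x - u x)) \<longlonglongrightarrow> 0" by blast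
  have fa: "fa \<phi> u"
  proof (rule fa_I[OF u(1) \<phi> u(2)])
    fix \<epsilon> :: real assume "\<epsilon> > 0"
    then show "\<exists>N. \<forall>m\<ge>N. \<forall>n\<ge>N. Q (\<lambda>x. \<phi> m x - \<phi> n x) < \<epsilon>"
      using cauQ[of \<epsilon>] order_le_less_trans[OF Ql2[OF D_diff[OF \<phi> \<phi>]]] by blast
  qed
  have "(\<lambda>n. q (\<phi> n) (\<psi> n) - of_real (- l) * L2_inner M (\<phi> n) (\<psi> n)) \<longlonglongrightarrow> L2_inner M f v" if \<psi>: "fa \<psi> v" for \<psi> v
  proof -
    obtain B N where B: "\<And>n. n \<ge> N \<Longrightarrow> Q (\<psi> n) + (L2_norm M (\<psi> n))\<^sup>2 \<le> B"
      using fa_bounded[OF \<psi>] by blast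
    have "cmod (G (\<phi> n) (\<psi> n)) \<le> s n * sqrt ((1 + l) * B)" if "n \<ge> N" for n
    proof -
      have "Ql (\<psi> n) \<le> (1 + l) * (Q (\<psi> n) + (L2_norm M (\<psi> n))\<^sup>2)"
        unfolding Ql_def using A_nonneg[OF fa_D(2)[OF \<psi>], of n] l by (simp add: algebra_simps)
      also have "\<dots> \<le> (1 + l) * B" using B[OF that] l by (intro mult_left_mono) auto
      finally have "s n * sqrt (Ql (\<psi> n)) \<le> s n * sqrt ((1 + l) * B)"
        by (intro mult_left_mono real_sqrt_le_mono) (auto simp: s_def)
      then show ?thesis using G\<phi>[OF fa_D(2)[OF \<psi>]] by (rule order_trans[rotated])
    qed
    then have ev: "\<forall>\<^sub>F n in sequentially. cmod (G (\<phi> n) (\<psi> n)) \<le> s n * sqrt ((1 + l) * B)"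
      by (auto simp: eventually_sequentially)
    have "(\<lambda>n. G (\<phi> n) (\<psi> n)) \<longlonglongrightarrow> 0"
      by (rule Lim_null_comparison[OF ev]) (rule tendsto_mult_left_zero[OF s0])
    moreover have "(\<lambda>n. L2_inner M f (\<psi> n)) \<longlonglongrightarrow> L2_inner M f v"
      by (rule L2_inner_tendsto[of "\<lambda>_. f"]) (use f fa_D[OF \<psi>] in \<open>auto simp: L2_norm_def\<close>)
    ultimately have "(\<lambda>n. G (\<phi> n) (\<psi> n) + L2_inner M f (\<psi> n)) \<longlonglongrightarrow> 0 + L2_inner M f v"
      by (rule tendsto_add)
    then show ?thesis by (simp add: G_def)
  qed
  with fa f show ?thesis by (auto simp: weak_solution_def)
qed

section \<open>Continuation of solvability to the complement of the half-line\<close>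

definition solvable :: "complex \<Rightarrow> bool" where
  "solvable z \<longleftrightarrow> (\<forall>f\<in>L2 M. \<exists>u. weak_solution z u f)"

text \<open>Neumann series, written as the iteration of
  \<open>u \<mapsto> R (f + (z - z0) u)\<close>. The a priori bound at \<open>z0\<close> makes this
  map a contraction with factor \<open>cmod (z - z0) / c\<close>.\<close>

lemma solvable_step:
  assumes z0: "solvable z0" and c: "c > 0" "cmod (z - z0) < c"
    and bound: "\<And>u f. weak_solution z0 u f \<Longrightarrow> c * L2_norm M u \<le> L2_norm M f"
  shows "solvable z"
  unfolding solvable_def
proof
  fix f assume f: "f \<in> L2 M"
  \<comment> \<open>\<open>R\<close> merely chooses solutions; differences of its values are
    controlled through \<open>weak_solution_diff\<close> instead of linearity.\<close>
  obtain R where R: "\<And>g. g \<in> L2 M \<Longrightarrow> weak_solution z0 (R g) g"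
    using z0 unfolding solvable_def by metis
  define k where "k = cmod (z - z0) / c"
  have k: "0 \<le> k" "k < 1" using c by (auto simp: k_def)
  define T where "T = (\<lambda>u. R (\<lambda>x. f x + (z - z0) * u x))"
  have Tg: "(\<lambda>x. f x + (z - z0) * u x) \<in> L2 M" if "u \<in> L2 M" for u
    by (intro L2_add L2_scale f that)
  have TL: "T u \<in> L2 M" if "u \<in> L2 M" for u
    unfolding T_def by (rule weak_solution_L2[OF R[OF Tg[OF that]]])
  have contr: "L2_norm M (\<lambda>x. T u x - T v x) \<le> k * L2_norm M (\<lambda>x. u x - v x)"
    if "u \<in> L2 M" "v \<in> L2 M" for u v
  proof -
    have "c * L2_norm M (\<lambda>x. T u x - T v x)
        \<le> L2_norm M (\<lambda>x. (f x + (z - z0) * u x) - (f x + (z - z0) * v x))"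
      unfolding T_def by (rule bound[OF weak_solution_diff[OF R[OF Tg[OF that(1)]] R[OF Tg[OF that(2)]]]])
    also have "\<dots> = L2_norm M (\<lambda>x. (z - z0) * (u x - v x))" by (simp add: right_diff_distrib)
    also have "\<dots> = cmod (z - z0) * L2_norm M (\<lambda>x. u x - v x)" by (rule L2_norm_scale)
    finally show ?thesis using c(1) by (simp add: k_def field_simps)
  qed
  define U where "U = (\<lambda>n. (T ^^ n) (\<lambda>x. 0))"
  have US: "U (Suc n) = T (U n)" for n by (simp add: U_def)
  have UL: "U n \<in> L2 M" for n by (induction n) (auto simp: U_def TL)
  \<comment> \<open>\<open>B\<close> is the sum of the geometric series, the solution of
    \<open>B = L2_norm M (U 1) + k * B\<close>.\<close>
  define B where "B = L2_norm M (U 1) / (1 - k)"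
  have B: "L2_norm M (U j) \<le> B" for j
  proof (induction j)
    case 0
    have "L2_norm M (U 0) = 0" by (simp add: U_def L2_norm_def)
    then show ?case using k by (simp add: B_def)
  next
    case (Suc j)
    have "L2_norm M (U (Suc j)) \<le> L2_norm M (U 1) + L2_norm M (\<lambda>x. U (Suc j) x - U 1 x)"
      by (intro L2_norm_triangle_sub UL)
    also have "L2_norm M (\<lambda>x. U (Suc j) x - U 1 x) \<le> k * L2_norm M (U j)"
      using contr[OF UL[of j] UL[of 0]] by (simp add: US) (simp add: U_def)
    also have "L2_norm M (U 1) + k * L2_norm M (U j) \<le> L2_norm M (U 1) + k * B"
      using Suc k by (intro add_left_mono mult_left_mono) auto
    also have "\<dots> = B" using k by (simp add: B_def field_simps)
    finally show ?case by simp
  qed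
  have Ud: "L2_norm M (\<lambda>x. U (n + j) x - U n x) \<le> k ^ n * B" for n j
  proof (induction n)
    case 0
    then show ?case using B[of j] by (simp add: U_def)
  next
    case (Suc n)
    have "L2_norm M (\<lambda>x. U (Suc n + j) x - U (Suc n) x) \<le> k * L2_norm M (\<lambda>x. U (n + j) x - U n x)"
      using contr[OF UL[of "n + j"] UL[of n]] by (simp add: US)
    also have "\<dots> \<le> k * (k ^ n * B)" using Suc k by (intro mult_left_mono) auto
    finally show ?case by simp
  qed
  have "(\<lambda>n. k ^ n * B) \<longlonglongrightarrow> 0"
    using tendsto_mult_left_zero[OF LIMSEQ_power_zero[of k]] k by simp
  have "\<exists>u\<in>L2 M. (\<lambda>n. L2_norm M (\<lambda>x. U n x - u x)) \<longlonglongrightarrow> 0"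
  proof (rule L2_complete[OF UL])
    fix \<epsilon> :: real assume "\<epsilon> > 0"
    from order_tendstoD(2)[OF \<open>(\<lambda>n. k ^ n * B) \<longlonglongrightarrow> 0\<close> this]
    obtain N where N: "\<And>n. n \<ge> N \<Longrightarrow> k ^ n * B < \<epsilon>" by (auto simp: eventually_sequentially)
    have *: "L2_norm M (\<lambda>x. U m x - U n x) < \<epsilon>" if "n \<ge> N" "m \<ge> n" for m n
      using Ud[of n "m - n"] N[of n] that by simp
    have "L2_norm M (\<lambda>x. U m x - U n x) < \<epsilon>" if "m \<ge> N" "n \<ge> N" for m n
      using *[of n m] *[of m n] that by (cases "m \<ge> n") (auto simp: L2_norm_minus[of M "U m"])
    then show "\<exists>N. \<forall>m\<ge>N. \<forall>n\<ge>N. L2_norm M (\<lambda>x. U m x - U n x) < \<epsilon>" by blast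
  qed
  then obtain u where u: "u \<in> L2 M" and lim: "(\<lambda>n. L2_norm M (\<lambda>x. U n x - u x)) \<longlonglongrightarrow> 0" by blast
  have "L2_norm M (\<lambda>x. T u x - u x) \<le> k * L2_norm M (\<lambda>x. U n x - u x) + L2_norm M (\<lambda>x. U (Suc n) x - u x)" for n
  proof -
    have "L2_norm M (\<lambda>x. (T u x - T (U n) x) + (U (Suc n) x - u x))
        \<le> L2_norm M (\<lambda>x. T u x - T (U n) x) + L2_norm M (\<lambda>x. U (Suc n) x - u x)"
      by (intro L2_norm_triangle L2_diff TL UL u)
    moreover have "L2_norm M (\<lambda>x. T u x - T (U n) x) \<le> k * L2_norm M (\<lambda>x. U n x - u x)"
      using contr[OF u UL[of n]] by (simp add: L2_norm_minus[of M u])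
    ultimately show ?thesis by (simp add: US)
  qed
  moreover have "(\<lambda>n. k * L2_norm M (\<lambda>x. U n x - u x) + L2_norm M (\<lambda>x. U (Suc n) x - u x)) \<longlonglongrightarrow> k * 0 + 0"
    by (intro tendsto_add tendsto_mult_left lim LIMSEQ_Suc)
  ultimately have "L2_norm M (\<lambda>x. T u x - u x) \<le> k * 0 + 0"
    by (intro LIMSEQ_le_const) auto
  then have "L2_norm M (\<lambda>x. T u x - u x) = 0" using L2_norm_nonneg[of M] by (metis add_0_right antisym mult_zero_right)
  \<comment> \<open>The fixed-point equation holds almost everywhere. The solution exhibited is
    therefore \<open>T u\<close>, for which \<open>R\<close> supplies an approximating
    sequence.\<close>
  from L2_norm_eq_0_AE[OF L2_diff[OF TL[OF u] u] this] have ae: "AE x in M. T u x = u x" by simp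
  from R[OF Tg[OF u]] obtain \<phi> where \<phi>: "fa \<phi> (T u)" and l:
    "\<And>\<psi> v. fa \<psi> v \<Longrightarrow> (\<lambda>n. q (\<phi> n) (\<psi> n) - z0 * L2_inner M (\<phi> n) (\<psi> n))
        \<longlonglongrightarrow> L2_inner M (\<lambda>x. f x + (z - z0) * u x) v"
    unfolding weak_solution_def T_def by blast
  have "(\<lambda>n. q (\<phi> n) (\<psi> n) - z * L2_inner M (\<phi> n) (\<psi> n)) \<longlonglongrightarrow> L2_inner M f v" if \<psi>: "fa \<psi> v" for \<psi> v
  proof -
    have "(\<lambda>n. (q (\<phi> n) (\<psi> n) - z0 * L2_inner M (\<phi> n) (\<psi> n)) - (z - z0) * L2_inner M (\<phi> n) (\<psi> n))
        \<longlonglongrightarrow> L2_inner M (\<lambda>x. f x + (z - z0) * u x) v - (z - z0) * L2_inner M (T u) v"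
      by (intro tendsto_diff l tendsto_mult_left fa_inner_tendsto \<phi> \<psi>)
    moreover have "L2_inner M (\<lambda>x. f x + (z - z0) * u x) v = L2_inner M f v + (z - z0) * L2_inner M u v"
      using f u fa_D(1)[OF \<psi>] by (simp add: L2_inner_add_left L2_inner_scale_left L2_scale)
    moreover have "L2_inner M (T u) v = L2_inner M u v"
      by (rule L2_inner_cong_AE[OF TL[OF u] u fa_D(1)[OF \<psi>] ae])
    ultimately show ?thesis by (simp add: algebra_simps)
  qed
  with \<phi> f have "weak_solution z (T u) f" by (auto simp: weak_solution_def)
  then show "\<exists>u. weak_solution z u f" by blast
qed

text \<open>The discs of radius \<open>l\<close> around \<open>- l\<close> exhaust the open left
  half-plane. From there every nonreal point is reached by horizontal steps of half its distance to
  the real axis; the bound by \<open>\<bar>Im z\<bar>\<close> does not deteriorate along the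
  way.\<close>

lemma solvable_resolvent_set:
  assumes "z \<notin> \<real>\<^sub>\<ge>\<^sub>0"
  shows "solvable z"
proof -
  have left: "solvable z" if "Re z < 0" for z
  proof (rule solvable_step)
    \<comment> \<open>Being in the disc means \<open>|z|^2 + 2 l Re z < 0\<close>; this
      \<open>l\<close> makes the left-hand side \<open>2 Re z\<close>.\<close>
    define l where "l = (cmod z)\<^sup>2 / (- 2 * Re z) + 1"
    have l: "l > 0" using that unfolding l_def by (intro add_nonneg_pos divide_nonneg_pos) auto
    have "(cmod (z - of_real (- l)))\<^sup>2 = (cmod z)\<^sup>2 + 2 * l * Re z + l\<^sup>2"
      unfolding cmod_power2 by (simp add: power2_eq_square algebra_simps)
    also have "2 * l * Re z = - (cmod z)\<^sup>2 + 2 * Re z" using that by (simp add: l_def field_simps)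
    finally have "(cmod (z - of_real (- l)))\<^sup>2 < l\<^sup>2" using that by simp
    then show "cmod (z - of_real (- l)) < l"
      by (rule power2_less_imp_less) (use l in simp)
    show "solvable (of_real (- l))" unfolding solvable_def using weak_solution_exists_negative[OF l] by blast
    show "l > 0" by (rule l)
    show "l * L2_norm M u \<le> L2_norm M f" if "weak_solution (of_real (- l)) u f" for u f
      using weak_solution_bound(2)[OF that] by simp
  qed
  \<comment> \<open>\<open>n\<close> counts horizontal steps; for \<open>n = 0\<close> the point is
    already in the left half-plane.\<close>
  have "solvable z" if "Im z \<noteq> 0" "Re z < real n * (\<bar>Im z\<bar> / 2)" for z n
    using that
  proof (induction n arbitrary: z)
    case 0
    then show ?case by (intro left) simp
  next
    case (Suc n)
    let ?z0 = "z - of_real (\<bar>Im z\<bar> / 2)"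
    show ?case
    proof (rule solvable_step)
      show "solvable ?z0" by (rule Suc.IH) (use Suc.prems in \<open>auto simp: algebra_simps\<close>)
      show "cmod (z - ?z0) < \<bar>Im z\<bar>" using Suc.prems by (simp add: norm_divide)
      show "\<bar>Im z\<bar> * L2_norm M u \<le> L2_norm M f" if "weak_solution ?z0 u f" for u f
        using weak_solution_bound(1)[OF that] by simp
    qed (use Suc.prems in simp)
  qed
  moreover have "\<exists>n. Re z < real n * (\<bar>Im z\<bar> / 2)" if "Im z \<noteq> 0"
    using reals_Archimedean3[of "\<bar>Im z\<bar> / 2"] that by auto
  ultimately show ?thesis
    using left assms by (cases "Im z = 0") (auto simp: complex_nonneg_Reals_iff not_le)
qed

end

section \<open>Test functions and integration by parts\<close>

text \<open>Local version of \<open>Ck\<close>, since powers of \<open>1 + x\<close> are smooth only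
  where \<open>x > -1\<close>. \<open>dir_deriv\<close> uses the derivative in the full space, which
  is why congruence, sums and products ask for open sets.\<close>

primrec Ck_on :: "nat \<Rightarrow> 'a::euclidean_space set \<Rightarrow> ('a \<Rightarrow> complex) \<Rightarrow> bool" where
  "Ck_on 0 S f \<longleftrightarrow> continuous_on S f"
| "Ck_on (Suc k) S f \<longleftrightarrow> (\<forall>p\<in>S. f differentiable at p) \<and> (\<forall>b\<in>Basis. Ck_on k S (dir_deriv b f))"

lemma Ck_on_UNIV: "Ck_on k UNIV f \<longleftrightarrow> Ck k f"
  by (induction k arbitrary: f) auto

lemma dir_derivI: "(f has_derivative f') (at p) \<Longrightarrow> dir_deriv b f p = f' b"
  unfolding dir_deriv_def using frechet_derivative_at by metis

lemma dir_deriv_cong_open: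
  assumes "open S" "p \<in> S" "\<And>p. p \<in> S \<Longrightarrow> f p = g p" "f differentiable at p"
  shows "dir_deriv b f p = dir_deriv b g p" "g differentiable at p"
proof -
  obtain f' where f': "(f has_derivative f') (at p)" using assms(4) by (auto simp: differentiable_def)
  have g': "(g has_derivative f') (at p)"
    by (rule has_derivative_transform_within_open[OF f' assms(1,2)]) (rule assms(3))
  show "dir_deriv b f p = dir_deriv b g p" using dir_derivI[OF f'] dir_derivI[OF g'] by simp
  show "g differentiable at p" using g' by (auto simp: differentiable_def)
qed

lemma Ck_on_cong:
  assumes "open S" "\<And>p. p \<in> S \<Longrightarrow> f p = g p" "Ck_on k S f"
  shows "Ck_on k S g"
  using assms(2,3)
proof (induction k arbitrary: f g)
  case 0
  then show ?case by (simp cong: continuous_on_cong)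
next
  case (Suc k)
  note c = dir_deriv_cong_open[OF assms(1) _ Suc.prems(1)]
  have "Ck_on k S (dir_deriv b g)" if b: "b \<in> Basis" for b
  proof (rule Suc.IH[of "dir_deriv b f"])
    show "dir_deriv b f p = dir_deriv b g p" if "p \<in> S" for p
      by (rule c(1)) (use Suc.prems(2) that in auto)
  qed (use Suc.prems(2) b in auto)
  moreover have "g differentiable at p" if "p \<in> S" for p
    by (rule c(2)) (use Suc.prems(2) that in auto)
  ultimately show ?case by simp
qed

lemma Ck_on_SucD: "Ck_on (Suc k) S f \<Longrightarrow> Ck_on k S f"
proof (induction k arbitrary: f)
  case 0
  then show ?case
    by (auto intro!: continuous_at_imp_continuous_on differentiable_imp_continuous_within)
qed auto

lemma has_derivative_frechet:
  "f differentiable at p \<Longrightarrow> (f has_derivative frechet_derivative f (at p)) (at p)"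
  by (simp add: frechet_derivative_works[symmetric])

lemma Ck_on_add:
  assumes "open S"
  shows "Ck_on k S f \<Longrightarrow> Ck_on k S g \<Longrightarrow> Ck_on k S (\<lambda>p. f p + g p)"
proof (induction k arbitrary: f g)
  case 0
  then show ?case by (auto intro: continuous_on_add)
next
  case (Suc k)
  have d: "dir_deriv b f p + dir_deriv b g p = dir_deriv b (\<lambda>p. f p + g p) p" if "p \<in> S" for p b
    using has_derivative_add[OF has_derivative_frechet has_derivative_frechet, of f p g] Suc.prems that
    by (subst dir_derivI[of "\<lambda>p. f p + g p"]) (auto simp: dir_deriv_def)
  have "Ck_on k S (dir_deriv b (\<lambda>p. f p + g p))" if "b \<in> Basis" for b
    by (rule Ck_on_cong[OF assms d Suc.IH]) (use Suc.prems that in auto)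
  then show ?case using Suc.prems by auto
qed

lemma Ck_on_mult:
  assumes "open S"
  shows "Ck_on k S f \<Longrightarrow> Ck_on k S g \<Longrightarrow> Ck_on k S (\<lambda>p. f p * g p)"
proof (induction k arbitrary: f g)
  case 0
  then show ?case by (auto intro: continuous_on_mult)
next
  case (Suc k)
  have d: "f p * dir_deriv b g p + dir_deriv b f p * g p = dir_deriv b (\<lambda>p. f p * g p) p" if "p \<in> S" for p b
    using has_derivative_mult[OF has_derivative_frechet has_derivative_frechet, of f p g] Suc.prems that
    by (subst dir_derivI[of "\<lambda>p. f p * g p"]) (auto simp: dir_deriv_def)
  have "Ck_on k S (dir_deriv b (\<lambda>p. f p * g p))" if "b \<in> Basis" for b
    by (rule Ck_on_cong[OF assms d Ck_on_add[OF assms Suc.IH[OF Ck_on_SucD] Suc.IH[OF _ Ck_on_SucD]]])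
      (use Suc.prems that in auto)
  then show ?case using Suc.prems by auto
qed

lemma Ck_on_Un:
  assumes "open S" "open T"
  shows "Ck_on k S f \<Longrightarrow> Ck_on k T f \<Longrightarrow> Ck_on k (S \<union> T) f"
proof (induction k arbitrary: f)
  case 0
  then show ?case using assms by (auto intro: continuous_on_open_Un)
qed auto

lemma Ck_on_subset: "Ck_on k S f \<Longrightarrow> T \<subseteq> S \<Longrightarrow> Ck_on k T f"
proof (induction k arbitrary: f)
  case 0
  then show ?case by (auto intro: continuous_on_subset)
qed auto

lemma Ck_on_const:
  fixes S :: "'a::euclidean_space set"
  shows "Ck_on k S (\<lambda>p. c)"
proof (induction k arbitrary: c)
  case (Suc k)
  have "dir_deriv b (\<lambda>p. c) = (\<lambda>p. 0)" for b :: 'a by (auto simp: dir_deriv_def)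
  then show ?case using Suc.IH[of 0] by simp
qed simp

lemma Ck_add: "Ck k f \<Longrightarrow> Ck k g \<Longrightarrow> Ck k (\<lambda>p. f p + g p)"
  and Ck_mult: "Ck k f \<Longrightarrow> Ck k g \<Longrightarrow> Ck k (\<lambda>p. f p * g p)"
  and Ck_const: "Ck k (\<lambda>p. c)"
  using Ck_on_add[of UNIV k] Ck_on_mult[of UNIV k] Ck_on_const[of k UNIV] by (auto simp: Ck_on_UNIV)

lemma has_derivative_translate:
  assumes "(f has_derivative f') (at (p - c))"
  shows "((\<lambda>p. f (p - c)) has_derivative f') (at p)"
proof -
  have "((\<lambda>p. p - c) has_derivative (\<lambda>x. x)) (at p)"
    by (auto intro!: derivative_eq_intros)
  from has_derivative_compose[OF this assms] show ?thesis by simp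
qed

lemma dir_deriv_translate:
  assumes "\<And>p. f differentiable at p"
  shows "dir_deriv b (\<lambda>p. f (p - c)) = (\<lambda>p. dir_deriv b f (p - c))"
  using dir_derivI[OF has_derivative_translate[OF has_derivative_frechet[OF assms]]]
  by (auto simp: dir_deriv_def)

lemma Ck_translate: "Ck k f \<Longrightarrow> Ck k (\<lambda>p. f (p - c))"
proof (induction k arbitrary: f)
  case 0
  then show ?case by (auto intro!: continuous_on_compose2[of UNIV f] continuous_intros)
next
  case (Suc k)
  have "(\<lambda>p. f (p - c)) differentiable at p" for p
    using has_derivative_translate[OF has_derivative_frechet, of f p c] Suc.prems by (auto simp: differentiable_def)
  then show ?case using Suc by (simp add: dir_deriv_translate)
qed

section \<open>Powers of 1 + x\<close>

definition wt :: "real \<Rightarrow> real \<times> 'b \<Rightarrow> real" where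
  "wt a p = (1 + fst p) powr a"

lemma wt_has_derivative:
  fixes p :: "real \<times> 'b::real_normed_vector"
  assumes "fst p > -1"
  shows "(wt a has_derivative (\<lambda>v. a * wt (a - 1) p * fst v)) (at p)"
proof -
  have "((\<lambda>x. (1 + x) powr a) has_real_derivative a * (1 + fst p) powr (a - 1)) (at (fst p))"
    using assms by (auto intro!: derivative_eq_intros)
  then have "((\<lambda>x. (1 + x) powr a) has_derivative (\<lambda>v. a * (1 + fst p) powr (a - 1) * v)) (at (fst p))"
    by (simp add: has_field_derivative_def)
  from has_derivative_compose[OF has_derivative_fst[OF has_derivative_ident] this]
  show ?thesis by (simp add: wt_def[abs_def])
qed

lemma open_half: "open {p :: real \<times> 'b::real_normed_vector. fst p > -1}"
  by (intro open_Collect_less continuous_intros)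

lemma Ck_on_wt: "Ck_on k {p :: real \<times> 'b::euclidean_space. fst p > -1} (\<lambda>p. of_real (wt a p))"
proof (induction k arbitrary: a)
  case 0
  have "isCont (wt a) p" if "fst p > -1" for p :: "real \<times> 'b"
    using has_derivative_continuous[OF wt_has_derivative[OF that]] .
  then show ?case
    by (auto intro!: continuous_at_imp_continuous_on continuous_of_real)
next
  case (Suc k)
  let ?H = "{p :: real \<times> 'b. fst p > -1}"
  have der: "((\<lambda>p. complex_of_real (wt a p)) has_derivative (\<lambda>v. of_real (a * wt (a - 1) p * fst v))) (at p)"
    if "p \<in> ?H" for p
    using has_derivative_of_real[OF wt_has_derivative[of p a]] that by simp
  have d: "of_real (a * fst b) * of_real (wt (a - 1) p) = dir_deriv b (\<lambda>p. complex_of_real (wt a p)) p"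
    if "p \<in> ?H" for p b
    using dir_derivI[OF der[OF that], of b] by simp
  have "Ck_on k ?H (dir_deriv b (\<lambda>p. complex_of_real (wt a p)))" for b
    by (rule Ck_on_cong[OF open_half d Ck_on_mult[OF open_half Ck_on_const Suc.IH]])
  moreover have "(\<lambda>p. complex_of_real (wt a p)) differentiable at p" if "p \<in> ?H" for p
    using der[OF that] by (auto simp: differentiable_def)
  ultimately show ?case by simp
qed

lemma wt_nonneg [simp]: "0 \<le> wt a p"
  by (simp add: wt_def)

lemma wt_le_1: "a \<le> 0 \<Longrightarrow> fst p \<ge> 0 \<Longrightarrow> wt a p \<le> 1"
  unfolding wt_def using powr_mono[of a 0 "1 + fst p"] by simp

lemma wt_add: "fst p > -1 \<Longrightarrow> wt (a + b) p = wt a p * wt b p"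
  by (simp add: wt_def powr_add)

lemma wt_measurable [measurable]: "(wt a :: real \<times> 'b::euclidean_space \<Rightarrow> real) \<in> borel_measurable borel"
proof -
  have "fst \<in> borel_measurable (borel :: (real \<times> 'b) measure)"
    by (intro borel_measurable_continuous_onI continuous_intros)
  then show ?thesis unfolding wt_def[abs_def] by measurable
qed

section \<open>Closure properties of test functions\<close>

lemma test_Ck: "\<phi> \<in> test_functions \<Omega> \<Longrightarrow> Ck k \<phi>"
  and test_compact: "\<phi> \<in> test_functions \<Omega> \<Longrightarrow> compact (closure {p. \<phi> p \<noteq> 0})"
  and test_supp: "\<phi> \<in> test_functions \<Omega> \<Longrightarrow> closure {p. \<phi> p \<noteq> 0} \<subseteq> \<Omega>"
  by (auto simp: test_functions_def)

lemma outside_closure_support: "p \<notin> closure {p. \<phi> p \<noteq> 0} \<Longrightarrow> \<phi> p = 0"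
  using closure_subset[of "{p. \<phi> p \<noteq> 0}"] by blast

lemma test_outside: "\<phi> \<in> test_functions \<Omega> \<Longrightarrow> p \<notin> \<Omega> \<Longrightarrow> \<phi> p = 0"
  using test_supp[of \<phi> \<Omega>] outside_closure_support[of p \<phi>] by blast

lemma test_continuous: "\<phi> \<in> test_functions \<Omega> \<Longrightarrow> continuous_on UNIV \<phi>"
  using test_Ck[of \<phi> \<Omega> 0] by simp

lemma test_differentiable: "\<phi> \<in> test_functions \<Omega> \<Longrightarrow> \<phi> differentiable at p"
  using test_Ck[of \<phi> \<Omega> 1] by simp

lemma test_has_derivative:
  "\<phi> \<in> test_functions \<Omega> \<Longrightarrow> (\<phi> has_derivative (\<lambda>v. dir_deriv v \<phi> p)) (at p)"
  using has_derivative_frechet[OF test_differentiable] by (simp add: dir_deriv_def)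

lemma test_I:
  assumes "\<And>k. Ck k \<phi>" "compact K" "K \<subseteq> \<Omega>" "\<And>p. p \<notin> K \<Longrightarrow> \<phi> p = 0"
  shows "\<phi> \<in> test_functions \<Omega>"
proof -
  have "closure {p. \<phi> p \<noteq> 0} \<subseteq> K"
    by (rule closure_minimal) (use assms in \<open>auto intro: compact_imp_closed\<close>)
  moreover have "compact (K \<inter> closure {p. \<phi> p \<noteq> 0})"
    by (rule compact_Int_closed[OF assms(2) closed_closure])
  ultimately show ?thesis
    using assms(1,3) by (auto simp: test_functions_def Int_absorb1)
qed

lemma test_zero: "(\<lambda>p. 0) \<in> test_functions \<Omega>"
  by (rule test_I[where K="{}"]) (auto simp: Ck_const)

lemma test_add:
  assumes "\<phi> \<in> test_functions \<Omega>" "\<psi> \<in> test_functions \<Omega>"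
  shows "(\<lambda>p. \<phi> p + \<psi> p) \<in> test_functions \<Omega>"
proof (rule test_I)
  show "compact (closure {p. \<phi> p \<noteq> 0} \<union> closure {p. \<psi> p \<noteq> 0})"
    using test_compact assms by (intro compact_Un)
  show "\<phi> p + \<psi> p = 0" if "p \<notin> closure {p. \<phi> p \<noteq> 0} \<union> closure {p. \<psi> p \<noteq> 0}" for p
    using that outside_closure_support[of p \<phi>] outside_closure_support[of p \<psi>] by simp
  show "closure {p. \<phi> p \<noteq> 0} \<union> closure {p. \<psi> p \<noteq> 0} \<subseteq> \<Omega>"
    using test_supp[OF assms(1)] test_supp[OF assms(2)] by simp
qed (intro Ck_add test_Ck[OF assms(1)] test_Ck[OF assms(2)])

lemma test_mult:
  assumes "\<phi> \<in> test_functions \<Omega>" "\<And>k. Ck k \<psi>"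
  shows "(\<lambda>p. \<psi> p * \<phi> p) \<in> test_functions \<Omega>"
proof (rule test_I[OF _ test_compact[OF assms(1)] test_supp[OF assms(1)]])
  show "\<psi> p * \<phi> p = 0" if "p \<notin> closure {p. \<phi> p \<noteq> 0}" for p
    using outside_closure_support[OF that] by simp
qed (rule Ck_mult[OF assms(2) test_Ck[OF assms(1)]])

lemma test_scale: "\<phi> \<in> test_functions \<Omega> \<Longrightarrow> (\<lambda>p. c * \<phi> p) \<in> test_functions \<Omega>"
  by (intro test_mult Ck_const)

lemma test_diff:
  "\<phi> \<in> test_functions \<Omega> \<Longrightarrow> \<psi> \<in> test_functions \<Omega> \<Longrightarrow> (\<lambda>p. \<phi> p - \<psi> p) \<in> test_functions \<Omega>"
  using test_add[of \<phi> \<Omega> "\<lambda>p. (-1) * \<psi> p"] test_scale[of \<psi> \<Omega> "-1"] by simp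

text \<open>The compact support is translated by \<open>c\<close>. With \<open>c = (h, 0)\<close>
  and \<open>h \<ge> 0\<close> this is where forward invariance of the domain enters.\<close>

lemma test_translate:
  assumes \<phi>: "\<phi> \<in> test_functions \<Omega>" and "\<And>p. p \<in> \<Omega> \<Longrightarrow> p + c \<in> \<Omega>"
  shows "(\<lambda>p. \<phi> (p - c)) \<in> test_functions \<Omega>"
proof (rule test_I)
  show "compact ((+) c ` closure {p. \<phi> p \<noteq> 0})"
    by (rule compact_translation[OF test_compact[OF \<phi>]])
  show "(+) c ` closure {p. \<phi> p \<noteq> 0} \<subseteq> \<Omega>"
    using test_supp[OF \<phi>] assms(2) by (auto simp: add.commute)
  show "\<phi> (p - c) = 0" if "p \<notin> (+) c ` closure {p. \<phi> p \<noteq> 0}" for p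
  proof (rule ccontr)
    assume "\<phi> (p - c) \<noteq> 0"
    then have "p - c \<in> closure {p. \<phi> p \<noteq> 0}"
      using closure_subset[of "{p. \<phi> p \<noteq> 0}"] by auto
    then have "c + (p - c) \<in> (+) c ` closure {p. \<phi> p \<noteq> 0}" by (rule imageI)
    then show False using that by simp
  qed
qed (use test_Ck[OF \<phi>] Ck_translate in auto)

lemma test_dir_deriv:
  assumes \<phi>: "\<phi> \<in> test_functions \<Omega>" and b: "b \<in> Basis"
  shows "dir_deriv b \<phi> \<in> test_functions \<Omega>"
proof (rule test_I[OF _ test_compact[OF \<phi>] test_supp[OF \<phi>]])
  show "Ck k (dir_deriv b \<phi>)" for k using test_Ck[OF \<phi>, of "Suc k"] b by simp
  fix p assume "p \<notin> closure {p. \<phi> p \<noteq> 0}"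
  then have "dir_deriv b (\<lambda>p. 0) p = dir_deriv b \<phi> p"
    by (intro dir_deriv_cong_open(1)[of "- closure {p. \<phi> p \<noteq> 0}"]) (auto dest: outside_closure_support)
  then show "dir_deriv b \<phi> p = 0" by (simp add: dir_deriv_def)
qed

text \<open>Two open sets cover the space: on \<open>fst p > -1\<close> the weight is smooth, and
  off the support the product is zero. Smoothness is glued from these two pieces.\<close>

lemma test_wt:
  fixes \<Omega> :: "(real \<times> 'b::euclidean_space) set"
  assumes \<phi>: "\<phi> \<in> test_functions \<Omega>" and pos: "\<And>p. p \<in> \<Omega> \<Longrightarrow> fst p > 0"
  shows "(\<lambda>p. of_real (wt a p) * \<phi> p) \<in> test_functions \<Omega>"
proof (rule test_I[OF _ test_compact[OF \<phi>] test_supp[OF \<phi>]])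
  let ?K = "closure {p. \<phi> p \<noteq> 0}" and ?H = "{p :: real \<times> 'b. fst p > -1}"
  have out: "of_real (wt a p) * \<phi> p = 0" if "p \<notin> ?K" for p
    using outside_closure_support[OF that] by simp
  then show "of_real (wt a p) * \<phi> p = 0" if "p \<notin> ?K" for p using that .
  fix k
  have "Ck_on k ?H (\<lambda>p. of_real (wt a p) * \<phi> p)"
    using test_Ck[OF \<phi>] Ck_on_subset[of k UNIV \<phi> ?H]
    by (intro Ck_on_mult open_half Ck_on_wt) (auto simp: Ck_on_UNIV)
  moreover have "Ck_on k (- ?K) (\<lambda>p. of_real (wt a p) * \<phi> p)"
    by (rule Ck_on_cong[OF _ _ Ck_on_const[of k "- ?K" 0]]) (use out in auto)
  ultimately have "Ck_on k (?H \<union> - ?K) (\<lambda>p. of_real (wt a p) * \<phi> p)"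
    by (intro Ck_on_Un open_half) auto
  moreover have "?H \<union> - ?K = UNIV" using test_supp[OF \<phi>] pos by force
  ultimately show "Ck k (\<lambda>p. of_real (wt a p) * \<phi> p)" by (simp add: Ck_on_UNIV)
qed

section \<open>Translation invariance of the integral and difference quotients\<close>

lemma integrable_continuous_compact_support:
  fixes f :: "'a::euclidean_space \<Rightarrow> 'b::{banach, second_countable_topology}"
  assumes "continuous_on UNIV f" "compact K" "\<And>p. p \<notin> K \<Longrightarrow> f p = 0"
  shows "integrable lborel f"
proof -
  have "integrable lborel (\<lambda>x. indicator K x *\<^sub>R f x)"
    by (rule borel_integrable_compact[OF assms(2) continuous_on_subset[OF assms(1)]]) auto
  moreover have "(\<lambda>x. indicator K x *\<^sub>R f x) = f"
    using assms(3) by (auto simp: indicator_def)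
  ultimately show ?thesis by simp
qed

lemma integral_lborel_translate:
  fixes f :: "'a::euclidean_space \<Rightarrow> 'b::{banach, second_countable_topology}"
  assumes [measurable]: "f \<in> borel_measurable borel"
  shows "(LINT p|lborel. f (p - c)) = (LINT p|lborel. f p)"
proof -
  have "(LINT p|lborel. f p) = (LINT p|distr lborel borel ((+) (- c)). f p)"
    by (simp only: lborel_distr_plus)
  also have "\<dots> = (LINT p|lborel. f (- c + p))" by (rule integral_distr) auto
  finally show ?thesis by simp
qed

lemma integrable_lborel_translate:
  fixes f :: "'a::euclidean_space \<Rightarrow> 'b::{banach, second_countable_topology}"
  assumes "integrable lborel f"
  shows "integrable lborel (\<lambda>p. f (p - c))"
proof -
  have "integrable (distr lborel borel ((+) (- c))) f" using assms by (simp only: lborel_distr_plus)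
  then show ?thesis by (subst (asm) integrable_distr_eq) (use assms in auto)
qed

lemma difference_quotient_tendsto:
  fixes h :: "'a::real_normed_vector \<Rightarrow> 'b::real_normed_vector"
  assumes der: "(h has_derivative h') (at p)"
  shows "((\<lambda>t. (h (p + t *\<^sub>R v) - h p) /\<^sub>R t) \<longlongrightarrow> h' v) (at 0)"
proof -
  have "((\<lambda>t. p + t *\<^sub>R v) has_derivative (\<lambda>t. t *\<^sub>R v)) (at 0)"
    by (auto intro!: derivative_eq_intros)
  from has_derivative_compose[OF this, of h h'] der
  have "((\<lambda>t. h (p + t *\<^sub>R v)) has_derivative (\<lambda>t. t *\<^sub>R h' v)) (at 0)"
    using linear_scale[OF has_derivative_linear[OF der]] by simp
  then have "(\<lambda>t. norm (h (p + t *\<^sub>R v) - h p - t *\<^sub>R h' v) / norm t) \<midarrow>0\<rightarrow> 0"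
    by (simp add: has_derivative_at)
  moreover have "norm (h (p + t *\<^sub>R v) - h p - t *\<^sub>R h' v) / norm t
      = norm ((h (p + t *\<^sub>R v) - h p) /\<^sub>R t - h' v)" if "t \<noteq> 0" for t
  proof -
    have "(h (p + t *\<^sub>R v) - h p) /\<^sub>R t - h' v = (h (p + t *\<^sub>R v) - h p - t *\<^sub>R h' v) /\<^sub>R t"
      using that by (simp add: scaleR_diff_right)
    then show ?thesis by (simp add: divide_inverse mult.commute)
  qed
  ultimately have "(\<lambda>t. norm ((h (p + t *\<^sub>R v) - h p) /\<^sub>R t - h' v)) \<midarrow>0\<rightarrow> 0"
    by (auto elim!: Lim_transform_eventually simp: eventually_at_filter)
  then show ?thesis by (rule LIM_zero_cancel[OF tendsto_norm_zero_cancel])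
qed

text \<open>Majorant for dominated convergence, uniform in the step. For \<open>t \<le> 1\<close>
  the displacement is at most \<open>norm v\<close>, so all quotients and the derivative vanish
  outside one ball.\<close>

lemma difference_quotient_bound:
  fixes h :: "'a::euclidean_space \<Rightarrow> 'b::real_normed_vector"
  assumes der: "\<And>p. (h has_derivative h' p) (at p)" and cont: "continuous_on UNIV (\<lambda>p. h' p v)"
    and K: "compact K" "\<And>p. p \<notin> K \<Longrightarrow> h p = 0"
  shows "\<exists>R B. B \<ge> 0 \<and> (\<forall>t p. 0 < t \<longrightarrow> t \<le> 1 \<longrightarrow>
    norm ((h (p + t *\<^sub>R v) - h p) /\<^sub>R t) \<le> B * indicator (cball 0 R) p \<and> norm (h' p v) \<le> B * indicator (cball 0 R) p)"
proof -
  have h'0: "h' p v = 0" if "p \<notin> K" for p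
  proof -
    have "(h has_derivative (\<lambda>v. 0)) (at p)"
      by (rule has_derivative_transform_within_open[of "\<lambda>p. 0" _ _ _ "- K"])
        (use that K compact_imp_closed in auto)
    from has_derivative_unique[OF der this] show ?thesis by simp
  qed
  have "bounded ((\<lambda>p. h' p v) ` K)"
    by (intro compact_imp_bounded compact_continuous_image continuous_on_subset[OF cont] K) auto
  then obtain B where B: "\<And>p. p \<in> K \<Longrightarrow> norm (h' p v) \<le> B" by (auto simp: bounded_iff)
  have B': "norm (h' p v) \<le> max B 0" for p using B[of p] h'0[of p] by (cases "p \<in> K") auto
  obtain R where "\<And>x. x \<in> K \<Longrightarrow> norm x \<le> R"
    using compact_imp_bounded[OF K(1)] by (auto simp: bounded_iff)
  then have R: "K \<subseteq> cball 0 R" by auto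
  have line: "((\<lambda>t. h (p + t *\<^sub>R v)) has_derivative (\<lambda>s. s *\<^sub>R h' (p + t *\<^sub>R v) v)) (at t within S)" for p t S
  proof -
    have "((\<lambda>t. p + t *\<^sub>R v) has_derivative (\<lambda>s. s *\<^sub>R v)) (at t within S)"
      by (auto intro!: derivative_eq_intros)
    from has_derivative_compose[OF this der]
    show ?thesis using linear_scale[OF has_derivative_linear[OF der]] by simp
  qed
  have "norm ((h (p + t *\<^sub>R v) - h p) /\<^sub>R t) \<le> max B 0 * indicator (cball 0 (R + norm v)) p"
    if t: "0 < t" "t \<le> 1" for t p
  proof (cases "p \<in> cball 0 (R + norm v)")
    case True
    have "norm (h (p + t *\<^sub>R v) - h (p + 0 *\<^sub>R v)) \<le> max B 0 * norm (t - 0)"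
    proof (rule differentiable_bound[of UNIV "\<lambda>t. h (p + t *\<^sub>R v)" "\<lambda>t s. s *\<^sub>R h' (p + t *\<^sub>R v) v"])
      show "onorm (\<lambda>s. s *\<^sub>R h' (p + t *\<^sub>R v) v) \<le> max B 0" for t :: real
        by (rule onorm_le) (use B'[of "p + t *\<^sub>R v"] in \<open>auto simp: mult.commute intro: mult_left_mono\<close>)
    qed (use line in auto)
    then have "norm (h (p + t *\<^sub>R v) - h p) / t \<le> max B 0"
      using t by (simp add: pos_divide_le_eq)
    then show ?thesis using True t by (simp add: divide_inverse mult.commute)
  next
    case False
    have "norm (t *\<^sub>R v) \<le> norm v" using t mult_right_mono[OF t(2), of "norm v"] by simp
    moreover have "norm p > R + norm v" using False by simp
    ultimately have "norm (p + t *\<^sub>R v) > R" "norm p > R"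
      using norm_diff_ineq[of p "t *\<^sub>R v"] norm_ge_zero[of v] by linarith+
    then have "p + t *\<^sub>R v \<notin> K" "p \<notin> K" using R by auto
    then show ?thesis using False K(2) by simp
  qed
  moreover have "norm (h' p v) \<le> max B 0 * indicator (cball 0 (R + norm v)) p" for p
  proof (cases "p \<in> K")
    case True
    then have "p \<in> cball 0 (R + norm v)" using subsetD[OF R True] by (simp add: add_increasing2)
    then show ?thesis using B'[of p] by simp
  qed (simp add: h'0)
  ultimately show ?thesis by (intro exI[of _ "R + norm v"] exI[of _ "max B 0"]) auto
qed

text \<open>Difference quotients have integral zero because Lebesgue measure is translation
  invariant; dominated convergence passes this to the derivative.\<close>

lemma integral_directional_derivative:
  fixes h :: "'a::euclidean_space \<Rightarrow> 'b::euclidean_space"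
  assumes der: "\<And>p. (h has_derivative h' p) (at p)" and cont: "continuous_on UNIV (\<lambda>p. h' p v)"
    and K: "compact K" "\<And>p. p \<notin> K \<Longrightarrow> h p = 0"
  shows "(LINT p|lborel. h' p v) = 0"
proof -
  have hc: "continuous_on UNIV h"
    using der has_derivative_continuous by (blast intro: continuous_at_imp_continuous_on)
  note [measurable] = borel_measurable_continuous_onI[OF hc] borel_measurable_continuous_onI[OF cont]
  have hi: "integrable lborel h" by (rule integrable_continuous_compact_support[OF hc K])
  obtain R B where RB: "\<And>t p. 0 < t \<Longrightarrow> t \<le> 1 \<Longrightarrow>
      norm ((h (p + t *\<^sub>R v) - h p) /\<^sub>R t) \<le> B * indicator (cball 0 R) p"
    using difference_quotient_bound[OF assms] by blast
  define s where "s = (\<lambda>n p. (h (p + (1 / real (Suc n)) *\<^sub>R v) - h p) /\<^sub>R (1 / real (Suc n)))"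
  have hti: "integrable lborel (\<lambda>p. h (p + c))" and htI: "(LINT p|lborel. h (p + c)) = (LINT p|lborel. h p)" for c
    using integrable_lborel_translate[OF hi, of "- c"] integral_lborel_translate[of h "- c"] by auto
  have s0: "(LINT p|lborel. s n p) = 0" for n
    unfolding s_def using hti hi htI by simp
  have "filterlim (\<lambda>n. 1 / real (Suc n)) (at 0) sequentially"
    using LIMSEQ_Suc[OF lim_1_over_n] by (simp add: filterlim_at del: of_nat_Suc)
  from filterlim_compose[OF difference_quotient_tendsto[OF der] this]
  have lim: "(\<lambda>n. s n p) \<longlonglongrightarrow> h' p v" for p unfolding s_def .
  have "(\<lambda>n. LINT p|lborel. s n p) \<longlonglongrightarrow> (LINT p|lborel. h' p v)"
  proof (rule integral_dominated_convergence[where w="\<lambda>p. B * indicator (cball 0 R) p"])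
    show "AE p in lborel. norm (s n p) \<le> B * indicator (cball 0 R) p" for n
      unfolding s_def by (intro AE_I2 RB) auto
  qed (use emeasure_lborel_cball_finite[of "0::'a" R] lim in \<open>auto simp: s_def\<close>)
  then show ?thesis unfolding s0 by (simp add: LIMSEQ_const_iff)
qed

section \<open>Passing between the domain and the whole space\<close>

lemma test_measurable: "\<phi> \<in> test_functions \<Omega> \<Longrightarrow> \<phi> \<in> borel_measurable borel"
  by (rule borel_measurable_continuous_onI[OF test_continuous])

lemma test_L2:
  assumes "\<phi> \<in> test_functions \<Omega>"
  shows "\<phi> \<in> L2 lborel"
proof -
  have "integrable lborel (\<lambda>p. (cmod (\<phi> p))\<^sup>2)"
    by (rule integrable_continuous_compact_support[OF _ test_compact[OF assms]])
      (auto intro!: continuous_intros test_continuous[OF assms] dest: outside_closure_support)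
  then show ?thesis using test_measurable[OF assms] by (simp add: L2_def)
qed

lemma L2_vol:
  assumes "open \<Omega>" "f \<in> L2 lborel"
  shows "f \<in> L2 (vol \<Omega>)"
proof -
  note [measurable] = L2_D(1)[OF assms(2)]
  have "integrable lborel (\<lambda>p. indicator \<Omega> p *\<^sub>R (cmod (f p))\<^sup>2)"
  proof (rule Bochner_Integration.integrable_bound[OF L2_D(2)[OF assms(2)]])
    have [measurable]: "\<Omega> \<in> sets borel" using assms(1) by simp
    show "(\<lambda>p. indicator \<Omega> p *\<^sub>R (cmod (f p))\<^sup>2) \<in> borel_measurable lborel" by measurable
  qed (auto simp: indicator_def)
  then show ?thesis
    using assms(1) L2_D(1)[OF assms(2)]
    by (auto simp: L2_def integrable_restrict_space intro: measurable_restrict_space1)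
qed

lemma L2_vol_extend:
  fixes f :: "'a::euclidean_space \<Rightarrow> complex"
  assumes "open \<Omega>" "f \<in> L2 (vol \<Omega>)"
  shows "(\<lambda>p. indicator \<Omega> p *\<^sub>R f p) \<in> L2 lborel"
proof -
  have m: "(\<lambda>p. indicator \<Omega> p *\<^sub>R f p) \<in> borel_measurable lborel"
    using L2_D(1)[OF assms(2)] assms(1) by (subst (asm) borel_measurable_restrict_space_iff) auto
  have "integrable lborel (\<lambda>p. indicator \<Omega> p *\<^sub>R (cmod (f p))\<^sup>2)"
    using L2_D(2)[OF assms(2)] assms(1) by (subst (asm) integrable_restrict_space) auto
  moreover have "(\<lambda>p. (cmod (indicator \<Omega> p *\<^sub>R f p))\<^sup>2) = (\<lambda>p. indicator \<Omega> p *\<^sub>R (cmod (f p))\<^sup>2)"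
    by (auto simp: indicator_def)
  ultimately show ?thesis using m by (simp add: L2_def)
qed

lemma L2_norm_vol:
  fixes f :: "'a::euclidean_space \<Rightarrow> complex"
  assumes "open \<Omega>" "\<And>p. p \<notin> \<Omega> \<Longrightarrow> f p = 0"
  shows "L2_norm (vol \<Omega>) f = L2_norm lborel f"
proof -
  have "(\<lambda>p. indicator \<Omega> p *\<^sub>R (cmod (f p))\<^sup>2) = (\<lambda>p. (cmod (f p))\<^sup>2)"
    by (auto simp: fun_eq_iff indicator_def assms(2))
  then show ?thesis using assms(1) by (simp add: L2_norm_def integral_restrict_space)
qed

lemma L2_norm_vol_le:
  fixes f :: "'a::euclidean_space \<Rightarrow> complex"
  assumes "open \<Omega>" "f \<in> L2 lborel"
  shows "L2_norm (vol \<Omega>) f \<le> L2_norm lborel f"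
proof -
  note [measurable] = L2_D(1)[OF assms(2)]
  have "(LINT p|lborel. indicator \<Omega> p *\<^sub>R (cmod (f p))\<^sup>2) \<le> (LINT p|lborel. (cmod (f p))\<^sup>2)"
    by (rule integral_mono')
      (use L2_D(2)[OF assms(2)] in \<open>auto simp: indicator_def\<close>)
  then show ?thesis using assms(1) by (simp add: L2_norm_def integral_restrict_space)
qed

lemma L2_inner_vol:
  fixes f :: "'a::euclidean_space \<Rightarrow> complex"
  assumes "open \<Omega>" "\<And>p. p \<notin> \<Omega> \<Longrightarrow> g p = 0"
  shows "L2_inner (vol \<Omega>) f g = L2_inner lborel f g"
proof -
  have "(\<lambda>p. indicator \<Omega> p *\<^sub>R (f p * cnj (g p))) = (\<lambda>p. f p * cnj (g p))"
    by (auto simp: fun_eq_iff indicator_def assms(2))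
  then show ?thesis using assms(1) by (simp add: L2_inner_def integral_restrict_space)
qed

section \<open>Integration by parts and the Dirichlet form\<close>

lemma dir_deriv_test_add:
  assumes "\<phi> \<in> test_functions \<Omega>" "\<psi> \<in> test_functions \<Omega>"
  shows "dir_deriv b (\<lambda>p. \<phi> p + \<psi> p) = (\<lambda>p. dir_deriv b \<phi> p + dir_deriv b \<psi> p)"
  by (rule ext, rule dir_derivI) (intro has_derivative_add test_has_derivative[OF assms(1)] test_has_derivative[OF assms(2)])

lemma dir_deriv_test_diff:
  assumes "\<phi> \<in> test_functions \<Omega>" "\<psi> \<in> test_functions \<Omega>"
  shows "dir_deriv b (\<lambda>p. \<phi> p - \<psi> p) = (\<lambda>p. dir_deriv b \<phi> p - dir_deriv b \<psi> p)"
  by (rule ext, rule dir_derivI) (intro has_derivative_diff test_has_derivative[OF assms(1)] test_has_derivative[OF assms(2)])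

lemma dir_deriv_test_scale:
  assumes "\<phi> \<in> test_functions \<Omega>"
  shows "dir_deriv b (\<lambda>p. c * \<phi> p) = (\<lambda>p. c * dir_deriv b \<phi> p)"
  by (rule ext, rule dir_derivI) (intro has_derivative_mult_right test_has_derivative[OF assms(1)])

lemma dir_deriv_test_translate:
  "\<phi> \<in> test_functions \<Omega> \<Longrightarrow> dir_deriv b (\<lambda>p. \<phi> (p - c)) = (\<lambda>p. dir_deriv b \<phi> (p - c))"
  by (rule dir_deriv_translate[OF test_differentiable])

lemma L2_inner_by_parts:
  assumes \<phi>: "\<phi> \<in> test_functions \<Omega>" and \<psi>: "\<psi> \<in> test_functions \<Omega>'" and b: "b \<in> Basis"
  shows "L2_inner lborel (dir_deriv b \<phi>) \<psi> = - L2_inner lborel \<phi> (dir_deriv b \<psi>)"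
proof -
  let ?h = "\<lambda>p v. \<phi> p * cnj (dir_deriv v \<psi> p) + dir_deriv v \<phi> p * cnj (\<psi> p)"
  note L = test_L2[OF \<phi>] test_L2[OF \<psi>] test_L2[OF test_dir_deriv[OF \<phi> b]] test_L2[OF test_dir_deriv[OF \<psi> b]]
  have "(LINT p|lborel. ?h p b) = 0"
  proof (rule integral_directional_derivative[where h="\<lambda>p. \<phi> p * cnj (\<psi> p)" and h'="?h", OF _ _ test_compact[OF \<phi>]])
    show "((\<lambda>p. \<phi> p * cnj (\<psi> p)) has_derivative ?h p) (at p)" for p
      by (intro has_derivative_mult bounded_linear.has_derivative[OF bounded_linear_cnj]
          test_has_derivative[OF \<phi>] test_has_derivative[OF \<psi>])
    show "continuous_on UNIV (\<lambda>p. ?h p b)"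
      by (intro continuous_intros test_continuous[OF \<phi>] test_continuous[OF \<psi>]
          test_continuous[OF test_dir_deriv[OF \<phi> b]] test_continuous[OF test_dir_deriv[OF \<psi> b]])
    show "\<phi> p * cnj (\<psi> p) = 0" if "p \<notin> closure {p. \<phi> p \<noteq> 0}" for p
      using outside_closure_support[OF that] by simp
  qed
  then show ?thesis
    using integrable_L2_mult[OF L(1,4)] integrable_L2_mult[OF L(3,2)]
    by (simp add: L2_inner_def add_eq_0_iff)
qed

text \<open>Test functions vanish off \<open>\<Omega>\<close>, so the form can be computed on the
  whole space, where translations are isometries.\<close>

lemma L2_inner_laplacian:
  assumes \<phi>: "\<phi> \<in> test_functions \<Omega>" and \<psi>: "\<psi> \<in> test_functions \<Omega>" and "open \<Omega>"
  shows "L2_inner (vol \<Omega>) (\<lambda>p. - laplacian \<phi> p) \<psi>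
    = (\<Sum>b\<in>Basis. L2_inner lborel (dir_deriv b \<phi>) (dir_deriv b \<psi>))"
proof -
  have "L2_inner (vol \<Omega>) (\<lambda>p. - laplacian \<phi> p) \<psi> = L2_inner lborel (\<lambda>p. - laplacian \<phi> p) \<psi>"
    by (rule L2_inner_vol[OF assms(3) test_outside[OF \<psi>]])
  also have "\<dots> = (LINT p|lborel. (\<Sum>b\<in>Basis. - (dir_deriv b (dir_deriv b \<phi>) p * cnj (\<psi> p))))"
    by (simp add: L2_inner_def laplacian_def sum_distrib_right sum_negf)
  also have "\<dots> = (\<Sum>b\<in>Basis. (LINT p|lborel. - (dir_deriv b (dir_deriv b \<phi>) p * cnj (\<psi> p))))"
    by (rule Bochner_Integration.integral_sum)
      (intro Bochner_Integration.integrable_minus integrable_L2_mult test_L2[OF \<psi>] test_L2[OF test_dir_deriv[OF test_dir_deriv[OF \<phi>]]])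
  also have "\<dots> = (\<Sum>b\<in>Basis. - L2_inner lborel (dir_deriv b (dir_deriv b \<phi>)) \<psi>)"
    by (simp add: L2_inner_def)
  also have "\<dots> = (\<Sum>b\<in>Basis. L2_inner lborel (dir_deriv b \<phi>) (dir_deriv b \<psi>))"
    by (rule sum.cong) (simp_all add: L2_inner_by_parts[OF test_dir_deriv[OF \<phi>] \<psi>])
  finally show ?thesis .
qed

lemma laplacian_add:
  assumes "\<phi> \<in> test_functions \<Omega>" "\<psi> \<in> test_functions \<Omega>"
  shows "laplacian (\<lambda>p. \<phi> p + \<psi> p) = (\<lambda>p. laplacian \<phi> p + laplacian \<psi> p)"
  unfolding laplacian_def
  by (simp add: dir_deriv_test_add[OF assms] sum.distrib
      dir_deriv_test_add[OF test_dir_deriv[OF assms(1)] test_dir_deriv[OF assms(2)]])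

lemma laplacian_scale:
  assumes "\<phi> \<in> test_functions \<Omega>"
  shows "laplacian (\<lambda>p. c * \<phi> p) = (\<lambda>p. c * laplacian \<phi> p)"
  unfolding laplacian_def
  by (simp add: dir_deriv_test_scale[OF assms] sum_distrib_left
      dir_deriv_test_scale[OF test_dir_deriv[OF assms]])

lemma test_laplacian:
  assumes "\<phi> \<in> test_functions \<Omega>"
  shows "(\<lambda>p. - laplacian \<phi> p) \<in> L2 lborel"
proof -
  have "(\<lambda>p. \<Sum>b\<in>B. dir_deriv b (dir_deriv b \<phi>) p) \<in> L2 lborel" if "finite B" "B \<subseteq> Basis" for B
    using that
  proof (induction B)
    case (insert b B)
    then have "dir_deriv b (dir_deriv b \<phi>) \<in> L2 lborel"
      by (intro test_L2[OF test_dir_deriv[OF test_dir_deriv[OF assms]]]) auto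
    then show ?case using insert by (simp add: L2_add)
  qed simp
  from L2_scale[OF this[of Basis], of "-1"] show ?thesis by (simp add: laplacian_def)
qed

lemma nonneg_form_laplacian:
  assumes "open \<Omega>"
  shows "nonneg_form (vol \<Omega>) (test_functions \<Omega>) (\<lambda>\<phi> p. - laplacian \<phi> p)"
proof
  fix \<phi> \<psi> :: "'a \<Rightarrow> complex" assume \<phi>: "\<phi> \<in> test_functions \<Omega>"
  show "\<phi> \<in> L2 (vol \<Omega>)" by (rule L2_vol[OF assms test_L2[OF \<phi>]])
  show "(\<lambda>p. - laplacian \<phi> p) \<in> L2 (vol \<Omega>)" by (rule L2_vol[OF assms test_laplacian[OF \<phi>]])
  show "(\<lambda>x. c * \<phi> x) \<in> test_functions \<Omega>" for c by (rule test_scale[OF \<phi>])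
  show "(\<lambda>p. - laplacian (\<lambda>x. c * \<phi> x) p) = (\<lambda>x. c * - laplacian \<phi> x)" for c
    by (simp add: laplacian_scale[OF \<phi>])
  show "0 \<le> Re (L2_inner (vol \<Omega>) (\<lambda>p. - laplacian \<phi> p) \<phi>)"
    by (simp add: L2_inner_laplacian[OF \<phi> \<phi> assms] L2_inner_self sum_nonneg)
  assume \<psi>: "\<psi> \<in> test_functions \<Omega>"
  show "(\<lambda>x. \<phi> x + \<psi> x) \<in> test_functions \<Omega>" by (rule test_add[OF \<phi> \<psi>])
  show "(\<lambda>p. - laplacian (\<lambda>x. \<phi> x + \<psi> x) p) = (\<lambda>x. - laplacian \<phi> x + - laplacian \<psi> x)"
    by (simp add: laplacian_add[OF \<phi> \<psi>])
  show "L2_inner (vol \<Omega>) (\<lambda>p. - laplacian \<phi> p) \<psi> = cnj (L2_inner (vol \<Omega>) (\<lambda>p. - laplacian \<psi> p) \<phi>)"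
    by (simp add: L2_inner_laplacian[OF \<phi> \<psi> assms] L2_inner_laplacian[OF \<psi> \<phi> assms] L2_inner_cnj)
qed (rule test_zero)

section \<open>The multiplier identity\<close>

lemma fst_Basis_cases:
  assumes "b \<in> (Basis :: (real \<times> 'b::euclidean_space) set)"
  shows "b = (1, 0) \<or> fst b = 0"
  using assms by (auto simp: Basis_prod_def)

lemma e1_Basis: "(1, 0) \<in> (Basis :: (real \<times> 'b::euclidean_space) set)"
  by (auto simp: Basis_prod_def)

text \<open>Only the basis vector \<open>(1, 0)\<close> has a nonzero first coordinate. Terms that
  occur only in the x-direction can thus be carried along for every \<open>b\<close> with a factor
  \<open>fst b\<close>.\<close>

lemma sum_Basis_fst:
  fixes f :: "real \<times> 'b::euclidean_space \<Rightarrow> real"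
  shows "(\<Sum>b\<in>Basis. fst b * f b) = f (1, 0)"
proof -
  have "(\<Sum>b\<in>Basis. fst b * f b) = (\<Sum>b\<in>Basis. if b = (1, 0) then f b else 0)"
    by (rule sum.cong[OF refl]) (use fst_Basis_cases in auto)
  then show ?thesis by (simp add: e1_Basis)
qed

definition mult_wt :: "real \<Rightarrow> (real \<times> 'b \<Rightarrow> complex) \<Rightarrow> real \<times> 'b \<Rightarrow> complex" where
  "mult_wt a \<phi> = (\<lambda>p. of_real (wt a p) * \<phi> p)"

definition bdq :: "real \<Rightarrow> (real \<times> 'b::euclidean_space \<Rightarrow> complex) \<Rightarrow> real \<times> 'b \<Rightarrow> complex" where
  "bdq h \<phi> = (\<lambda>p. of_real (1 / h) * (\<phi> p - \<phi> (p - (h, 0))))"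

abbreviation dx :: "(real \<times> 'b::euclidean_space \<Rightarrow> complex) \<Rightarrow> real \<times> 'b \<Rightarrow> complex" where
  "dx \<equiv> dir_deriv (1, 0)"

text \<open>A discrete version of the multiplier \<open>2 w \<partial>\<^sub>x \<phi> + w' \<phi>\<close> with
  \<open>w = 1 - (1 + x) powr (- \<delta>)\<close>. The backward difference quotient, unlike \<open>\<partial>\<^sub>x \<phi>\<close>, stays in the
  form domain, because \<open>\<Omega>\<close> is invariant under forward translations.\<close>

definition multiplier :: "real \<Rightarrow> real \<Rightarrow> (real \<times> 'b::euclidean_space \<Rightarrow> complex) \<Rightarrow> real \<times> 'b \<Rightarrow> complex" where
  "multiplier \<delta> h \<phi> = (\<lambda>p. 2 * (bdq h \<phi> p - mult_wt (- \<delta>) (bdq h \<phi>) p) + of_real \<delta> * mult_wt (- 1 - \<delta>) \<phi> p)"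

text \<open>Concavity of \<open>w = 1 - (1 + x) powr (- \<delta>)\<close>: by the mean value theorem
  an increment of \<open>w\<close> is \<open>h\<close> times an intermediate slope, and the slope is
  largest at the left end.\<close>

lemma wt_difference_le:
  fixes p :: "real \<times> 'b"
  assumes "0 < \<delta>" "fst p > 0" "h > 0"
  shows "(1 + fst p) powr (- \<delta>) - (1 + (fst p + h)) powr (- \<delta>) \<le> h * (\<delta> * wt (- 1 - \<delta>) p)"
proof -
  let ?f = "\<lambda>x::real. - (x powr (- \<delta>))"
  have "\<exists>y>1 + fst p. y < 1 + (fst p + h) \<and>
      ?f (1 + (fst p + h)) - ?f (1 + fst p) = (1 + (fst p + h) - (1 + fst p)) * (\<delta> * y powr (- 1 - \<delta>))"
  proof (rule MVT2)
    fix x assume "1 + fst p \<le> x" "x \<le> 1 + (fst p + h)"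
    then have "x > 0" using assms by simp
    then have "DERIV ?f x :> \<delta> * x powr (- \<delta> - 1)"
      by (auto intro!: derivative_eq_intros)
    moreover have "- \<delta> - 1 = - 1 - \<delta>" by simp
    ultimately show "DERIV ?f x :> \<delta> * x powr (- 1 - \<delta>)" by (simp only:)
  qed (use assms in simp)
  then obtain y where y: "y > 1 + fst p"
    "?f (1 + (fst p + h)) - ?f (1 + fst p) = h * (\<delta> * y powr (- 1 - \<delta>))" by auto
  have "y powr (- 1 - \<delta>) \<le> (1 + fst p) powr (- 1 - \<delta>)"
    by (rule powr_mono2') (use assms y in auto)
  then have "h * (\<delta> * y powr (- 1 - \<delta>)) \<le> h * (\<delta> * wt (- 1 - \<delta>) p)"
    using assms by (simp add: wt_def)
  then show ?thesis using y(2) by simp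
qed

text \<open>All that the analytic estimate retains of the geometry; the boundary hypotheses are
  reduced to this by \<open>forward_invariant_domain_if_normals\<close>.\<close>

locale forward_invariant_domain =
  fixes \<Omega> :: "(real \<times> 'b::euclidean_space) set"
  assumes op: "open \<Omega>"
    and pos: "p \<in> \<Omega> \<Longrightarrow> fst p > 0"
    and forward: "p \<in> \<Omega> \<Longrightarrow> t \<ge> 0 \<Longrightarrow> p + (t, 0) \<in> \<Omega>"
begin

sublocale nonneg_form "vol \<Omega>" "test_functions \<Omega>" "\<lambda>\<phi> p. - laplacian \<phi> p"
  by (rule nonneg_form_laplacian[OF op])

abbreviation T where "T \<equiv> test_functions \<Omega>"
abbreviation ip where "ip \<equiv> L2_inner (lborel :: (real \<times> 'b) measure)"
abbreviation nrm where "nrm \<equiv> L2_norm (lborel :: (real \<times> 'b) measure)"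

lemma T_mult_wt: "\<phi> \<in> T \<Longrightarrow> mult_wt a \<phi> \<in> T"
  unfolding mult_wt_def by (rule test_wt[OF _ pos])

lemma T_shift: "\<phi> \<in> T \<Longrightarrow> h \<ge> 0 \<Longrightarrow> (\<lambda>p. \<phi> (p - (h, 0))) \<in> T"
  by (rule test_translate) (auto intro: forward)

lemma T_bdq: "\<phi> \<in> T \<Longrightarrow> h \<ge> 0 \<Longrightarrow> bdq h \<phi> \<in> T"
  unfolding bdq_def by (intro test_scale test_diff T_shift)

lemma T_multiplier: "\<phi> \<in> T \<Longrightarrow> h \<ge> 0 \<Longrightarrow> multiplier \<delta> h \<phi> \<in> T"
  unfolding multiplier_def by (intro test_scale test_diff test_add T_mult_wt T_bdq)

lemma T_dx: "\<phi> \<in> T \<Longrightarrow> dx \<phi> \<in> T"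
  by (rule test_dir_deriv[OF _ e1_Basis])

lemma q_eq: "\<phi> \<in> T \<Longrightarrow> \<psi> \<in> T \<Longrightarrow> q \<phi> \<psi> = (\<Sum>b\<in>Basis. ip (dir_deriv b \<phi>) (dir_deriv b \<psi>))"
  by (rule L2_inner_laplacian[OF _ _ op])

lemma Q_eq: "\<phi> \<in> T \<Longrightarrow> Q \<phi> = (\<Sum>b\<in>Basis. (nrm (dir_deriv b \<phi>))\<^sup>2)"
  by (simp add: q_eq L2_inner_self)

lemma dx_le_Q: "\<phi> \<in> T \<Longrightarrow> (nrm (dx \<phi>))\<^sup>2 \<le> Q \<phi>"
  unfolding Q_eq by (rule member_le_sum[OF e1_Basis]) auto

lemma norm_vol_T: "\<phi> \<in> T \<Longrightarrow> L2_norm (vol \<Omega>) \<phi> = nrm \<phi>"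
  by (rule L2_norm_vol[OF op test_outside])

section \<open>Weighted norms and integration by parts in x\<close>

lemma mult_wt_le:
  assumes "\<And>p. p \<notin> \<Omega> \<Longrightarrow> f p = 0" "a \<le> b"
  shows "cmod (mult_wt a f p) \<le> cmod (mult_wt b f p)"
proof (cases "p \<in> \<Omega>")
  case True
  have "wt a p \<le> wt b p" unfolding wt_def using pos[OF True] assms(2) by (intro powr_mono) auto
  then show ?thesis by (simp add: mult_wt_def norm_mult mult_right_mono)
qed (use assms in \<open>simp add: mult_wt_def\<close>)

lemma mult_wt_0: "(\<And>p. p \<notin> \<Omega> \<Longrightarrow> f p = 0) \<Longrightarrow> mult_wt 0 f = f"
  using pos by (force simp: mult_wt_def wt_def)

lemma mult_wt_measurable:
  assumes [measurable]: "f \<in> borel_measurable lborel"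
  shows "mult_wt a f \<in> borel_measurable lborel"
  unfolding mult_wt_def by measurable

lemma mult_wt_L2:
  assumes "\<And>p. p \<notin> \<Omega> \<Longrightarrow> f p = 0" "a \<le> 0" "f \<in> L2 lborel"
  shows "mult_wt a f \<in> L2 lborel" "nrm (mult_wt a f) \<le> nrm f"
proof -
  have le: "cmod (mult_wt a f p) \<le> 1 * cmod (f p)" for p
    using mult_wt_le[of f a 0 p] mult_wt_0[of f] assms by simp
  show "mult_wt a f \<in> L2 lborel"
    by (rule L2_dominated(1)[OF mult_wt_measurable[OF L2_D(1)[OF assms(3)]] assms(3) le])
  show "nrm (mult_wt a f) \<le> nrm f"
    using L2_dominated(2)[OF mult_wt_measurable[OF L2_D(1)[OF assms(3)]] assms(3) le] by simp
qed

lemma nrm_mult_wt_mono: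
  assumes "\<phi> \<in> T" "a \<le> b"
  shows "nrm (mult_wt a \<phi>) \<le> nrm (mult_wt b \<phi>)"
proof -
  have "nrm (mult_wt a \<phi>) \<le> 1 * nrm (mult_wt b \<phi>)"
    by (rule L2_dominated(2)[OF L2_D(1)[OF test_L2[OF T_mult_wt[OF assms(1)]]] test_L2[OF T_mult_wt[OF assms(1)]]])
      (use mult_wt_le[of \<phi>, OF test_outside[OF assms(1)] assms(2)] in auto)
  then show ?thesis by simp
qed

lemma nrm_mult_wt_le: "\<phi> \<in> T \<Longrightarrow> a \<le> 0 \<Longrightarrow> nrm (mult_wt a \<phi>) \<le> nrm \<phi>"
  by (rule mult_wt_L2(2)) (auto intro: test_outside test_L2)

lemma ip_mult_wt:
  assumes "\<phi> \<in> T"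
  shows "ip (mult_wt a \<phi>) (mult_wt b \<psi>) = ip \<phi> (mult_wt (a + b) \<psi>)"
proof -
  have "mult_wt a \<phi> p * cnj (mult_wt b \<psi> p) = \<phi> p * cnj (mult_wt (a + b) \<psi> p)" for p
  proof (cases "p \<in> \<Omega>")
    case True
    then show ?thesis using pos[OF True] by (simp add: mult_wt_def wt_add)
  qed (simp add: mult_wt_def test_outside[OF assms])
  then show ?thesis by (simp add: L2_inner_def)
qed

lemma ip_mult_wt_left: "ip (mult_wt a \<phi>) \<psi> = ip \<phi> (mult_wt a \<psi>)"
  by (simp add: L2_inner_def mult_wt_def mult_ac)

lemma nrm_mult_wt_sq: "\<phi> \<in> T \<Longrightarrow> c = a + a \<Longrightarrow> Re (ip \<phi> (mult_wt c \<phi>)) = (nrm (mult_wt a \<phi>))\<^sup>2"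
  by (simp only: ip_mult_wt[symmetric] L2_inner_self Re_complex_of_real)

text \<open>The weight depends on x alone, hence the factor \<open>fst b\<close>. Off
  \<open>\<Omega>\<close> all terms vanish, so the product rule holds at every point.\<close>

lemma dir_deriv_mult_wt:
  assumes \<phi>: "\<phi> \<in> T" and b: "b \<in> Basis"
  shows "dir_deriv b (mult_wt a \<phi>) p = mult_wt a (dir_deriv b \<phi>) p + of_real (fst b * a) * mult_wt (a - 1) \<phi> p"
proof (cases "p \<in> \<Omega>")
  case True
  then have "fst p > -1" using pos[of p] by simp
  from has_derivative_mult[OF has_derivative_of_real[OF wt_has_derivative[OF this, of a]] test_has_derivative[OF \<phi>]]
  have "((\<lambda>p. of_real (wt a p) * \<phi> p) has_derivative
      (\<lambda>v. of_real (wt a p) * dir_deriv v \<phi> p + of_real (a * wt (a - 1) p * fst v) * \<phi> p)) (at p)" .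
  from dir_derivI[OF this, of b] show ?thesis by (simp add: mult_wt_def mult_ac)
next
  case False
  then show ?thesis
    using test_outside[OF test_dir_deriv[OF T_mult_wt[OF \<phi>] b]] test_outside[OF test_dir_deriv[OF \<phi> b]] test_outside[OF \<phi>]
    by (simp add: mult_wt_def)
qed

lemma dir_deriv_bdq:
  assumes \<phi>: "\<phi> \<in> T" and h: "h \<ge> 0"
  shows "dir_deriv b (bdq h \<phi>) = bdq h (dir_deriv b \<phi>)"
  unfolding bdq_def dir_deriv_test_scale[OF test_diff[OF \<phi> T_shift[OF \<phi> h]]]
    dir_deriv_test_diff[OF \<phi> T_shift[OF \<phi> h]] dir_deriv_test_translate[OF \<phi>] ..

text \<open>The x-derivative of \<open>(1+x)^a |\<phi>|^2\<close> has integral zero. The exponents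
  \<open>0\<close>, \<open>- \<delta>\<close> and \<open>- 2 - \<delta>\<close> are used
  later.\<close>

lemma ip_dx_mult_wt:
  assumes \<phi>: "\<phi> \<in> T"
  shows "2 * Re (ip \<phi> (mult_wt a (dx \<phi>))) = - a * Re (ip \<phi> (mult_wt (a - 1) \<phi>))"
proof -
  have "ip (dx (mult_wt a \<phi>)) \<phi> = - ip (mult_wt a \<phi>) (dx \<phi>)"
    by (rule L2_inner_by_parts[OF T_mult_wt[OF \<phi>] \<phi> e1_Basis])
  moreover have "dx (mult_wt a \<phi>) = (\<lambda>p. mult_wt a (dx \<phi>) p + of_real a * mult_wt (a - 1) \<phi> p)"
    by (rule ext) (simp add: dir_deriv_mult_wt[OF \<phi> e1_Basis])
  moreover have "ip (\<lambda>p. mult_wt a (dx \<phi>) p + of_real a * mult_wt (a - 1) \<phi> p) \<phi>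
      = ip (mult_wt a (dx \<phi>)) \<phi> + of_real a * ip (mult_wt (a - 1) \<phi>) \<phi>"
    by (simp add: L2_inner_add_left L2_inner_scale_left L2_scale test_L2[OF T_mult_wt] T_dx \<phi> test_L2[OF \<phi>]
        test_L2[OF T_mult_wt[OF T_dx[OF \<phi>]]] test_L2[OF T_mult_wt[OF \<phi>]])
  moreover have "ip (mult_wt a (dx \<phi>)) \<phi> = cnj (ip \<phi> (mult_wt a (dx \<phi>)))" by (simp add: L2_inner_cnj)
  ultimately have "cnj (ip \<phi> (mult_wt a (dx \<phi>))) + of_real a * ip \<phi> (mult_wt (a - 1) \<phi>) = - ip \<phi> (mult_wt a (dx \<phi>))"
    by (simp add: ip_mult_wt_left)
  from arg_cong[OF this, of Re] show ?thesis by simp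
qed

text \<open>With the true derivative the integrand would be the x-derivative of
  \<open>w |\<phi>|^2\<close>, and the real part would be zero. For the backward quotient, the
  remainder \<open>w |\<phi> - ?s|^2\<close> is nonnegative and concavity of \<open>w\<close>
  controls the shift of the weight. \<open>q_multiplier_ge\<close> applies this to every partial
  derivative of \<open>\<phi>\<close>.\<close>

lemma ip_multiplier_nonneg:
  assumes \<phi>: "\<phi> \<in> T" and h: "h > 0" and \<delta>: "0 < \<delta>"
  shows "0 \<le> Re (ip \<phi> (multiplier \<delta> h \<phi>))"
proof -
  let ?s = "\<lambda>p. \<phi> (p - (h, 0))"
  define w where "w = (\<lambda>p :: real \<times> 'b. 1 - wt (- \<delta>) p)"
  define W where "W = (\<lambda>p :: real \<times> 'b. wt (- 1 - \<delta>) p)"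
  have s: "?s \<in> T" by (rule T_shift) (use \<phi> h in auto)
  have [measurable]: "\<phi> \<in> borel_measurable borel" "?s \<in> borel_measurable borel"
    by (rule test_measurable[OF \<phi>], rule test_measurable[OF s])
  have [measurable]: "w \<in> borel_measurable borel" "W \<in> borel_measurable borel"
    unfolding w_def W_def by measurable
  have [measurable]: "(\<lambda>p. w (p + (h, 0))) \<in> borel_measurable borel"
    by (rule measurable_compose[OF borel_measurable_continuous_onI]) (auto intro!: continuous_intros)
  have w: "0 \<le> w p" "w p \<le> 1" if "fst p \<ge> 0" for p
    using wt_le_1[of "- \<delta>" p] \<delta> that by (auto simp: w_def)
  have W: "W p \<le> 1" if "p \<in> \<Omega>" for p
    using wt_le_1[of "- 1 - \<delta>" p] \<delta> pos[OF that] by (simp add: W_def)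
  have W0: "0 \<le> W p" for p by (simp add: W_def)
  note L = test_L2[OF \<phi>] test_L2[OF s] test_L2[OF T_mult_wt[OF \<phi>]] test_L2[OF T_bdq[OF \<phi> less_imp_le[OF h]]]
    test_L2[OF T_mult_wt[OF T_bdq[OF \<phi> less_imp_le[OF h]]]]
  have i\<phi>: "integrable lborel (\<lambda>p. (cmod (\<phi> p))\<^sup>2)" and i\<phi>s: "integrable lborel (\<lambda>p. (cmod (?s p))\<^sup>2)"
    using L2_D(2)[OF L(1)] L2_D(2)[OF L(2)] by auto
  have i1: "integrable lborel (\<lambda>p. w p * (cmod (\<phi> p))\<^sup>2)"
  proof (rule Bochner_Integration.integrable_bound[OF i\<phi>])
    have "\<bar>w p * (cmod (\<phi> p))\<^sup>2\<bar> \<le> (cmod (\<phi> p))\<^sup>2" for p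
      using w[of p] pos[of p] test_outside[OF \<phi>, of p] by (cases "p \<in> \<Omega>") (auto simp: abs_mult mult_left_le_one_le)
    then show "AE p in lborel. norm (w p * (cmod (\<phi> p))\<^sup>2) \<le> norm ((cmod (\<phi> p))\<^sup>2)" by simp
  qed simp
  have i2: "integrable lborel (\<lambda>p. w (p + (h, 0)) * (cmod (\<phi> p))\<^sup>2)"
  proof (rule Bochner_Integration.integrable_bound[OF i\<phi>])
    have "\<bar>w (p + (h, 0)) * (cmod (\<phi> p))\<^sup>2\<bar> \<le> (cmod (\<phi> p))\<^sup>2" for p
      using w[of "p + (h, 0)"] pos[of p] h test_outside[OF \<phi>, of p] by (cases "p \<in> \<Omega>") (auto simp: abs_mult mult_left_le_one_le)
    then show "AE p in lborel. norm (w (p + (h, 0)) * (cmod (\<phi> p))\<^sup>2) \<le> norm ((cmod (\<phi> p))\<^sup>2)" by simp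
  qed simp
  have i3: "integrable lborel (\<lambda>p. W p * (cmod (\<phi> p))\<^sup>2)"
  proof (rule Bochner_Integration.integrable_bound[OF i\<phi>])
    have "\<bar>W p * (cmod (\<phi> p))\<^sup>2\<bar> \<le> (cmod (\<phi> p))\<^sup>2" for p
      using W[of p] W0[of p] test_outside[OF \<phi>, of p] by (cases "p \<in> \<Omega>") (auto simp: abs_mult mult_left_le_one_le)
    then show "AE p in lborel. norm (W p * (cmod (\<phi> p))\<^sup>2) \<le> norm ((cmod (\<phi> p))\<^sup>2)" by simp
  qed simp
  \<comment> \<open>Summation by parts: the translation moves from the function to the
    weight.\<close>
  have i4: "integrable lborel (\<lambda>p. w p * (cmod (?s p))\<^sup>2)"
    and shift: "(LINT p|lborel. w p * (cmod (?s p))\<^sup>2) = (LINT p|lborel. w (p + (h, 0)) * (cmod (\<phi> p))\<^sup>2)"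
    using integrable_lborel_translate[OF i2, of "(h, 0)"]
      integral_lborel_translate[of "\<lambda>p. w (p + (h, 0)) * (cmod (\<phi> p))\<^sup>2" "(h, 0)"] by auto
  have pt: "w p * (cmod (\<phi> p))\<^sup>2 - w p * (cmod (?s p))\<^sup>2 + h * \<delta> * (W p * (cmod (\<phi> p))\<^sup>2)
      \<le> h * Re (\<phi> p * cnj (multiplier \<delta> h \<phi> p))" for p
  proof -
    have eq: "h * Re (\<phi> p * cnj (multiplier \<delta> h \<phi> p))
        = w p * (2 * Re (\<phi> p * cnj (\<phi> p - ?s p))) + h * \<delta> * (W p * (cmod (\<phi> p))\<^sup>2)"
      using h unfolding multiplier_def mult_wt_def bdq_def w_def W_def cmod_power2
      by (simp add: field_simps power2_eq_square)
    \<comment> \<open>Polarization; discarding the last square, multiplied by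
      \<open>w \<ge> 0\<close>, is the convexity step.\<close>
    have sq: "2 * Re (\<phi> p * cnj (\<phi> p - ?s p)) = (cmod (\<phi> p))\<^sup>2 - (cmod (?s p))\<^sup>2 + (cmod (\<phi> p - ?s p))\<^sup>2"
      unfolding cmod_power2 by (simp add: power2_eq_square algebra_simps)
    show ?thesis
    proof (cases "p \<in> \<Omega>")
      case True
      have "0 \<le> w p * (cmod (\<phi> p - ?s p))\<^sup>2" using w(1)[of p] pos[OF True] by simp
      then show ?thesis unfolding eq sq by (simp add: algebra_simps)
    next
      case False
      then show ?thesis unfolding eq using test_outside[OF \<phi> False] test_outside[OF s False] by simp
    qed
  qed
  have conc: "(w (p + (h, 0)) - w p) * (cmod (\<phi> p))\<^sup>2 \<le> h * \<delta> * (W p * (cmod (\<phi> p))\<^sup>2)" for p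
  proof (cases "p \<in> \<Omega>")
    case True
    have "w (p + (h, 0)) - w p \<le> h * (\<delta> * W p)"
      using wt_difference_le[OF \<delta> pos[OF True] h] by (simp add: w_def W_def wt_def)
    from mult_right_mono[OF this, of "(cmod (\<phi> p))\<^sup>2"] show ?thesis by (simp add: mult_ac)
  qed (simp add: test_outside[OF \<phi>])
  have "(LINT p|lborel. w (p + (h, 0)) * (cmod (\<phi> p))\<^sup>2) - (LINT p|lborel. w p * (cmod (\<phi> p))\<^sup>2)
      = (LINT p|lborel. (w (p + (h, 0)) - w p) * (cmod (\<phi> p))\<^sup>2)"
    using i1 i2 by (simp add: left_diff_distrib)
  also have "\<dots> \<le> (LINT p|lborel. h * \<delta> * (W p * (cmod (\<phi> p))\<^sup>2))"
    by (rule integral_mono) (use i1 i2 i3 conc in \<open>auto simp: left_diff_distrib\<close>)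
  finally have "0 \<le> (LINT p|lborel. w p * (cmod (\<phi> p))\<^sup>2) - (LINT p|lborel. w (p + (h, 0)) * (cmod (\<phi> p))\<^sup>2)
      + (LINT p|lborel. h * \<delta> * (W p * (cmod (\<phi> p))\<^sup>2))" by simp
  also have "\<dots> = (LINT p|lborel. w p * (cmod (\<phi> p))\<^sup>2 - w p * (cmod (?s p))\<^sup>2 + h * \<delta> * (W p * (cmod (\<phi> p))\<^sup>2))"
    using i1 i3 i4 shift by simp
  also have "\<dots> \<le> (LINT p|lborel. h * Re (\<phi> p * cnj (multiplier \<delta> h \<phi> p)))"
    by (rule integral_mono)
      (use i1 i3 i4 pt integrable_Re[OF integrable_L2_mult[OF L(1) test_L2[OF T_multiplier[OF \<phi> less_imp_le[OF h]]]]] in auto)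
  also have "\<dots> = h * Re (ip \<phi> (multiplier \<delta> h \<phi>))"
    using integral_Re[OF integrable_L2_mult[OF L(1) test_L2[OF T_multiplier[OF \<phi> less_imp_le[OF h]]]]]
    by (simp add: L2_inner_def)
  finally show ?thesis using h by (simp add: zero_le_mult_iff)
qed

text \<open>The exponent is chosen so that integration by parts produces the weight
  \<open>(1+x)^(-3-\<delta>)\<close>, the square of the one in the theorem.\<close>

lemma hardy_identity:
  assumes \<phi>: "\<phi> \<in> T"
  shows "2 * Re (ip \<phi> (mult_wt (- 2 - \<delta>) (dx \<phi>))) = (2 + \<delta>) * (nrm (mult_wt (- (3 + \<delta>) / 2) \<phi>))\<^sup>2"
  using ip_dx_mult_wt[OF \<phi>, of "- 2 - \<delta>"] nrm_mult_wt_sq[OF \<phi>, of "- 2 - \<delta> - 1" "- (3 + \<delta>) / 2"]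
  by (simp add: add_divide_distrib[symmetric])

text \<open>Cauchy-Schwarz in \<open>hardy_identity\<close>, with the exponent split as
  \<open>- 2 - \<delta> = - (3 + \<delta>) / 2 - (1 + \<delta>) / 2\<close>; one factor of the
  weighted norm of \<open>\<phi>\<close> cancels.\<close>

lemma hardy:
  assumes \<phi>: "\<phi> \<in> T" and \<delta>: "0 < \<delta>"
  shows "(1 + \<delta> / 2) * nrm (mult_wt (- (3 + \<delta>) / 2) \<phi>) \<le> nrm (mult_wt (- (1 + \<delta>) / 2) (dx \<phi>))"
proof -
  let ?N = "nrm (mult_wt (- (3 + \<delta>) / 2) \<phi>)" and ?X = "nrm (mult_wt (- (1 + \<delta>) / 2) (dx \<phi>))"
  have "(2 + \<delta>) * ?N\<^sup>2 = 2 * Re (ip \<phi> (mult_wt (- 2 - \<delta>) (dx \<phi>)))"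
    by (rule hardy_identity[OF \<phi>, symmetric])
  also have "ip \<phi> (mult_wt (- 2 - \<delta>) (dx \<phi>)) = ip (mult_wt (- (3 + \<delta>) / 2) \<phi>) (mult_wt (- (1 + \<delta>) / 2) (dx \<phi>))"
    unfolding ip_mult_wt[OF \<phi>] by (rule arg_cong[where f="\<lambda>c. ip \<phi> (mult_wt c (dx \<phi>))"]) (simp add: field_simps)
  also have "2 * Re \<dots> \<le> 2 * (?N * ?X)"
    using order_trans[OF complex_Re_le_cmod cmod_L2_inner_le[OF test_L2[OF T_mult_wt[OF \<phi>]] test_L2[OF T_mult_wt[OF T_dx[OF \<phi>]]]]]
    by simp
  finally have "(1 + \<delta> / 2) * ?N * ?N \<le> ?X * ?N" by (simp add: power2_eq_square algebra_simps)
  then show ?thesis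
    using \<delta> by (cases "?N = 0") (auto simp: mult_le_cancel_right less_le)
qed

text \<open>Differentiation commutes with the difference quotient, so the commutator comes from the
  weights alone: \<open>2 w'\<close> in front of the quotient and \<open>w''\<close> in front of
  \<open>\<phi>\<close>, both only in direction \<open>(1, 0)\<close>.\<close>

lemma dir_deriv_multiplier:
  assumes \<phi>: "\<phi> \<in> T" and h: "h \<ge> 0" and b: "b \<in> Basis"
  shows "dir_deriv b (multiplier \<delta> h \<phi>) = (\<lambda>p. multiplier \<delta> h (dir_deriv b \<phi>) p
    + of_real (fst b) * (of_real (2 * \<delta>) * mult_wt (- 1 - \<delta>) (bdq h \<phi>) p
        - of_real (\<delta> * (1 + \<delta>)) * mult_wt (- 2 - \<delta>) \<phi> p))"
proof -
  note D = T_bdq[OF \<phi> h]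
  note t = test_scale test_diff T_mult_wt D \<phi>
  have 1: "(\<lambda>p. bdq h \<phi> p - mult_wt (- \<delta>) (bdq h \<phi>) p) \<in> T"
    "(\<lambda>p. 2 * (bdq h \<phi> p - mult_wt (- \<delta>) (bdq h \<phi>) p)) \<in> T"
    "(\<lambda>p. of_real \<delta> * mult_wt (- 1 - \<delta>) \<phi> p) \<in> T" by (intro t)+
  have e1: "- \<delta> - 1 = - 1 - \<delta>" and e2: "- 1 - \<delta> - 1 = - 2 - \<delta>" by simp_all
  show ?thesis
    unfolding multiplier_def dir_deriv_test_add[OF 1(2,3)] dir_deriv_test_scale[OF 1(1)]
      dir_deriv_test_diff[OF D T_mult_wt[OF D]] dir_deriv_test_scale[OF T_mult_wt[OF \<phi>]]
      dir_deriv_bdq[OF \<phi> h, symmetric]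
    by (intro ext) (simp add: dir_deriv_mult_wt[OF D b, of "- \<delta>", unfolded e1]
        dir_deriv_mult_wt[OF \<phi> b, of "- 1 - \<delta>", unfolded e2] ring_distribs)
qed

text \<open>\<open>ip_multiplier_nonneg\<close> removes the principal terms of all partial
  derivatives. Of the commutator, \<open>2 w'\<close> gives the squared weighted norm of
  \<open>dx \<phi>\<close>, and \<open>w''\<close> gives \<open>(1/2) w'''\<close> against
  \<open>|\<phi>|^2\<close> by \<open>hardy_identity\<close>. The last term on the left pays for
  replacing the quotient by the derivative.\<close>

lemma q_multiplier_ge:
  assumes \<phi>: "\<phi> \<in> T" and h: "h > 0" and \<delta>: "0 < \<delta>"
  shows "2 * \<delta> * (nrm (mult_wt (- (1 + \<delta>) / 2) (dx \<phi>)))\<^sup>2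
      - \<delta> * (1 + \<delta>) * (1 + \<delta> / 2) * (nrm (mult_wt (- (3 + \<delta>) / 2) \<phi>))\<^sup>2
      - 2 * \<delta> * nrm (dx \<phi>) * nrm (\<lambda>p. bdq h \<phi> p - dx \<phi> p)
    \<le> Re (q \<phi> (multiplier \<delta> h \<phi>))"
proof -
  have h0: "h \<ge> 0" using h by simp
  note D = T_bdq[OF \<phi> h0]
  note L = test_L2[OF T_dx[OF \<phi>]] test_L2[OF T_mult_wt[OF D]] test_L2[OF T_mult_wt[OF \<phi>]]
  let ?R = "\<lambda>p. of_real (2 * \<delta>) * mult_wt (- 1 - \<delta>) (bdq h \<phi>) p - of_real (\<delta> * (1 + \<delta>)) * mult_wt (- 2 - \<delta>) \<phi> p"
  have R: "?R \<in> L2 lborel" by (intro L2_diff L2_scale L)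
  have "Re (q \<phi> (multiplier \<delta> h \<phi>)) = (\<Sum>b\<in>Basis. Re (ip (dir_deriv b \<phi>) (multiplier \<delta> h (dir_deriv b \<phi>)))
      + fst b * Re (ip (dir_deriv b \<phi>) ?R))"
    unfolding q_eq[OF \<phi> T_multiplier[OF \<phi> h0]] Re_sum
  proof (rule sum.cong[OF refl])
    fix b :: "real \<times> 'b" assume b: "b \<in> Basis"
    note db = test_dir_deriv[OF \<phi> b]
    show "Re (ip (dir_deriv b \<phi>) (dir_deriv b (multiplier \<delta> h \<phi>)))
        = Re (ip (dir_deriv b \<phi>) (multiplier \<delta> h (dir_deriv b \<phi>))) + fst b * Re (ip (dir_deriv b \<phi>) ?R)"
      unfolding dir_deriv_multiplier[OF \<phi> h0 b]
      using L2_inner_add_right[OF test_L2[OF T_multiplier[OF db h0]] L2_scale[OF R] test_L2[OF db], of \<delta> "of_real (fst b)"]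
      by (simp only: L2_inner_scale_right) simp
  qed
  also have "\<dots> = (\<Sum>b\<in>Basis. Re (ip (dir_deriv b \<phi>) (multiplier \<delta> h (dir_deriv b \<phi>)))) + Re (ip (dx \<phi>) ?R)"
    unfolding sum.distrib sum_Basis_fst ..
  also have "\<dots> \<ge> Re (ip (dx \<phi>) ?R)"
    using ip_multiplier_nonneg[OF test_dir_deriv[OF \<phi>] h \<delta>] by (simp add: sum_nonneg)
  finally have 1: "Re (ip (dx \<phi>) ?R) \<le> Re (q \<phi> (multiplier \<delta> h \<phi>))" .
  have 2: "Re (ip (dx \<phi>) ?R) = 2 * \<delta> * Re (ip (dx \<phi>) (mult_wt (- 1 - \<delta>) (bdq h \<phi>)))
      - \<delta> * (1 + \<delta>) * Re (ip (dx \<phi>) (mult_wt (- 2 - \<delta>) \<phi>))"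
    using L2_inner_diff_right[OF L2_scale[OF L(2)] L2_scale[OF L(3)] L(1), of "of_real (2 * \<delta>)" "- 1 - \<delta>" "of_real (\<delta> * (1 + \<delta>))" "- 2 - \<delta>"]
    by (simp only: L2_inner_scale_right) simp
  have 3: "Re (ip (dx \<phi>) (mult_wt (- 2 - \<delta>) \<phi>)) = (1 + \<delta> / 2) * (nrm (mult_wt (- (3 + \<delta>) / 2) \<phi>))\<^sup>2"
  proof -
    have "Re (ip (dx \<phi>) (mult_wt (- 2 - \<delta>) \<phi>)) = Re (ip \<phi> (mult_wt (- 2 - \<delta>) (dx \<phi>)))"
      using arg_cong[OF L2_inner_cnj[of lborel "dx \<phi>" "mult_wt (- 2 - \<delta>) \<phi>"], of Re] by (simp add: ip_mult_wt_left)
    then show ?thesis using hardy_identity[OF \<phi>, of \<delta>] by (simp add: field_simps)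
  qed
  have 4: "(nrm (mult_wt (- (1 + \<delta>) / 2) (dx \<phi>)))\<^sup>2 - nrm (dx \<phi>) * nrm (\<lambda>p. bdq h \<phi> p - dx \<phi> p)
      \<le> Re (ip (dx \<phi>) (mult_wt (- 1 - \<delta>) (bdq h \<phi>)))"
  proof -
    let ?E = "\<lambda>p. bdq h \<phi> p - dx \<phi> p"
    have E: "?E \<in> T" by (intro test_diff D T_dx \<phi>)
    have "mult_wt (- 1 - \<delta>) (bdq h \<phi>) = (\<lambda>p. mult_wt (- 1 - \<delta>) (dx \<phi>) p + mult_wt (- 1 - \<delta>) ?E p)"
      by (simp add: mult_wt_def right_diff_distrib)
    then have "Re (ip (dx \<phi>) (mult_wt (- 1 - \<delta>) (bdq h \<phi>)))
        = Re (ip (dx \<phi>) (mult_wt (- 1 - \<delta>) (dx \<phi>))) + Re (ip (dx \<phi>) (mult_wt (- 1 - \<delta>) ?E))"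
      by (simp add: L2_inner_add_right[OF test_L2[OF T_mult_wt[OF T_dx[OF \<phi>]]] test_L2[OF T_mult_wt[OF E]] L(1)])
    moreover have "Re (ip (dx \<phi>) (mult_wt (- 1 - \<delta>) (dx \<phi>))) = (nrm (mult_wt (- (1 + \<delta>) / 2) (dx \<phi>)))\<^sup>2"
      by (rule nrm_mult_wt_sq[OF T_dx[OF \<phi>]]) (simp add: field_simps)
    moreover have "cmod (ip (dx \<phi>) (mult_wt (- 1 - \<delta>) ?E)) \<le> nrm (dx \<phi>) * nrm ?E"
      by (rule order_trans[OF cmod_L2_inner_le[OF L(1) test_L2[OF T_mult_wt[OF E]]]])
        (use nrm_mult_wt_le[OF E, of "- 1 - \<delta>"] \<delta> in \<open>simp add: mult_left_mono\<close>)
    ultimately show ?thesis using abs_Re_le_cmod[of "ip (dx \<phi>) (mult_wt (- 1 - \<delta>) ?E)"] by linarith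
  qed
  have "2 * \<delta> * ((nrm (mult_wt (- (1 + \<delta>) / 2) (dx \<phi>)))\<^sup>2 - nrm (dx \<phi>) * nrm (\<lambda>p. bdq h \<phi> p - dx \<phi> p))
      \<le> 2 * \<delta> * Re (ip (dx \<phi>) (mult_wt (- 1 - \<delta>) (bdq h \<phi>)))"
    by (rule mult_left_mono[OF 4]) (use \<delta> in simp)
  then show ?thesis using 1 unfolding 2 3 by (simp add: right_diff_distrib mult.assoc)
qed

end

section \<open>The weighted estimate\<close>

text \<open>Put \<open>P = Q - z m^2\<close>. The imaginary parts of \<open>P\<close> and
  \<open>cnj z * P\<close> isolate \<open>Im z * m^2\<close> and \<open>Im z * Q\<close>; the
  product of the two bounds is \<open>(Im z)^2 m^2 Q \<le> |z| |P|^2\<close>. This is the origin of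
  the factor \<open>|z|^(1/2)\<close> in the theorem.\<close>

lemma abs_Im_mult_le_energy:
  fixes z :: complex
  assumes "0 \<le> m" "d\<^sup>2 \<le> Q" "0 \<le> d"
  shows "\<bar>Im z\<bar> * m * d \<le> sqrt (cmod z) * cmod (of_real Q - z * of_real (m\<^sup>2))"
proof -
  let ?P = "of_real Q - z * of_real (m\<^sup>2)"
  have Q: "0 \<le> Q" using assms(2) by (meson order_trans zero_le_power2)
  have "Im ?P = - (Im z * m\<^sup>2)" by simp
  then have 1: "\<bar>Im z\<bar> * m\<^sup>2 \<le> cmod ?P"
    using abs_Im_le_cmod[of ?P] by (simp add: abs_mult)
  have "Im (cnj z * ?P) = - (Im z * Q)" by (simp add: algebra_simps)
  then have "\<bar>Im z\<bar> * Q \<le> cmod (cnj z * ?P)"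
    using abs_Im_le_cmod[of "cnj z * ?P"] Q by (simp only: abs_minus_cancel abs_mult abs_of_nonneg)
  then have 2: "\<bar>Im z\<bar> * Q \<le> cmod z * cmod ?P" by (simp add: norm_mult)
  have "(\<bar>Im z\<bar> * m * d)\<^sup>2 = (\<bar>Im z\<bar> * m\<^sup>2) * (\<bar>Im z\<bar> * d\<^sup>2)"
    by (simp add: power2_eq_square mult_ac)
  also have "\<dots> \<le> (\<bar>Im z\<bar> * m\<^sup>2) * (\<bar>Im z\<bar> * Q)"
    using assms(2) by (intro mult_left_mono) auto
  also have "\<dots> \<le> cmod ?P * (cmod z * cmod ?P)"
    by (rule mult_mono[OF 1 2]) (use Q in auto)
  also have "\<dots> = (sqrt (cmod z) * cmod ?P)\<^sup>2"
    by (simp add: power_mult_distrib power2_eq_square)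
  finally show ?thesis by (rule power2_le_imp_le) simp
qed

text \<open>Multiply \<open>le\<close> by \<open>\<kappa> = 1 + \<delta>/2\<close> and apply Hardy
  to the negative term: since \<open>2 \<kappa> - (1 + \<delta>) = 1\<close>, this leaves
  \<open>\<delta> X^2 \<le> a X (2 + 2 \<delta> + 2 s)\<close> up to an error. With
  \<open>\<kappa> N \<le> X\<close> and \<open>2 + 2 \<delta> + 2 s \<le> 3 \<kappa> (1 + s)\<close>
  the constant 3 results. If the conclusion failed, the excess \<open>\<gamma>\<close> would enter
  both factors of \<open>X (\<delta> X - a (2 + 2 \<delta> + 2 s))\<close> and outweigh the
  error.\<close>

lemma quadratic_conclusion:
  fixes X N a s \<delta> \<epsilon> \<gamma> :: real
  assumes \<delta>: "0 < \<delta>" "\<delta> \<le> 1" and "0 \<le> a" "0 \<le> s" "0 \<le> N" "0 < \<gamma>"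
    and hardy: "(1 + \<delta> / 2) * N \<le> X"
    and le: "2 * \<delta> * X\<^sup>2 - \<delta> * (1 + \<delta>) * (1 + \<delta> / 2) * N\<^sup>2 \<le> a * (2 * X + \<delta> * N + 2 * s * N) + \<epsilon>"
    and \<epsilon>: "2 * \<epsilon> < \<delta> * \<gamma>\<^sup>2"
  shows "N \<le> 3 / \<delta> * (1 + s) * a + \<gamma>"
proof (rule ccontr)
  define \<kappa> where "\<kappa> = 1 + \<delta> / 2"
  have \<kappa>: "\<kappa> \<ge> 1" "\<kappa> \<le> 2" "2 * \<kappa> = 2 + \<delta>" using \<delta> by (auto simp: \<kappa>_def)
  have N: "\<kappa> * N \<le> X" using hardy by (simp add: \<kappa>_def)
  have X0: "0 \<le> X" using N \<kappa> assms(5) by (meson mult_nonneg_nonneg order_trans zero_le_one)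
  define c where "c = 3 / \<delta> * (1 + s) * a"
  have dc: "\<delta> * c = 3 * (1 + s) * a" using \<delta>(1) by (simp add: c_def)
  have c0: "0 \<le> c" using \<delta>(1) assms(3,4) by (simp add: c_def)
  assume "\<not> N \<le> 3 / \<delta> * (1 + s) * a + \<gamma>"
  then have cN: "c + \<gamma> < N" by (simp add: c_def)
  then have "\<delta> * (c + \<gamma>) < \<delta> * N" using \<delta>(1) by (rule mult_strict_left_mono)
  then have N1: "3 * (1 + s) * a + \<delta> * \<gamma> < \<delta> * N" by (simp only: distrib_left dc)
  have g: "\<gamma> \<le> N" using cN c0 by simp
  have NX: "N \<le> X" using N mult_right_mono[OF \<kappa>(1) assms(5)] by simp
  have "(\<kappa> * N)\<^sup>2 \<le> X\<^sup>2" by (rule power_mono[OF N]) (use \<kappa> assms(5) in simp)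
  then have "\<delta> * (1 + \<delta>) * (\<kappa> * N)\<^sup>2 \<le> \<delta> * (1 + \<delta>) * X\<^sup>2" using \<delta> by (intro mult_left_mono) auto
  moreover have "\<delta> * (1 + \<delta>) * (\<kappa> * N)\<^sup>2 = \<kappa> * (\<delta> * (1 + \<delta>) * \<kappa> * N\<^sup>2)"
    by (simp add: power2_eq_square mult_ac)
  ultimately have 1: "\<kappa> * (\<delta> * (1 + \<delta>) * \<kappa> * N\<^sup>2) \<le> \<delta> * (1 + \<delta>) * X\<^sup>2" by (simp only:)
  have "2 * \<kappa> * \<delta> * X\<^sup>2 - \<delta> * (1 + \<delta>) * X\<^sup>2 \<le> 2 * \<kappa> * \<delta> * X\<^sup>2 - \<kappa> * (\<delta> * (1 + \<delta>) * \<kappa> * N\<^sup>2)"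
    using 1 by simp
  also have "\<dots> = \<kappa> * (2 * \<delta> * X\<^sup>2 - \<delta> * (1 + \<delta>) * \<kappa> * N\<^sup>2)" by (simp add: algebra_simps)
  also have "\<dots> \<le> \<kappa> * (a * (2 * X + \<delta> * N + 2 * s * N) + \<epsilon>)"
    using le \<kappa>(1) unfolding \<kappa>_def[symmetric] by (intro mult_left_mono) auto
  also have "2 * \<kappa> * \<delta> * X\<^sup>2 - \<delta> * (1 + \<delta>) * X\<^sup>2 = \<delta> * X\<^sup>2" unfolding \<kappa>(3) by (simp add: algebra_simps)
  also have "\<kappa> * (a * (2 * X + \<delta> * N + 2 * s * N) + \<epsilon>) = a * (2 * \<kappa> * X + (\<delta> + 2 * s) * (\<kappa> * N)) + \<kappa> * \<epsilon>"
    by (simp add: algebra_simps)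
  also have "\<dots> \<le> a * (2 * \<kappa> * X + (\<delta> + 2 * s) * X) + \<kappa> * \<epsilon>"
    using N assms(3,4) \<delta> by (intro add_right_mono mult_left_mono add_left_mono) auto
  also have "\<dots> = X * (a * (2 + 2 * \<delta> + 2 * s)) + \<kappa> * \<epsilon>" unfolding \<kappa>(3) by (simp add: algebra_simps)
  finally have main': "\<delta> * X\<^sup>2 \<le> X * (a * (2 + 2 * \<delta> + 2 * s)) + \<kappa> * \<epsilon>" .
  have "X * (\<delta> * X - a * (2 + 2 * \<delta> + 2 * s)) = \<delta> * X\<^sup>2 - X * (a * (2 + 2 * \<delta> + 2 * s))"
    by (simp add: right_diff_distrib power2_eq_square mult_ac)
  then have main: "X * (\<delta> * X - a * (2 + 2 * \<delta> + 2 * s)) \<le> \<kappa> * \<epsilon>" using main' by linarith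
  have "\<kappa> * (\<delta> * N) \<le> \<delta> * X" using mult_left_mono[OF N, of \<delta>] \<delta> by (simp add: mult.left_commute)
  moreover have "\<kappa> * (3 * (1 + s) * a + \<delta> * \<gamma>) \<le> \<kappa> * (\<delta> * N)"
    by (rule mult_left_mono[OF less_imp_le[OF N1]]) (use \<kappa> in simp)
  moreover have "a * (2 + 2 * \<delta> + 2 * s) + \<delta> * \<gamma> \<le> \<kappa> * (3 * (1 + s) * a + \<delta> * \<gamma>)"
  proof -
    have "2 + 2 * \<delta> + 2 * s \<le> \<kappa> * (3 * (1 + s))"
    proof -
      have "3 + 3 * (\<delta> / 2) + 3 * s \<le> \<kappa> * (3 * (1 + s))"
        using \<delta> assms(4) by (simp add: \<kappa>_def algebra_simps)
      then show ?thesis using \<delta> assms(4) by linarith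
    qed
    from mult_right_mono[OF this assms(3)] have "a * (2 + 2 * \<delta> + 2 * s) \<le> \<kappa> * (3 * (1 + s) * a)"
      by (simp only: mult.assoc mult.commute[of a])
    moreover have "\<delta> * \<gamma> \<le> \<kappa> * (\<delta> * \<gamma>)" using mult_right_mono[OF \<kappa>(1), of "\<delta> * \<gamma>"] \<delta> assms(6) by simp
    ultimately show ?thesis by (simp add: distrib_left)
  qed
  ultimately have "\<delta> * \<gamma> \<le> \<delta> * X - a * (2 + 2 * \<delta> + 2 * s)" by linarith
  moreover have "\<gamma> \<le> X" using g NX by simp
  ultimately have "\<gamma> * (\<delta> * \<gamma>) \<le> X * (\<delta> * X - a * (2 + 2 * \<delta> + 2 * s))"
    using assms(6) \<delta> by (intro mult_mono) auto
  moreover have "\<gamma> * (\<delta> * \<gamma>) = \<delta> * \<gamma>\<^sup>2" by (simp add: power2_eq_square)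
  ultimately have *: "\<delta> * \<gamma>\<^sup>2 \<le> \<kappa> * \<epsilon>" using main by linarith
  moreover have "0 < \<delta> * \<gamma>\<^sup>2" using \<delta> assms(6) by simp
  ultimately have "0 < \<kappa> * \<epsilon>" by linarith
  \<comment> \<open>The sign of \<open>\<epsilon>\<close> is not among the assumptions, but is
    required to enlarge \<open>\<kappa>\<close> to 2.\<close>
  then have "\<epsilon> > 0" using \<kappa>(1) by (simp add: zero_less_mult_iff)
  then have "\<kappa> * \<epsilon> \<le> 2 * \<epsilon>" using \<kappa>(2) by simp
  then show False using * \<epsilon> by simp
qed

section \<open>The lower-order term tested with the multiplier\<close>

context forward_invariant_domain
begin

lemma nrm_translate: "f \<in> borel_measurable borel \<Longrightarrow> nrm (\<lambda>p. f (p - c)) = nrm f"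
  unfolding L2_norm_def using integral_lborel_translate[of "\<lambda>p. (cmod (f p))\<^sup>2" c] by simp

lemma nrm_one_minus_wt_le:
  assumes "\<phi> \<in> T" "0 \<le> \<delta>"
  shows "nrm (\<lambda>p. \<phi> p - mult_wt (- \<delta>) \<phi> p) \<le> nrm \<phi>"
proof -
  have "nrm (\<lambda>p. \<phi> p - mult_wt (- \<delta>) \<phi> p) \<le> 1 * nrm \<phi>"
  proof (rule L2_dominated(2)[OF _ test_L2[OF assms(1)]])
    show "(\<lambda>p. \<phi> p - mult_wt (- \<delta>) \<phi> p) \<in> borel_measurable lborel"
      by (rule L2_D(1)[OF test_L2[OF test_diff[OF assms(1) T_mult_wt[OF assms(1)]]]])
    show "cmod (\<phi> p - mult_wt (- \<delta>) \<phi> p) \<le> 1 * cmod (\<phi> p)" for p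
    proof (cases "p \<in> \<Omega>")
      case True
      have "\<phi> p - mult_wt (- \<delta>) \<phi> p = of_real (1 - wt (- \<delta>) p) * \<phi> p"
        by (simp add: mult_wt_def left_diff_distrib)
      moreover have "0 \<le> 1 - wt (- \<delta>) p" "1 - wt (- \<delta>) p \<le> 1"
        using wt_le_1[of "- \<delta>" p] pos[OF True] assms(2) by auto
      ultimately show ?thesis by (simp only: norm_mult norm_of_real abs_of_nonneg mult_right_mono norm_ge_zero)
    qed (simp add: mult_wt_def test_outside[OF assms(1)])
  qed simp
  then show ?thesis by simp
qed

text \<open>With the true derivative the multiplier is antisymmetric, so its pairing with
  \<open>\<phi>\<close> is purely imaginary and only \<open>Im z\<close> survives in the real part.
  The second term on the right accounts for the difference quotient, with all of
  \<open>cmod z\<close>.\<close>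

lemma ip_multiplier_bound:
  assumes \<phi>: "\<phi> \<in> T" and h: "h > 0" and \<delta>: "0 < \<delta>"
  shows "Re (z * ip \<phi> (multiplier \<delta> h \<phi>)) \<le> 2 * \<bar>Im z\<bar> * nrm \<phi> * nrm (dx \<phi>)
    + 2 * cmod z * nrm \<phi> * nrm (\<lambda>p. bdq h \<phi> p - dx \<phi> p)"
proof -
  let ?E = "\<lambda>p. bdq h \<phi> p - dx \<phi> p"
  let ?A = "\<lambda>p. dx \<phi> p - mult_wt (- \<delta>) (dx \<phi>) p"
  let ?B = "\<lambda>p. ?E p - mult_wt (- \<delta>) ?E p"
  have h0: "h \<ge> 0" using h by simp
  have E: "?E \<in> T" by (intro test_diff T_bdq T_dx \<phi> h0)
  have A: "?A \<in> T" by (intro test_diff T_dx T_mult_wt \<phi>)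
  have B: "?B \<in> T" by (rule test_diff[OF E T_mult_wt[OF E]])
  note L = test_L2[OF A] test_L2[OF B] test_L2[OF T_mult_wt[OF \<phi>]] test_L2[OF \<phi>] test_L2[OF T_dx[OF \<phi>]] test_L2[OF T_mult_wt[OF T_dx[OF \<phi>]]]
  \<comment> \<open>\<open>?A\<close> is \<open>w\<close> times the derivative and \<open>?B\<close>
    is \<open>w\<close> times the error of the quotient; the bracket is the antisymmetric
    part.\<close>
  have m: "multiplier \<delta> h \<phi> = (\<lambda>p. (2 * ?A p + of_real \<delta> * mult_wt (- 1 - \<delta>) \<phi> p) + 2 * ?B p)"
    unfolding multiplier_def mult_wt_def by (rule ext) (simp add: algebra_simps)
  define S0 where "S0 = ip \<phi> (\<lambda>p. 2 * ?A p + of_real \<delta> * mult_wt (- 1 - \<delta>) \<phi> p)"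
  have S: "ip \<phi> (multiplier \<delta> h \<phi>) = S0 + 2 * ip \<phi> ?B"
    unfolding m S0_def
    using L2_inner_add_right[OF L2_add[OF L2_scale[OF L(1)] L2_scale[OF L(3)]] L2_scale[OF L(2)] L(4), of 2 "of_real \<delta>" "- 1 - \<delta>" 2]
      L2_inner_scale_right[of lborel \<phi> 2 ?B] by simp
  have S0: "S0 = 2 * ip \<phi> ?A + of_real \<delta> * ip \<phi> (mult_wt (- 1 - \<delta>) \<phi>)"
    unfolding S0_def
    using L2_inner_add_right[OF L2_scale[OF L(1)] L2_scale[OF L(3)] L(4), of 2 "of_real \<delta>" "- 1 - \<delta>"]
      L2_inner_scale_right[of lborel \<phi> 2 ?A] L2_inner_scale_right[of lborel \<phi> "of_real \<delta>" "mult_wt (- 1 - \<delta>) \<phi>"] by simp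
  have ipA: "ip \<phi> ?A = ip \<phi> (dx \<phi>) - ip \<phi> (mult_wt (- \<delta>) (dx \<phi>))"
    by (rule L2_inner_diff_right[OF L(5,6,4)])
  have e1: "- \<delta> - 1 = - 1 - \<delta>" by simp
  have "2 * Re (ip \<phi> (dx \<phi>)) = 0"
    using ip_dx_mult_wt[OF \<phi>, of 0] mult_wt_0[OF test_outside[OF T_dx[OF \<phi>]]] by simp
  moreover have "2 * Re (ip \<phi> (mult_wt (- \<delta>) (dx \<phi>))) = \<delta> * Re (ip \<phi> (mult_wt (- 1 - \<delta>) \<phi>))"
    using ip_dx_mult_wt[OF \<phi>, of "- \<delta>"] unfolding e1 by simp
  ultimately have Re0: "Re S0 = 0" unfolding S0 ipA by simp
  have "Im (ip \<phi> (mult_wt (- 1 - \<delta>) \<phi>)) = 0"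
    using L2_inner_cnj[of lborel \<phi> "mult_wt (- 1 - \<delta>) \<phi>"] ip_mult_wt_left[of "- 1 - \<delta>" \<phi> \<phi>]
    by (metis Reals_cnj_iff complex_is_Real_iff)
  then have "Im S0 = 2 * Im (ip \<phi> ?A)" unfolding S0 by simp
  moreover have "\<bar>Im (ip \<phi> ?A)\<bar> \<le> nrm \<phi> * nrm (dx \<phi>)"
  proof -
    have "\<bar>Im (ip \<phi> ?A)\<bar> \<le> nrm \<phi> * nrm ?A"
      by (rule order_trans[OF abs_Im_le_cmod cmod_L2_inner_le[OF L(4,1)]])
    also have "\<dots> \<le> nrm \<phi> * nrm (dx \<phi>)"
      using nrm_one_minus_wt_le[OF T_dx[OF \<phi>], of \<delta>] \<delta> by (intro mult_left_mono) auto
    finally show ?thesis .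
  qed
  ultimately have "\<bar>Im S0\<bar> \<le> 2 * (nrm \<phi> * nrm (dx \<phi>))" by simp
  then have "\<bar>Im z\<bar> * \<bar>Im S0\<bar> \<le> \<bar>Im z\<bar> * (2 * (nrm \<phi> * nrm (dx \<phi>)))" by (rule mult_left_mono) simp
  moreover have "Re (z * S0) \<le> \<bar>Im z\<bar> * \<bar>Im S0\<bar>" using Re0 by (simp add: abs_mult[symmetric])
  ultimately have 1: "Re (z * S0) \<le> 2 * \<bar>Im z\<bar> * nrm \<phi> * nrm (dx \<phi>)" by simp
  have "cmod (ip \<phi> ?B) \<le> nrm \<phi> * nrm ?E"
  proof -
    have "cmod (ip \<phi> ?B) \<le> nrm \<phi> * nrm ?B" by (rule cmod_L2_inner_le[OF L(4,2)])
    also have "\<dots> \<le> nrm \<phi> * nrm ?E"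
      using nrm_one_minus_wt_le[OF E, of \<delta>] \<delta> by (intro mult_left_mono) auto
    finally show ?thesis .
  qed
  then have "cmod z * cmod (ip \<phi> ?B) \<le> cmod z * (nrm \<phi> * nrm ?E)" by (rule mult_left_mono) simp
  then have "Re (z * ip \<phi> ?B) \<le> cmod z * (nrm \<phi> * nrm ?E)"
    using complex_Re_le_cmod[of "z * ip \<phi> ?B"] by (simp add: norm_mult)
  then have 2: "Re (z * (2 * ip \<phi> ?B)) \<le> 2 * cmod z * nrm \<phi> * nrm ?E" by (simp add: algebra_simps)
  show ?thesis unfolding S distrib_left using 1 2 by simp
qed

section \<open>Difference quotients along approximating sequences\<close>

lemma bdq_tendsto:
  assumes \<phi>: "\<phi> \<in> T" and t: "t \<longlonglongrightarrow> 0" "\<And>n. 0 < t n" "\<And>n. t n \<le> 1"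
  shows "(\<lambda>n. nrm (\<lambda>p. bdq (t n) \<phi> p - dx \<phi> p)) \<longlonglongrightarrow> 0"
proof -
  let ?v = "(- 1, 0) :: real \<times> 'b"
  have dv: "dir_deriv ?v \<phi> p = - dx \<phi> p" for p
    using linear_neg[OF has_derivative_linear[OF test_has_derivative[OF \<phi>, of p]], of "(1, 0)"] by simp
  have "continuous_on UNIV (\<lambda>p. dir_deriv ?v \<phi> p)"
    unfolding dv by (intro continuous_on_minus test_continuous[OF T_dx[OF \<phi>]])
  from difference_quotient_bound[of \<phi> "\<lambda>p v. dir_deriv v \<phi> p", OF test_has_derivative[OF \<phi>] this test_compact[OF \<phi>] outside_closure_support[of _ \<phi>]]
  obtain R B where B: "B \<ge> 0" and b: "\<And>s p. 0 < s \<Longrightarrow> s \<le> 1 \<Longrightarrow>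
      cmod ((\<phi> (p + s *\<^sub>R ?v) - \<phi> p) /\<^sub>R s) \<le> B * indicator (cball 0 R) p \<and> cmod (dir_deriv ?v \<phi> p) \<le> B * indicator (cball 0 R) p"
    by blast
  \<comment> \<open>A backward quotient is minus a forward quotient in direction
    \<open>(-1, 0)\<close>.\<close>
  have eq: "bdq s \<phi> p = - ((\<phi> (p + s *\<^sub>R ?v) - \<phi> p) /\<^sub>R s)" for s p
  proof -
    have e: "p + s *\<^sub>R ?v = p - (s, 0)" by (cases p) simp
    show ?thesis unfolding e bdq_def
      by (simp add: scaleR_conv_of_real divide_inverse algebra_simps)
  qed
  have L: "(\<lambda>p. bdq (t n) \<phi> p - dx \<phi> p) \<in> L2 lborel" for n
    by (intro L2_diff test_L2[OF T_bdq] test_L2[OF T_dx] \<phi> less_imp_le t)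
  have "(\<lambda>n. LINT p|lborel. (cmod (bdq (t n) \<phi> p - dx \<phi> p))\<^sup>2) \<longlonglongrightarrow> (LINT p|(lborel :: (real \<times> 'b) measure). 0)"
  proof (rule integral_dominated_convergence[where w="\<lambda>p. (2 * B)\<^sup>2 * indicator (cball 0 R) p"])
    show "AE p in lborel. (\<lambda>n. (cmod (bdq (t n) \<phi> p - dx \<phi> p))\<^sup>2) \<longlonglongrightarrow> 0"
    proof (rule AE_I2)
      fix p
      have "filterlim t (at 0) sequentially"
        using t(1) t(2) by (auto simp: filterlim_at less_imp_neq[symmetric])
      from tendsto_minus[OF filterlim_compose[OF difference_quotient_tendsto[OF test_has_derivative[OF \<phi>], where v="?v"] this]]
      have "(\<lambda>n. bdq (t n) \<phi> p) \<longlonglongrightarrow> dx \<phi> p"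
        by (simp only: eq dv minus_minus)
      then have "(\<lambda>n. (cmod (bdq (t n) \<phi> p - dx \<phi> p))\<^sup>2) \<longlonglongrightarrow> (cmod (dx \<phi> p - dx \<phi> p))\<^sup>2"
        by (intro tendsto_intros)
      then show "(\<lambda>n. (cmod (bdq (t n) \<phi> p - dx \<phi> p))\<^sup>2) \<longlonglongrightarrow> 0" by simp
    qed
    show "AE p in lborel. norm ((cmod (bdq (t n) \<phi> p - dx \<phi> p))\<^sup>2) \<le> (2 * B)\<^sup>2 * indicator (cball 0 R) p" for n
    proof (rule AE_I2)
      fix p
      have "cmod (bdq (t n) \<phi> p - dx \<phi> p) \<le> cmod (bdq (t n) \<phi> p) + cmod (dx \<phi> p)" by (rule norm_triangle_ineq4)
      also have "\<dots> \<le> 2 * B * indicator (cball 0 R) p"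
        using b[OF t(2,3), of n p] unfolding eq norm_minus_cancel dv by simp
      finally have "(cmod (bdq (t n) \<phi> p - dx \<phi> p))\<^sup>2 \<le> (2 * B * indicator (cball 0 R) p)\<^sup>2" by (rule power_mono) simp
      then show "norm ((cmod (bdq (t n) \<phi> p - dx \<phi> p))\<^sup>2) \<le> (2 * B)\<^sup>2 * indicator (cball 0 R) p"
        by (cases "p \<in> cball 0 R") (auto simp: power_mult_distrib)
    qed
    show "(\<lambda>p. (cmod (bdq (t n) \<phi> p - dx \<phi> p))\<^sup>2) \<in> borel_measurable lborel" for n
      using borel_measurable_integrable[OF L2_D(2)[OF L]] .
  qed (use emeasure_lborel_cball_finite[of "0::real \<times> 'b" R] in auto)
  from tendsto_real_sqrt[OF this] show ?thesis by (simp add: L2_norm_def)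
qed

text \<open>Cutting the step \<open>h\<close> into equal parts and using the triangle inequality
  bounds the quotient by the one with step \<open>h / Suc n\<close>, whose norm tends to that of the
  derivative.\<close>

lemma nrm_bdq_le:
  assumes \<phi>: "\<phi> \<in> T" and h: "0 < h" "h \<le> 1"
  shows "nrm (bdq h \<phi>) \<le> nrm (dx \<phi>)"
proof -
  have shift_le: "nrm (\<lambda>p. \<phi> p - \<phi> (p - (real k * s, 0))) \<le> real k * nrm (\<lambda>p. \<phi> p - \<phi> (p - (s, 0)))"
    if s: "s \<ge> 0" for k s
  proof (induction k)
    case 0
    have "nrm (\<lambda>p. 0) = 0" by (simp add: L2_norm_def)
    then show ?case by (simp add: zero_prod_def[symmetric])
  next
    case (Suc k)
    let ?g = "\<lambda>p. \<phi> p - \<phi> (p - (real k * s, 0))"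
    have g: "?g \<in> T" by (intro test_diff T_shift \<phi>) (use s in auto)
    have g1: "(\<lambda>p. \<phi> p - \<phi> (p - (s, 0))) \<in> T" by (intro test_diff T_shift \<phi> s)
    have "(\<lambda>p. \<phi> p - \<phi> (p - (real (Suc k) * s, 0))) = (\<lambda>p. (\<phi> p - \<phi> (p - (s, 0))) + ?g (p - (s, 0)))"
      by (simp add: algebra_simps minus_prod_def)
    moreover have "nrm (\<lambda>p. (\<phi> p - \<phi> (p - (s, 0))) + ?g (p - (s, 0)))
        \<le> nrm (\<lambda>p. \<phi> p - \<phi> (p - (s, 0))) + nrm (\<lambda>p. ?g (p - (s, 0)))"
      by (rule L2_norm_triangle[OF test_L2[OF g1] test_L2[OF T_shift[OF g s]]])
    moreover have "nrm (\<lambda>p. ?g (p - (s, 0))) = nrm ?g" by (rule nrm_translate[OF test_measurable[OF g]])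
    ultimately show ?case using Suc by (simp add: algebra_simps)
  qed
  define t where "t = (\<lambda>n. h / real (Suc n))"
  have t0: "t \<longlonglongrightarrow> 0"
    using LIMSEQ_Suc[OF lim_const_over_n[of h]] by (simp add: t_def del: of_nat_Suc)
  have tp: "0 < t n" "t n \<le> 1" for n
    using h by (auto simp: t_def intro: order_trans[OF _ h(2)] simp: divide_le_eq)
  have "nrm (bdq h \<phi>) \<le> nrm (dx \<phi>) + nrm (\<lambda>p. bdq (t n) \<phi> p - dx \<phi> p)" for n
  proof -
    have "nrm (bdq h \<phi>) = 1 / h * nrm (\<lambda>p. \<phi> p - \<phi> (p - (h, 0)))"
      unfolding bdq_def L2_norm_scale using h by (simp add: norm_divide)
    also have "\<dots> \<le> 1 / h * (real (Suc n) * nrm (\<lambda>p. \<phi> p - \<phi> (p - (t n, 0))))"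
      using shift_le[of "t n" "Suc n"] tp(1)[of n] h
      by (intro mult_left_mono) (auto simp: t_def simp del: of_nat_Suc)
    also have "\<dots> = nrm (bdq (t n) \<phi>)"
      unfolding bdq_def L2_norm_scale using h tp(1)[of n] by (simp add: norm_divide t_def del: of_nat_Suc)
    also have "\<dots> \<le> nrm (dx \<phi>) + nrm (\<lambda>p. bdq (t n) \<phi> p - dx \<phi> p)"
      by (intro L2_norm_triangle_sub test_L2[OF T_bdq] test_L2[OF T_dx] \<phi> less_imp_le tp)
    finally show ?thesis .
  qed
  moreover have "(\<lambda>n. nrm (dx \<phi>) + nrm (\<lambda>p. bdq (t n) \<phi> p - dx \<phi> p)) \<longlonglongrightarrow> nrm (dx \<phi>) + 0"
    by (intro tendsto_add tendsto_const bdq_tendsto[OF \<phi> t0 tp])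
  ultimately have "nrm (bdq h \<phi>) \<le> nrm (dx \<phi>) + 0" by (intro LIMSEQ_le_const) auto
  then show ?thesis by simp
qed

text \<open>The quotient converges for the single function \<open>\<phi> N\<close>; for later
  members the difference to \<open>\<phi> N\<close> is small in the form norm, and
  \<open>nrm_bdq_le\<close> controls its quotient uniformly in \<open>h\<close>. Thus one
  \<open>h\<close> works for all large \<open>n\<close>.\<close>

lemma bdq_uniform:
  assumes \<phi>: "fa \<phi> u" and \<epsilon>: "\<epsilon> > 0"
  shows "\<exists>h N. 0 < h \<and> h \<le> 1 \<and> (\<forall>n\<ge>N. nrm (\<lambda>p. bdq h (\<phi> n) p - dx (\<phi> n) p) \<le> \<epsilon>)"
proof -
  note D = fa_D(2)[OF \<phi>]
  obtain N where N: "\<And>n. n \<ge> N \<Longrightarrow> Q (\<lambda>p. \<phi> n p - \<phi> N p) < (\<epsilon> / 3)\<^sup>2"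
    using fa_Cauchy[OF \<phi>, of "(\<epsilon> / 3)\<^sup>2"] \<epsilon> by auto
  have "(\<lambda>n. nrm (\<lambda>p. bdq (1 / real (Suc n)) (\<phi> N) p - dx (\<phi> N) p)) \<longlonglongrightarrow> 0"
    using LIMSEQ_Suc[OF lim_1_over_n] by (intro bdq_tendsto[OF D]) auto
  from order_tendstoD(2)[OF this, of "\<epsilon> / 3"] \<epsilon>
  obtain k where k: "nrm (\<lambda>p. bdq (1 / real (Suc k)) (\<phi> N) p - dx (\<phi> N) p) < \<epsilon> / 3"
    by (auto simp: eventually_sequentially)
  define h where "h = 1 / real (Suc k)"
  have h: "0 < h" "h \<le> 1" by (auto simp: h_def)
  have "nrm (\<lambda>p. bdq h (\<phi> n) p - dx (\<phi> n) p) \<le> \<epsilon>" if n: "n \<ge> N" for n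
  proof -
    let ?c = "\<lambda>p. \<phi> n p - \<phi> N p"
    have c: "?c \<in> T" by (rule test_diff[OF D D])
    have "(nrm (dx ?c))\<^sup>2 \<le> (\<epsilon> / 3)\<^sup>2" using dx_le_Q[OF c] N[OF n] by linarith
    then have d: "nrm (dx ?c) \<le> \<epsilon> / 3" by (rule power2_le_imp_le) (use \<epsilon> in simp)
    note L = test_L2[OF T_bdq[OF c less_imp_le[OF h(1)]]] test_L2[OF T_dx[OF c]]
      test_L2[OF T_bdq[OF D less_imp_le[OF h(1)]]] test_L2[OF T_dx[OF D]]
    have eq: "(\<lambda>p. bdq h (\<phi> n) p - dx (\<phi> n) p) = (\<lambda>p. (bdq h ?c p - dx ?c p) + (bdq h (\<phi> N) p - dx (\<phi> N) p))"
      unfolding dir_deriv_test_diff[OF D D] bdq_def by (simp add: algebra_simps)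
    have "nrm (\<lambda>p. bdq h (\<phi> n) p - dx (\<phi> n) p)
        \<le> nrm (\<lambda>p. bdq h ?c p - dx ?c p) + nrm (\<lambda>p. bdq h (\<phi> N) p - dx (\<phi> N) p)"
      unfolding eq by (intro L2_norm_triangle L2_diff L)
    also have "nrm (\<lambda>p. bdq h ?c p - dx ?c p) \<le> nrm (bdq h ?c) + nrm (dx ?c)"
      by (intro L2_norm_triangle_diff L)
    finally show ?thesis using nrm_bdq_le[OF c h] d k unfolding h_def by linarith
  qed
  with h show ?thesis by blast
qed

text \<open>Translation preserves norm and form on the whole space. The limit \<open>u\<close> means
  something only on \<open>\<Omega>\<close>, so it is extended by zero before being
  translated.\<close>

lemma fa_shift:
  assumes \<phi>: "fa \<phi> u" and h: "h \<ge> 0"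
  shows "\<exists>v. fa (\<lambda>n p. \<phi> n (p - (h, 0))) v"
proof -
  define U where "U = (\<lambda>p. indicator \<Omega> p *\<^sub>R u p)"
  have U: "U \<in> L2 lborel" unfolding U_def by (rule L2_vol_extend[OF op fa_D(1)[OF \<phi>]])
  have Um: "U \<in> borel_measurable borel" using L2_D(1)[OF U] by simp
  have shift_L2: "(\<lambda>p. f (p - (h, 0))) \<in> L2 lborel" if "f \<in> L2 lborel" for f :: "real \<times> 'b \<Rightarrow> complex"
  proof -
    have [measurable]: "f \<in> borel_measurable borel" using L2_D(1)[OF that] by simp
    have "(\<lambda>p. f (p - (h, 0))) \<in> borel_measurable lborel" by measurable
    then show ?thesis using integrable_lborel_translate[OF L2_D(2)[OF that], of "(h, 0)"] by (simp add: L2_def)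
  qed
  have d: "(\<lambda>p. \<phi> n p - U p) \<in> L2 lborel" for n by (intro L2_diff U test_L2[OF fa_D(2)[OF \<phi>]])
  have "fa (\<lambda>n p. \<phi> n (p - (h, 0))) (\<lambda>p. U (p - (h, 0)))"
  proof (rule fa_map[OF \<phi>, where C=1 and K=1])
    show "(\<lambda>p. U (p - (h, 0))) \<in> L2 (vol \<Omega>)" by (rule L2_vol[OF op shift_L2[OF U]])
    show "(\<lambda>p. \<phi> n (p - (h, 0))) \<in> T" for n by (rule T_shift[OF fa_D(2)[OF \<phi>] h])
    show "L2_norm (vol \<Omega>) (\<lambda>p. \<phi> n (p - (h, 0)) - U (p - (h, 0))) \<le> 1 * L2_norm (vol \<Omega>) (\<lambda>p. \<phi> n p - u p)" for n
    proof -
      have "L2_norm (vol \<Omega>) (\<lambda>p. \<phi> n (p - (h, 0)) - U (p - (h, 0))) \<le> nrm (\<lambda>p. \<phi> n (p - (h, 0)) - U (p - (h, 0)))"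
        by (rule L2_norm_vol_le[OF op shift_L2[OF d]])
      also have "\<dots> = nrm (\<lambda>p. \<phi> n p - U p)"
        using nrm_translate[of "\<lambda>p. \<phi> n p - U p"] L2_D(1)[OF d] by simp
      also have "\<dots> = L2_norm (vol \<Omega>) (\<lambda>p. \<phi> n p - U p)"
        by (rule L2_norm_vol[OF op, symmetric]) (simp add: U_def test_outside[OF fa_D(2)[OF \<phi>]])
      also have "\<dots> = L2_norm (vol \<Omega>) (\<lambda>p. \<phi> n p - u p)"
        unfolding L2_norm_def
        by (intro arg_cong[where f=sqrt] Bochner_Integration.integral_cong) (auto simp: U_def space_restrict_space)
      finally show ?thesis by simp
    qed
    fix m n
    let ?c = "\<lambda>p. \<phi> m p - \<phi> n p"
    have c: "?c \<in> T" by (rule test_diff[OF fa_D(2)[OF \<phi>] fa_D(2)[OF \<phi>]])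
    have "Q (\<lambda>p. ?c (p - (h, 0))) = Q ?c"
      unfolding Q_eq[OF T_shift[OF c h]] Q_eq[OF c]
    proof (rule sum.cong[OF refl])
      fix b :: "real \<times> 'b" assume b: "b \<in> Basis"
      show "(nrm (dir_deriv b (\<lambda>p. ?c (p - (h, 0)))))\<^sup>2 = (nrm (dir_deriv b ?c))\<^sup>2"
        unfolding dir_deriv_test_translate[OF c] nrm_translate[OF test_measurable[OF test_dir_deriv[OF c b]]] ..
    qed
    then show "Q (\<lambda>p. \<phi> m (p - (h, 0)) - \<phi> n (p - (h, 0))) \<le> 1 * (Q ?c + (L2_norm (vol \<Omega>) ?c)\<^sup>2)" by simp
  qed auto
  then show ?thesis by blast
qed

lemma Q_mult_wt_le:
  assumes \<phi>: "\<phi> \<in> T" and a: "a \<le> 0"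
  shows "Q (mult_wt a \<phi>) \<le> (2 + 2 * a\<^sup>2) * (Q \<phi> + (nrm \<phi>)\<^sup>2)"
proof -
  \<comment> \<open>The square of \<open>fst b\<close> is written as an iterated product so that
    \<open>sum_Basis_fst\<close> matches.\<close>
  have "Q (mult_wt a \<phi>) \<le> (\<Sum>b\<in>Basis. 2 * (nrm (dir_deriv b \<phi>))\<^sup>2 + fst b * (fst b * (2 * a\<^sup>2 * (nrm \<phi>)\<^sup>2)))"
    unfolding Q_eq[OF T_mult_wt[OF \<phi>]]
  proof (rule sum_mono)
    fix b :: "real \<times> 'b" assume b: "b \<in> Basis"
    note db = test_dir_deriv[OF \<phi> b]
    let ?f = "mult_wt a (dir_deriv b \<phi>)" and ?g = "\<lambda>p. of_real (fst b * a) * mult_wt (a - 1) \<phi> p"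
    have "nrm (dir_deriv b (mult_wt a \<phi>)) \<le> nrm ?f + nrm ?g"
      unfolding dir_deriv_mult_wt[OF \<phi> b, THEN ext]
      by (rule L2_norm_triangle[OF test_L2[OF T_mult_wt[OF db]] L2_scale[OF test_L2[OF T_mult_wt[OF \<phi>]]]])
    also have "nrm ?f \<le> nrm (dir_deriv b \<phi>)" by (rule nrm_mult_wt_le[OF db a])
    also have "nrm ?g = \<bar>fst b * a\<bar> * nrm (mult_wt (a - 1) \<phi>)" unfolding L2_norm_scale by (simp only: norm_of_real)
    also have "\<dots> \<le> \<bar>fst b * a\<bar> * nrm \<phi>" using nrm_mult_wt_le[OF \<phi>, of "a - 1"] a by (intro mult_left_mono) auto
    finally have "(nrm (dir_deriv b (mult_wt a \<phi>)))\<^sup>2 \<le> (nrm (dir_deriv b \<phi>) + \<bar>fst b * a\<bar> * nrm \<phi>)\<^sup>2"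
      by (intro power_mono) auto
    also have "\<dots> \<le> 2 * (nrm (dir_deriv b \<phi>))\<^sup>2 + 2 * (\<bar>fst b * a\<bar> * nrm \<phi>)\<^sup>2"
      using sum_squares_bound[of "nrm (dir_deriv b \<phi>)" "\<bar>fst b * a\<bar> * nrm \<phi>"] by (simp add: power2_sum)
    also have "(\<bar>fst b * a\<bar> * nrm \<phi>)\<^sup>2 = fst b * (fst b * (a\<^sup>2 * (nrm \<phi>)\<^sup>2))"
      unfolding power_mult_distrib power2_abs by (simp add: power2_eq_square mult_ac)
    finally show "(nrm (dir_deriv b (mult_wt a \<phi>)))\<^sup>2 \<le> 2 * (nrm (dir_deriv b \<phi>))\<^sup>2 + fst b * (fst b * (2 * a\<^sup>2 * (nrm \<phi>)\<^sup>2))"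
      by (simp add: mult_ac)
  qed
  also have "\<dots> = 2 * Q \<phi> + 2 * a\<^sup>2 * (nrm \<phi>)\<^sup>2"
    unfolding sum.distrib sum_Basis_fst Q_eq[OF \<phi>] by (simp add: sum_distrib_left)
  also have "\<dots> \<le> (2 + 2 * a\<^sup>2) * (Q \<phi> + (nrm \<phi>)\<^sup>2)"
    using A_nonneg[OF \<phi>] by (simp add: algebra_simps)
  finally show ?thesis .
qed

lemma mult_wt_L2_vol:
  assumes f: "f \<in> L2 (vol \<Omega>)" and a: "a \<le> 0"
  shows "mult_wt a f \<in> L2 (vol \<Omega>)" "L2_norm (vol \<Omega>) (mult_wt a f) \<le> L2_norm (vol \<Omega>) f"
proof -
  have [measurable]: "f \<in> borel_measurable (vol \<Omega>)" by (rule L2_D(1)[OF f])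
  have [measurable]: "wt a \<in> borel_measurable (vol \<Omega>)"
    by (rule measurable_restrict_space1) simp
  have m: "mult_wt a f \<in> borel_measurable (vol \<Omega>)" unfolding mult_wt_def by measurable
  have le: "cmod (mult_wt a f p) \<le> 1 * cmod (f p)" if "p \<in> space (vol \<Omega>)" for p
    using wt_le_1[OF a, of p] pos[of p] that op
    by (auto simp: mult_wt_def norm_mult space_restrict_space intro!: mult_left_le_one_le)
  show "mult_wt a f \<in> L2 (vol \<Omega>)" "L2_norm (vol \<Omega>) (mult_wt a f) \<le> L2_norm (vol \<Omega>) f"
    using L2_dominated[OF m f le] by simp_all
qed

lemma fa_mult_wt:
  assumes \<phi>: "fa \<phi> u" and a: "a \<le> 0"
  shows "fa (\<lambda>n. mult_wt a (\<phi> n)) (mult_wt a u)"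
proof (rule fa_map[OF \<phi>, where C=1 and K="2 + 2 * a\<^sup>2"])
  show "mult_wt a u \<in> L2 (vol \<Omega>)" by (rule mult_wt_L2_vol(1)[OF fa_D(1)[OF \<phi>] a])
  show "mult_wt a (\<phi> n) \<in> T" for n by (rule T_mult_wt[OF fa_D(2)[OF \<phi>]])
  show "L2_norm (vol \<Omega>) (\<lambda>p. mult_wt a (\<phi> n) p - mult_wt a u p) \<le> 1 * L2_norm (vol \<Omega>) (\<lambda>p. \<phi> n p - u p)" for n
  proof -
    have d: "(\<lambda>p. \<phi> n p - u p) \<in> L2 (vol \<Omega>)" by (intro L2_diff fa_D[OF \<phi>])
    have "(\<lambda>p. mult_wt a (\<phi> n) p - mult_wt a u p) = mult_wt a (\<lambda>p. \<phi> n p - u p)"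
      by (simp add: mult_wt_def right_diff_distrib)
    then show ?thesis using mult_wt_L2_vol(2)[OF d a] by simp
  qed
  fix m n
  let ?c = "\<lambda>p. \<phi> m p - \<phi> n p"
  have c: "?c \<in> T" by (rule test_diff[OF fa_D(2)[OF \<phi>] fa_D(2)[OF \<phi>]])
  have "(\<lambda>p. mult_wt a (\<phi> m) p - mult_wt a (\<phi> n) p) = mult_wt a ?c"
    by (simp add: mult_wt_def right_diff_distrib)
  then show "Q (\<lambda>p. mult_wt a (\<phi> m) p - mult_wt a (\<phi> n) p) \<le> (2 + 2 * a\<^sup>2) * (Q ?c + (L2_norm (vol \<Omega>) ?c)\<^sup>2)"
    using Q_mult_wt_le[OF c a] norm_vol_T[OF c] by simp
qed auto

text \<open>For fixed \<open>h\<close> the multiplier is built from translations, bounded weights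
  and linear combinations, hence yields admissible test sequences in the weak formulation.\<close>

lemma fa_multiplier:
  assumes \<phi>: "fa \<phi> u" and h: "h > 0" and \<delta>: "0 < \<delta>"
  shows "\<exists>v. fa (\<lambda>n. multiplier \<delta> h (\<phi> n)) v"
proof -
  obtain v where "fa (\<lambda>n p. \<phi> n (p - (h, 0))) v" using fa_shift[OF \<phi>, of h] h by auto
  from fa_scale[OF fa_diff[OF \<phi> this], of "of_real (1 / h)"]
  obtain d where d: "fa (\<lambda>n. bdq h (\<phi> n)) d" unfolding bdq_def by blast
  from fa_add[OF fa_scale[OF fa_diff[OF d fa_mult_wt[OF d, of "- \<delta>"]], of 2] fa_scale[OF fa_mult_wt[OF \<phi>, of "- 1 - \<delta>"], of "of_real \<delta>"]] \<delta>
  show ?thesis unfolding multiplier_def by auto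
qed

text \<open>The weight on the source is moved to the test function, leaving the unweighted norm of
  \<open>f\<close>.\<close>

lemma L2_inner_mult_wt_le:
  assumes f: "f \<in> L2 (vol \<Omega>)" and \<psi>: "\<psi> \<in> T"
  shows "cmod (L2_inner (vol \<Omega>) (mult_wt a f) \<psi>) \<le> L2_norm (vol \<Omega>) f * nrm (mult_wt a \<psi>)"
proof -
  have "L2_inner (vol \<Omega>) (mult_wt a f) \<psi> = L2_inner (vol \<Omega>) f (mult_wt a \<psi>)"
    by (simp add: L2_inner_def mult_wt_def mult_ac)
  then show ?thesis
    using cmod_L2_inner_le[OF f L2_vol[OF op test_L2[OF T_mult_wt[OF \<psi>]]]] norm_vol_T[OF T_mult_wt[OF \<psi>]] by metis
qed

text \<open>The weight commutes with \<open>w\<close>, and \<open>0 \<le> w \<le> 1\<close> on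
  \<open>\<Omega>\<close>. A full power of \<open>1 + x\<close> is given away on the derivative,
  because \<open>q_multiplier_ge\<close> controls it with the exponent
  \<open>- (1 + \<delta>) / 2\<close>.\<close>

lemma nrm_mult_wt_multiplier_le:
  assumes \<phi>: "\<phi> \<in> T" and h: "h > 0" and \<delta>: "0 < \<delta>"
  shows "nrm (mult_wt (- (3 + \<delta>) / 2) (multiplier \<delta> h \<phi>))
    \<le> 2 * nrm (mult_wt (- (1 + \<delta>) / 2) (dx \<phi>)) + 2 * nrm (\<lambda>p. bdq h \<phi> p - dx \<phi> p)
      + \<delta> * nrm (mult_wt (- (3 + \<delta>) / 2) \<phi>)"
proof -
  let ?a = "- (3 + \<delta>) / 2" and ?D = "bdq h \<phi>" and ?E = "\<lambda>p. bdq h \<phi> p - dx \<phi> p"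
  note D = T_bdq[OF \<phi> less_imp_le[OF h]]
  have E: "?E \<in> T" by (intro test_diff D T_dx \<phi>)
  let ?F = "mult_wt ?a ?D" and ?G = "mult_wt ?a \<phi>"
  have F: "?F \<in> T" and G: "?G \<in> T" by (intro T_mult_wt D \<phi>)+
  have FF: "(\<lambda>p. ?F p - mult_wt (- \<delta>) ?F p) \<in> T" by (rule test_diff[OF F T_mult_wt[OF F]])
  have eq: "mult_wt ?a (multiplier \<delta> h \<phi>) = (\<lambda>p. 2 * (?F p - mult_wt (- \<delta>) ?F p) + of_real \<delta> * mult_wt (- 1 - \<delta>) ?G p)"
    unfolding multiplier_def mult_wt_def by (rule ext) (simp add: algebra_simps)
  have "nrm (mult_wt ?a (multiplier \<delta> h \<phi>)) \<le> nrm (\<lambda>p. 2 * (?F p - mult_wt (- \<delta>) ?F p)) + nrm (\<lambda>p. of_real \<delta> * mult_wt (- 1 - \<delta>) ?G p)"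
    unfolding eq by (rule L2_norm_triangle[OF L2_scale[OF test_L2[OF FF]] L2_scale[OF test_L2[OF T_mult_wt[OF G]]]])
  moreover have "nrm (\<lambda>p. 2 * (?F p - mult_wt (- \<delta>) ?F p)) \<le> 2 * nrm ?F"
    unfolding L2_norm_scale using nrm_one_minus_wt_le[OF F, of \<delta>] \<delta> by simp
  moreover have "nrm (\<lambda>p. of_real \<delta> * mult_wt (- 1 - \<delta>) ?G p) \<le> \<delta> * nrm ?G"
    unfolding L2_norm_scale using nrm_mult_wt_le[OF G, of "- 1 - \<delta>"] \<delta> by simp
  moreover have "nrm ?F \<le> nrm (mult_wt (- (1 + \<delta>) / 2) (dx \<phi>)) + nrm ?E"
  proof -
    have eq: "?F = (\<lambda>p. mult_wt ?a (dx \<phi>) p + mult_wt ?a ?E p)"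
      by (simp add: mult_wt_def right_diff_distrib)
    have "nrm ?F \<le> nrm (mult_wt ?a (dx \<phi>)) + nrm (mult_wt ?a ?E)"
      unfolding eq by (rule L2_norm_triangle[OF test_L2[OF T_mult_wt[OF T_dx[OF \<phi>]]] test_L2[OF T_mult_wt[OF E]]])
    moreover have "nrm (mult_wt ?a (dx \<phi>)) \<le> nrm (mult_wt (- (1 + \<delta>) / 2) (dx \<phi>))"
      by (rule nrm_mult_wt_mono[OF T_dx[OF \<phi>]]) simp
    moreover have "nrm (mult_wt ?a ?E) \<le> nrm ?E" by (rule nrm_mult_wt_le[OF E]) (use \<delta> in simp)
    ultimately show ?thesis by linarith
  qed
  ultimately show ?thesis by linarith
qed


text \<open>The equation is tested with the approximating sequence itself and with its multiplier.
  All inequalities are applied to one test function \<open>\<phi> n\<close> whose residuals are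
  small, and only the weighted norm is passed to the limit.\<close>

lemma weighted_resolvent_estimate:
  assumes \<delta>: "0 < \<delta>" "\<delta> \<le> 1" and f: "f \<in> L2 (vol \<Omega>)"
    and sol: "weak_solution z u (mult_wt (- (3 + \<delta>) / 2) f)"
  shows "L2_norm (vol \<Omega>) (mult_wt (- (3 + \<delta>) / 2) u) \<le> 3 / \<delta> * (1 + sqrt (cmod z)) * L2_norm (vol \<Omega>) f"
    (is "?Nu \<le> ?c")
proof (rule field_le_epsilon)
  let ?\<rho> = "- (3 + \<delta>) / 2"
  let ?F = "mult_wt ?\<rho> f"
  define a where "a = L2_norm (vol \<Omega>) f"
  have a0: "0 \<le> a" by (simp add: a_def)
  obtain \<phi> where F: "?F \<in> L2 (vol \<Omega>)" and \<phi>: "fa \<phi> u"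
    and weak: "\<And>\<psi> v. fa \<psi> v \<Longrightarrow>
      (\<lambda>n. q (\<phi> n) (\<psi> n) - z * L2_inner (vol \<Omega>) (\<phi> n) (\<psi> n)) \<longlonglongrightarrow> L2_inner (vol \<Omega>) ?F v"
    using sol unfolding weak_solution_def by blast
  note T = fa_D(2)[OF \<phi>]
  \<comment> \<open>The source is paired with \<open>\<psi> n\<close> rather than with its limit, so
    that the estimates for test functions apply at finite \<open>n\<close>.\<close>
  have resid: "(\<lambda>n. q (\<phi> n) (\<psi> n) - z * L2_inner (vol \<Omega>) (\<phi> n) (\<psi> n) - L2_inner (vol \<Omega>) ?F (\<psi> n)) \<longlonglongrightarrow> 0"
    if \<psi>: "fa \<psi> v" for \<psi> v
  proof -
    have "(\<lambda>n. L2_inner (vol \<Omega>) ?F (\<psi> n)) \<longlonglongrightarrow> L2_inner (vol \<Omega>) ?F v"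
      by (rule L2_inner_tendsto[of "\<lambda>_. ?F"]) (use F fa_D[OF \<psi>] in \<open>auto simp: L2_norm_def\<close>)
    from tendsto_diff[OF weak[OF \<psi>] this] show ?thesis by simp
  qed
  fix \<gamma>2 :: real assume "\<gamma>2 > 0"
  \<comment> \<open>One half of the allowance pays for replacing the limit by \<open>N n\<close>,
    the other for the error in \<open>quadratic_conclusion\<close>.\<close>
  define \<gamma> where "\<gamma> = \<gamma>2 / 2"
  have \<gamma>: "\<gamma> > 0" using \<open>\<gamma>2 > 0\<close> by (simp add: \<gamma>_def)
  define \<epsilon> where "\<epsilon> = \<delta> * \<gamma>\<^sup>2 / 4"
  have "\<delta> * \<gamma>\<^sup>2 > 0" using \<delta> \<gamma> by simp
  then have \<epsilon>: "\<epsilon> > 0" "2 * \<epsilon> < \<delta> * \<gamma>\<^sup>2" by (simp_all add: \<epsilon>_def)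
  obtain B N0 where B: "\<And>n. n \<ge> N0 \<Longrightarrow> Q (\<phi> n) + (L2_norm (vol \<Omega>) (\<phi> n))\<^sup>2 \<le> B"
    using fa_bounded[OF \<phi>] by blast
  have bnd: "nrm (\<phi> n) \<le> sqrt B" "nrm (dx (\<phi> n)) \<le> sqrt B" if "n \<ge> N0" for n
    using B[OF that] dx_le_Q[OF T, of n] A_nonneg[OF T, of n] norm_vol_T[OF T, of n]
    by (auto intro!: real_le_rsqrt) (smt (verit) zero_le_power2)+
  have b0: "0 \<le> sqrt B" using bnd(1)[of N0] L2_norm_nonneg[of lborel "\<phi> N0"] by linarith
  define s where "s = sqrt (cmod z)"
  have s0: "0 \<le> s" by (simp add: s_def)
  \<comment> \<open>\<open>C\<close> collects the coefficients with which the quotient error enters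
    the final inequality; the summand 1 makes it positive.\<close>
  define C where "C = 2 * a + 2 * \<delta> * sqrt B + 2 * cmod z * sqrt B + 1"
  have C: "C > 0" unfolding C_def using a0 b0 \<delta> by (intro add_nonneg_pos add_nonneg_nonneg mult_nonneg_nonneg) auto
  define e where "e = \<epsilon> / (3 * C)"
  have e: "e > 0" "C * e = \<epsilon> / 3" using C \<epsilon> by (simp_all add: e_def)
  \<comment> \<open>The step is fixed here, before \<open>n\<close> is chosen, since the residual of
    the multiplier tends to zero only for fixed \<open>h\<close>.\<close>
  obtain h N1 where h: "0 < h" and N1: "\<And>n. n \<ge> N1 \<Longrightarrow> nrm (\<lambda>p. bdq h (\<phi> n) p - dx (\<phi> n) p) \<le> e"
    using bdq_uniform[OF \<phi> e(1)] by blast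
  obtain v where v: "fa (\<lambda>n. multiplier \<delta> h (\<phi> n)) v" using fa_multiplier[OF \<phi> h \<delta>(1)] by blast
  define r1 where "r1 = (\<lambda>n. q (\<phi> n) (\<phi> n) - z * L2_inner (vol \<Omega>) (\<phi> n) (\<phi> n) - L2_inner (vol \<Omega>) ?F (\<phi> n))"
  define r2 where "r2 = (\<lambda>n. q (\<phi> n) (multiplier \<delta> h (\<phi> n)) - z * L2_inner (vol \<Omega>) (\<phi> n) (multiplier \<delta> h (\<phi> n))
      - L2_inner (vol \<Omega>) ?F (multiplier \<delta> h (\<phi> n)))"
  define N where "N = (\<lambda>n. nrm (mult_wt ?\<rho> (\<phi> n)))"
  have fw: "fa (\<lambda>n. mult_wt ?\<rho> (\<phi> n)) (mult_wt ?\<rho> u)" by (rule fa_mult_wt[OF \<phi>]) (use \<delta> in simp)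
  have "(\<lambda>n. L2_norm (vol \<Omega>) (mult_wt ?\<rho> (\<phi> n))) \<longlonglongrightarrow> ?Nu"
    by (rule L2_norm_tendsto) (rule fa_D[OF fw])+
  then have Nlim: "N \<longlonglongrightarrow> ?Nu" unfolding N_def norm_vol_T[OF T_mult_wt[OF T]] .
  have e1: "\<forall>\<^sub>F n in sequentially. ?Nu - \<gamma> < N n"
    by (rule order_tendstoD(1)[OF Nlim]) (use \<gamma> in simp)
  have "(\<lambda>n. cmod (r1 n)) \<longlonglongrightarrow> 0" unfolding r1_def by (rule tendsto_norm_zero[OF resid[OF \<phi>]])
  \<comment> \<open>The error budget is three times \<open>\<epsilon> / 3\<close>: for
    \<open>r2\<close>, for the quotient error, and for \<open>r1\<close>, which enters twice with
    the factor \<open>s\<close>; \<open>s + 1\<close> covers \<open>s = 0\<close>.\<close>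
  then have e2: "\<forall>\<^sub>F n in sequentially. cmod (r1 n) < \<epsilon> / (6 * (s + 1))"
    by (rule order_tendstoD(2)) (use \<epsilon> s0 in simp)
  have "(\<lambda>n. cmod (r2 n)) \<longlonglongrightarrow> 0" unfolding r2_def by (rule tendsto_norm_zero[OF resid[OF v]])
  then have e3: "\<forall>\<^sub>F n in sequentially. cmod (r2 n) < \<epsilon> / 3"
    by (rule order_tendstoD(2)) (use \<epsilon> in simp)
  have e4: "\<forall>\<^sub>F n in sequentially. n \<ge> max N0 N1" by (rule eventually_ge_at_top)
  obtain n where n: "?Nu - \<gamma> < N n" "cmod (r1 n) < \<epsilon> / (6 * (s + 1))" "cmod (r2 n) < \<epsilon> / 3" "n \<ge> N0" "n \<ge> N1"
    using eventually_happens[OF eventually_conj[OF e1 eventually_conj[OF e2 eventually_conj[OF e3 e4]]]] by auto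
  let ?\<phi> = "\<phi> n" and ?\<psi> = "multiplier \<delta> h (\<phi> n)"
  let ?err = "nrm (\<lambda>p. bdq h (\<phi> n) p - dx (\<phi> n) p)"
  define X where "X = nrm (mult_wt (- (1 + \<delta>) / 2) (dx ?\<phi>))"
  define S where "S = ip ?\<phi> ?\<psi>"
  have \<psi>: "?\<psi> \<in> T" by (rule T_multiplier[OF T less_imp_le[OF h]])
  have err: "?err \<le> e" by (rule N1[OF n(5)])
  have 1: "2 * \<delta> * X\<^sup>2 - \<delta> * (1 + \<delta>) * (1 + \<delta> / 2) * (N n)\<^sup>2 - 2 * \<delta> * nrm (dx ?\<phi>) * ?err \<le> Re (q ?\<phi> ?\<psi>)"
    unfolding X_def N_def by (rule q_multiplier_ge[OF T h \<delta>(1)])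
  have 2: "Re (z * S) \<le> 2 * \<bar>Im z\<bar> * nrm ?\<phi> * nrm (dx ?\<phi>) + 2 * cmod z * nrm ?\<phi> * ?err"
    unfolding S_def by (rule ip_multiplier_bound[OF T h \<delta>(1)])
  have 3: "\<bar>Im z\<bar> * nrm ?\<phi> * nrm (dx ?\<phi>) \<le> s * (a * N n) + \<epsilon> / 6"
  proof -
    let ?P = "q ?\<phi> ?\<phi> - z * L2_inner (vol \<Omega>) ?\<phi> ?\<phi>"
    have P: "?P = of_real (Q ?\<phi>) - z * of_real ((nrm ?\<phi>)\<^sup>2)"
      by (simp only: q_self[OF T, symmetric] L2_inner_self norm_vol_T[OF T])
    have "\<bar>Im z\<bar> * nrm ?\<phi> * nrm (dx ?\<phi>) \<le> s * cmod ?P"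
      unfolding P s_def by (rule abs_Im_mult_le_energy[OF _ dx_le_Q[OF T]]) auto
    also have "\<dots> \<le> s * (cmod (r1 n) + a * N n)"
    proof (rule mult_left_mono[OF _ s0])
      have "cmod ?P \<le> cmod (r1 n) + cmod (L2_inner (vol \<Omega>) ?F ?\<phi>)"
        using norm_triangle_ineq[of "r1 n" "L2_inner (vol \<Omega>) ?F ?\<phi>"] by (simp add: r1_def)
      also have "cmod (L2_inner (vol \<Omega>) ?F ?\<phi>) \<le> a * N n"
        unfolding a_def N_def by (rule L2_inner_mult_wt_le[OF f T])
      finally show "cmod ?P \<le> cmod (r1 n) + a * N n" by simp
    qed
    also have "\<dots> = s * cmod (r1 n) + s * (a * N n)" by (rule distrib_left)
    also have "s * cmod (r1 n) \<le> (s + 1) * (\<epsilon> / (6 * (s + 1)))"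
      using s0 n(2) by (intro mult_mono) auto
    also have "\<dots> = \<epsilon> / 6" using s0 by (simp add: field_simps)
    finally show ?thesis by simp
  qed
  have 4: "Re (q ?\<phi> ?\<psi>) - Re (z * S) \<le> a * (2 * X + 2 * ?err + \<delta> * N n) + \<epsilon> / 3"
  proof -
    have S: "L2_inner (vol \<Omega>) ?\<phi> ?\<psi> = S" unfolding S_def by (rule L2_inner_vol[OF op test_outside[OF \<psi>]])
    have "q ?\<phi> ?\<psi> - z * S = r2 n + L2_inner (vol \<Omega>) ?F ?\<psi>" by (simp add: r2_def S)
    then have "Re (q ?\<phi> ?\<psi>) - Re (z * S) = Re (r2 n + L2_inner (vol \<Omega>) ?F ?\<psi>)"
      unfolding minus_complex.simps(1)[symmetric] by (rule arg_cong)
    also have "\<dots> \<le> cmod (r2 n) + cmod (L2_inner (vol \<Omega>) ?F ?\<psi>)"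
      by (rule order_trans[OF complex_Re_le_cmod norm_triangle_ineq])
    also have "cmod (L2_inner (vol \<Omega>) ?F ?\<psi>) \<le> a * nrm (mult_wt ?\<rho> ?\<psi>)"
      unfolding a_def by (rule L2_inner_mult_wt_le[OF f \<psi>])
    also have "a * nrm (mult_wt ?\<rho> ?\<psi>) \<le> a * (2 * X + 2 * ?err + \<delta> * N n)"
      unfolding X_def N_def by (rule mult_left_mono[OF nrm_mult_wt_multiplier_le[OF T h \<delta>(1)] a0])
    finally show ?thesis using n(3) by linarith
  qed
  have 5: "a * ?err \<le> a * e" by (rule mult_left_mono[OF err a0])
  have 6: "\<delta> * nrm (dx ?\<phi>) * ?err \<le> \<delta> * sqrt B * e"
    using \<delta> b0 err bnd(2)[OF n(4)] by (intro mult_mono) auto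
  have 7: "cmod z * nrm ?\<phi> * ?err \<le> cmod z * sqrt B * e"
    using b0 err bnd(1)[OF n(4)] by (intro mult_mono) auto
  have 8: "a * (2 * X + 2 * ?err + \<delta> * N n) = a * (2 * X + \<delta> * N n) + 2 * (a * ?err)" by (simp add: algebra_simps)
  have 9: "a * (2 * X + \<delta> * N n + 2 * s * N n) = a * (2 * X + \<delta> * N n) + 2 * (s * (a * N n))" by (simp add: algebra_simps)
  have "C * e = 2 * (a * e) + 2 * (\<delta> * sqrt B * e) + 2 * (cmod z * sqrt B * e) + e"
    by (simp add: C_def algebra_simps)
  then have 10: "2 * (a * e) + 2 * (\<delta> * sqrt B * e) + 2 * (cmod z * sqrt B * e) \<le> \<epsilon> / 3" using e by linarith
  have main: "2 * \<delta> * X\<^sup>2 - \<delta> * (1 + \<delta>) * (1 + \<delta> / 2) * (N n)\<^sup>2 \<le> a * (2 * X + \<delta> * N n + 2 * s * N n) + \<epsilon>"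
    using 1 2 3 4 5 6 7 10 unfolding 8 9 unfolding mult.assoc[of 2] by linarith
  have "N n \<le> 3 / \<delta> * (1 + s) * a + \<gamma>"
    by (rule quadratic_conclusion[OF \<delta> a0 s0 _ \<gamma> _ main \<epsilon>(2)])
      (use hardy[OF T \<delta>(1)] in \<open>auto simp: N_def X_def\<close>)
  then show "?Nu \<le> ?c + \<gamma>2" using n(1) unfolding s_def a_def \<gamma>_def by simp
qed

end

section \<open>Invariance under forward translations\<close>

text \<open>The part of \<open>w\<close> orthogonal to \<open>n\<close> lies on the edge of the
  half-space. Tilted slightly inwards it becomes an admissible \<open>v\<close>, and testing with it
  forces this part to vanish.\<close>

lemma eq_scaleR_if_halfspace_nonpos:
  fixes w n :: "'a::real_inner"
  assumes n: "norm n = 1" and le: "\<And>v. v \<bullet> n < 0 \<Longrightarrow> w \<bullet> v \<le> 0"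
  shows "w = norm w *\<^sub>R n"
proof -
  have nn: "n \<bullet> n = 1" using n by (simp add: norm_eq_1)
  have 0: "0 \<le> w \<bullet> n" using le[of "- n"] nn by simp
  have "w \<bullet> w - (w \<bullet> n)\<^sup>2 \<le> \<epsilon> * (w \<bullet> n)" if "\<epsilon> > 0" for \<epsilon>
  proof -
    have "w \<bullet> (w - (w \<bullet> n) *\<^sub>R n - \<epsilon> *\<^sub>R n) \<le> 0"
      by (rule le) (use that nn in \<open>simp add: inner_diff_left\<close>)
    then show ?thesis by (simp add: inner_diff_right power2_eq_square)
  qed
  note bound = this
  have "w \<bullet> w - (w \<bullet> n)\<^sup>2 \<le> 0"
  proof (rule ccontr)
    \<comment> \<open>The choice \<open>\<epsilon> = ?X / ?c\<close> in the bound contradicts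
      \<open>?X > 0\<close>, because \<open>w \<bullet> n < ?c\<close>; the added 1 keeps
      \<open>?c\<close> positive.\<close>
    let ?X = "w \<bullet> w - (w \<bullet> n)\<^sup>2" and ?c = "w \<bullet> n + 1"
    assume "\<not> ?X \<le> 0"
    then have X: "?X > 0" by simp
    then have "?X \<le> ?X / ?c * (w \<bullet> n)" using 0 by (intro bound) simp
    then have "?X * ?c \<le> ?X * (w \<bullet> n)" using 0 by (simp add: pos_le_divide_eq)
    then show False using X by (simp add: distrib_left)
  qed
  moreover have "(norm (w - (w \<bullet> n) *\<^sub>R n))\<^sup>2 = w \<bullet> w - (w \<bullet> n)\<^sup>2"
    unfolding power2_norm_eq_inner using nn
    by (simp add: inner_diff_left inner_diff_right inner_commute power2_eq_square)
  ultimately have "(norm (w - (w \<bullet> n) *\<^sub>R n))\<^sup>2 \<le> 0" by linarith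
  then have eq: "w = (w \<bullet> n) *\<^sub>R n" by simp
  then have "norm w = w \<bullet> n" using n 0 by (metis abs_of_nonneg mult.right_neutral norm_scaleR)
  then show ?thesis using eq by simp
qed

section \<open>Normals at points touched by an interior ball\<close>

lemma power2_norm_scaleR_add:
  fixes n w :: "'a::real_inner"
  assumes "norm n = 1"
  shows "(norm (r *\<^sub>R n + w))\<^sup>2 = r\<^sup>2 + 2 * r * (n \<bullet> w) + (norm w)\<^sup>2"
proof -
  have "n \<bullet> n = 1" using assms by (simp add: norm_eq_1)
  then show ?thesis unfolding power2_norm_eq_inner
    by (simp add: inner_add_left inner_add_right inner_commute power2_eq_square)
qed

text \<open>If \<open>G q > q \<bullet> e\<close>, continuity keeps a neighbourhood outside
  \<open>\<Omega>\<close>; if \<open>G q < q \<bullet> e\<close>, then \<open>q\<close> lies in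
  \<open>\<Omega>\<close>. A frontier point of an open set admits neither.\<close>

lemma epigraph_near_frontier:
  assumes "open \<Omega>" "q \<in> frontier \<Omega>" "epigraph_near \<Omega> q e G" "isCont G q"
  shows "G q = q \<bullet> e"
proof -
  obtain U where U: "open U" "q \<in> U" "\<And>y. y \<in> U \<Longrightarrow> y \<in> \<Omega> \<longleftrightarrow> G y < y \<bullet> e"
    using assms(3) by (auto simp: epigraph_near_def)
  have qn: "q \<notin> \<Omega>" and qc: "q \<in> closure \<Omega>"
    using assms(1,2) by (auto simp: frontier_def interior_open)
  have "\<not> G q > q \<bullet> e"
  proof
    assume "G q > q \<bullet> e"
    moreover have "isCont (\<lambda>y. G y - y \<bullet> e) q" using assms(4) by (intro continuous_intros)
    ultimately have "\<forall>\<^sub>F y in nhds q. 0 < G y - y \<bullet> e"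
      by (intro order_tendstoD(1)[where y="G q - q \<bullet> e"]) (auto simp: isCont_def tendsto_nhds_iff continuous_at)
    then obtain V where V: "open V" "q \<in> V" "\<And>y. y \<in> V \<Longrightarrow> 0 < G y - y \<bullet> e"
      by (auto simp: eventually_nhds)
    have "open (U \<inter> V)" "q \<in> U \<inter> V" using U V by auto
    then have "U \<inter> V \<inter> \<Omega> \<noteq> {}" using qc open_Int_closure_eq_empty[of "U \<inter> V" \<Omega>] by auto
    then show False using U V by force
  qed
  then show ?thesis using U(2,3) qn by force
qed

text \<open>Relative to the centre the squared distance is
  \<open>r^2 + 2 r t (v \<bullet> n) + t^2 |v|^2\<close>; for small \<open>t > 0\<close> the
  negative linear term dominates.\<close>

lemma interior_ball_direction:
  fixes q :: "'a::real_inner"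
  assumes "norm n = 1" "r > 0" "v \<bullet> n < 0"
  shows "\<exists>d>0. \<forall>t. 0 < t \<and> t < d \<longrightarrow> q + t *\<^sub>R v \<in> ball (q - r *\<^sub>R n) r"
proof (intro exI conjI allI impI)
  have v0: "v \<noteq> 0" using assms(3) by auto
  let ?d = "2 * r * - (v \<bullet> n) / (norm v)\<^sup>2"
  show "?d > 0" using assms v0 by (intro divide_pos_pos mult_pos_pos) auto
  fix t :: real assume t: "0 < t \<and> t < ?d"
  then have "t < 2 * r * - (v \<bullet> n) / (norm v)\<^sup>2" by blast
  then have "t * (norm v)\<^sup>2 < 2 * r * - (v \<bullet> n)"
    using v0 pos_less_divide_eq[of "(norm v)\<^sup>2" t "2 * r * - (v \<bullet> n)"] by simp
  then have "t * (t * (norm v)\<^sup>2) < t * (2 * r * - (v \<bullet> n))" using t by (intro mult_strict_left_mono) auto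
  moreover have "(norm (r *\<^sub>R n + t *\<^sub>R v))\<^sup>2 = r\<^sup>2 + 2 * r * t * (v \<bullet> n) + t * (t * (norm v)\<^sup>2)"
    unfolding power2_norm_scaleR_add[OF assms(1)]
    by (simp add: inner_commute[of n] power_mult_distrib power2_eq_square)
  ultimately have "(norm (r *\<^sub>R n + t *\<^sub>R v))\<^sup>2 < r\<^sup>2" by (simp add: algebra_simps)
  then have "norm (r *\<^sub>R n + t *\<^sub>R v) < r" by (rule power2_less_imp_less) (use assms in simp)
  moreover have "dist (q - r *\<^sub>R n) (q + t *\<^sub>R v) = norm (r *\<^sub>R n + t *\<^sub>R v)"
    unfolding dist_norm by (subst norm_minus_commute) (simp add: add.commute)
  ultimately show "q + t *\<^sub>R v \<in> ball (q - r *\<^sub>R n) r" by simp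
qed

text \<open>Directions with \<open>v \<bullet> n < 0\<close> enter the ball and hence
  \<open>\<Omega>\<close>, where \<open>G y - y \<bullet> e\<close> is negative. Its gradient
  \<open>D - e\<close> is therefore nonpositive on a half-space, so a multiple of
  \<open>n\<close>.\<close>

lemma normal_eq_if_gderiv:
  assumes "open \<Omega>" "q \<in> frontier \<Omega>" "epigraph_near \<Omega> q e G" "GDERIV G q :> D"
    and n: "norm n = 1" "r > 0" "ball (q - r *\<^sub>R n) r \<subseteq> \<Omega>"
  shows "n = (1 / norm (D - e)) *\<^sub>R (D - e)"
proof -
  obtain U where U: "open U" "q \<in> U" "\<And>y. y \<in> U \<Longrightarrow> y \<in> \<Omega> \<longleftrightarrow> G y < y \<bullet> e"
    and e: "norm e = 1" and inv: "\<And>y t. G (y + t *\<^sub>R e) = G y"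
    using assms(3) by (auto simp: epigraph_near_def)
  have GD: "(G has_derivative (\<lambda>h. h \<bullet> D)) (at q)" using assms(4) by (simp add: gderiv_def)
  have Gq: "G q = q \<bullet> e"
    by (rule epigraph_near_frontier[OF assms(1-3)]) (rule has_derivative_continuous[OF GD])
  have line: "((\<lambda>t. G (q + t *\<^sub>R v) - (q + t *\<^sub>R v) \<bullet> e) has_real_derivative (D - e) \<bullet> v) (at 0)" for v
  proof -
    have "((\<lambda>t. q + t *\<^sub>R v) has_derivative (\<lambda>t. t *\<^sub>R v)) (at 0)"
      by (auto intro!: derivative_eq_intros)
    from has_derivative_compose[OF this, of G "\<lambda>h. h \<bullet> D"] GD
    have 1: "((\<lambda>t. G (q + t *\<^sub>R v)) has_derivative (\<lambda>t. (t *\<^sub>R v) \<bullet> D)) (at 0)" by simp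
    have 2: "((\<lambda>t. (q + t *\<^sub>R v) \<bullet> e) has_derivative (\<lambda>t. (t *\<^sub>R v) \<bullet> e)) (at 0)"
      by (auto intro!: derivative_eq_intros)
    show ?thesis
      unfolding has_field_derivative_def
      by (rule has_derivative_eq_rhs[OF has_derivative_diff[OF 1 2]])
        (auto simp: fun_eq_iff inner_diff_left inner_commute[of v] algebra_simps)
  qed
  have "((\<lambda>t. G (q + t *\<^sub>R e) - (q + t *\<^sub>R e) \<bullet> e) has_real_derivative - 1) (at 0)"
    using e by (auto simp: inv inner_add_left norm_eq_1 intro!: derivative_eq_intros)
  \<comment> \<open>\<open>G\<close> is constant along \<open>e\<close>, so only the linear part
    contributes; the gradient can thus be normalized.\<close>
  then have "(D - e) \<bullet> e = - 1" using DERIV_unique[OF line[of e]] by simp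
  then have ne: "D - e \<noteq> 0" by auto
  have "(D - e) \<bullet> v \<le> 0" if v: "v \<bullet> n < 0" for v
  proof (rule ccontr)
    assume "\<not> (D - e) \<bullet> v \<le> 0"
    then have "(D - e) \<bullet> v > 0" by simp
    from DERIV_pos_inc_right[OF line this] Gq obtain d1 where d1: "d1 > 0"
      "\<And>t. 0 < t \<Longrightarrow> t < d1 \<Longrightarrow> 0 < G (q + t *\<^sub>R v) - (q + t *\<^sub>R v) \<bullet> e" by auto
    obtain d2 where d2: "d2 > 0" "\<And>t. 0 < t \<Longrightarrow> t < d2 \<Longrightarrow> q + t *\<^sub>R v \<in> ball (q - r *\<^sub>R n) r"
      using interior_ball_direction[OF n(1,2) v, of q] by blast
    have "isCont (\<lambda>t. q + t *\<^sub>R v) 0" by (intro continuous_intros)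
    then have "\<forall>\<^sub>F t in nhds 0. q + t *\<^sub>R v \<in> U"
      using topological_tendstoD[of "\<lambda>t. q + t *\<^sub>R v" "q + 0 *\<^sub>R v" "nhds 0" U] U
      by (simp add: continuous_at tendsto_nhds_iff isCont_def)
    then obtain d3 where d3: "d3 > 0" "\<And>t. \<bar>t\<bar> < d3 \<Longrightarrow> q + t *\<^sub>R v \<in> U"
      by (auto simp: eventually_nhds_metric dist_real_def)
    define t where "t = min d1 (min d2 d3) / 2"
    have t: "0 < t" "t < d1" "t < d2" "\<bar>t\<bar> < d3" using d1 d2 d3 by (auto simp: t_def)
    show False
      using d1(2)[OF t(1,2)] U(3)[OF d3(2)[OF t(4)]] d2(2)[OF t(1,3)] n(3) by auto
  qed
  from eq_scaleR_if_halfspace_nonpos[OF n(1) this]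
  have "D - e = norm (D - e) *\<^sub>R n" .
  then have "(1 / norm (D - e)) *\<^sub>R (D - e) = (1 / norm (D - e)) *\<^sub>R (norm (D - e) *\<^sub>R n)" by metis
  then show ?thesis using ne by simp
qed

text \<open>The gradient of \<open>G\<close> is Lipschitz, but \<open>G\<close> itself may grow
  quadratically, whereas \<open>outward_unit_normal\<close> asks for a globally Lipschitz function.
  So \<open>G\<close> is modified away from \<open>q\<close>.\<close>

lemma C11_boundary_normal:
  fixes \<Omega> :: "'a::euclidean_space set"
  assumes "open \<Omega>" "q \<in> frontier \<Omega>" "C11_boundary_at \<Omega> q"
    and n: "norm n = 1" "r > 0" "ball (q - r *\<^sub>R n) r \<subseteq> \<Omega>"
  shows "outward_unit_normal \<Omega> q n"
proof -
  obtain e G D L where epi: "epigraph_near \<Omega> q e G" and der: "\<And>y. GDERIV G y :> D y"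
    and D: "L-lipschitz_on UNIV D"
    using assms(3) by (auto simp: C11_boundary_at_def)
  obtain U where U: "open U" "q \<in> U" "\<And>y. y \<in> U \<Longrightarrow> y \<in> \<Omega> \<longleftrightarrow> G y < y \<bullet> e"
    and e: "norm e = 1" and inv: "\<And>y t. G (y + t *\<^sub>R e) = G y"
    using epi by (auto simp: epigraph_near_def)
  have ee: "e \<bullet> e = 1" using e by (simp add: norm_eq_1)
  define P where "P = (\<lambda>y. y - (y \<bullet> e) *\<^sub>R e)"
  have P_inv: "P (y + t *\<^sub>R e) = P y" for y t using ee by (simp add: P_def inner_add_left algebra_simps)
  have GP: "G (P y) = G y" for y using inv[of y "- (y \<bullet> e)"] by (simp add: P_def)
  have P_le: "norm (P x - P y) \<le> norm (x - y)" for x y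
  proof (rule power2_le_imp_le)
    have "(norm (P x - P y))\<^sup>2 = (norm (x - y))\<^sup>2 - ((x - y) \<bullet> e)\<^sup>2"
      unfolding P_def power2_norm_eq_inner
      using ee by (simp add: inner_diff_left inner_diff_right inner_commute algebra_simps power2_eq_square)
    then show "(norm (P x - P y))\<^sup>2 \<le> (norm (x - y))\<^sup>2" by simp
  qed simp
  let ?B = "cball (P q) 1"
  \<comment> \<open>Projecting along \<open>e\<close> keeps the invariance; retracting to a unit
    ball, where the gradient is bounded by \<open>K\<close>, makes \<open>H\<close> Lipschitz. Near
    \<open>q\<close> it agrees with \<open>G\<close>.\<close>
  define H where "H = (\<lambda>y. G (closest_point ?B (P y)))"
  have HG: "H y = G y" if "y \<in> ball q 1" for y
  proof -
    have "P y \<in> ?B" using that P_le[of q y] by (simp add: dist_norm)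
    then show ?thesis by (simp add: H_def closest_point_self GP)
  qed
  define K where "K = norm (D (P q)) + L"
  have L0: "L \<ge> 0" using D by (rule lipschitz_on_nonneg)
  have GK: "norm (G x - G y) \<le> K * norm (x - y)" if "x \<in> ?B" "y \<in> ?B" for x y
  proof (rule differentiable_bound[of ?B G "\<lambda>y h. h \<bullet> D y"])
    show "(G has_derivative (\<lambda>h. h \<bullet> D y)) (at y within ?B)" if "y \<in> ?B" for y
      using der[of y] has_derivative_at_withinI unfolding gderiv_def by blast
    show "onorm (\<lambda>h. h \<bullet> D y) \<le> K" if "y \<in> ?B" for y
    proof (rule onorm_le)
      have "norm (D y) \<le> norm (D (P q)) + dist (D y) (D (P q))"
        using norm_triangle_ineq2[of "D y" "D (P q)"] by (simp add: dist_norm)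
      also have "dist (D y) (D (P q)) \<le> L * dist y (P q)" using lipschitz_onD[OF D] by simp
      also have "\<dots> \<le> L * 1" using that L0 by (intro mult_left_mono) (auto simp: dist_commute)
      finally have "norm (D y) \<le> K" by (simp add: K_def)
      then show "norm (h \<bullet> D y) \<le> K * norm h" for h
        using Cauchy_Schwarz_ineq2[of h "D y"] mult_left_mono[of "norm (D y)" K "norm h"] by (simp add: mult.commute)
    qed
  qed (use that in auto)
  have "K-lipschitz_on UNIV H"
  proof (rule lipschitz_onI)
    fix x y
    have ne: "?B \<noteq> {}" by simp
    have "dist (H x) (H y) \<le> K * norm (closest_point ?B (P x) - closest_point ?B (P y))"
      unfolding H_def dist_norm
      by (rule GK) (rule closest_point_in_set[OF closed_cball ne])+
    also have "\<dots> \<le> K * norm (x - y)"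
      using closest_point_lipschitz[OF convex_cball closed_cball ne, of "P x" "P y"] P_le[of x y] L0
      by (intro mult_left_mono) (auto simp: dist_norm K_def)
    finally show "dist (H x) (H y) \<le> K * dist x y" by (simp add: dist_norm)
  qed (use L0 in \<open>simp add: K_def\<close>)
  moreover have epiH: "epigraph_near \<Omega> q e H"
    unfolding epigraph_near_def
  proof (intro conjI allI e)
    show "H (y + t *\<^sub>R e) = H y" for y t by (simp add: H_def P_inv)
    show "\<exists>U. open U \<and> q \<in> U \<and> (\<forall>y\<in>U. (y \<in> \<Omega>) = (H y < y \<bullet> e))"
      by (rule exI[of _ "U \<inter> ball q 1"]) (use U HG in auto)
  qed
  moreover have derH: "GDERIV H q :> D q"
    using der[of q] has_derivative_transform_within_open[of G _ q UNIV "ball q 1" H] HG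
    by (auto simp: gderiv_def)
  moreover have "n = (1 / norm (D q - e)) *\<^sub>R (D q - e)"
    by (rule normal_eq_if_gderiv[OF assms(1,2) epiH derH n])
  ultimately show ?thesis using assms(2) unfolding outward_unit_normal_def by blast
qed

text \<open>Near \<open>q\<close> the graph of \<open>G\<close> is squeezed between a supporting
  hyperplane of the convex piece and the touching sphere. These are tangent at \<open>q\<close>, so
  \<open>G\<close> is differentiable there.\<close>

lemma convex_boundary_normal:
  fixes \<Omega> :: "'a::euclidean_space set"
  assumes "open \<Omega>" "q \<in> frontier \<Omega>" "epigraph_near \<Omega> q e G" "L-lipschitz_on UNIV G"
    and W: "open W" "q \<in> W" "convex (W \<inter> \<Omega>)"
    and n: "norm n = 1" "r > 0" "ball (q - r *\<^sub>R n) r \<subseteq> \<Omega>"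
  shows "outward_unit_normal \<Omega> q n"
proof -
  obtain U where U: "open U" "q \<in> U" "\<And>y. y \<in> U \<Longrightarrow> y \<in> \<Omega> \<longleftrightarrow> G y < y \<bullet> e"
    and e: "norm e = 1" and inv: "\<And>y t. G (y + t *\<^sub>R e) = G y"
    using assms(3) by (auto simp: epigraph_near_def)
  have Gc: "isCont G q" using lipschitz_on_continuous_on[OF assms(4)] by (simp add: continuous_on_eq_continuous_at)
  have Gq: "G q = q \<bullet> e" by (rule epigraph_near_frontier[OF assms(1-3) Gc])
  have qn: "q \<notin> \<Omega>" using assms(1,2) by (simp add: frontier_def interior_open)
  obtain \<rho> where \<rho>: "\<rho> > 0" "ball q \<rho> \<subseteq> U \<inter> W"
    using open_contains_ball[of "U \<inter> W"] open_Int[OF U(1) W(1)] U(2) W(2) by blast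
  have "W \<inter> \<Omega> \<noteq> {}"
    using open_Int_closure_eq_empty[of W \<Omega>] W assms(2) by (auto simp: frontier_def)
  \<comment> \<open>The separating hyperplane supports the convex piece at \<open>q\<close>; the
    interior ball will force \<open>a\<close> to be a multiple of \<open>n\<close>.\<close>
  then obtain a b where a: "a \<noteq> 0" "\<And>x. x \<in> W \<inter> \<Omega> \<Longrightarrow> a \<bullet> x \<le> b" "a \<bullet> q \<ge> b"
    using separating_hyperplane_sets[OF W(3) convex_singleton[of q]] qn by blast
  have small: "\<exists>d>0. \<forall>t. 0 < t \<and> t < d \<longrightarrow> q + t *\<^sub>R v \<in> ball q \<rho>" for v
  proof (intro exI conjI allI impI)
    show "\<rho> / (norm v + 1) > 0" using \<rho> by (intro divide_pos_pos) (auto intro: add_nonneg_pos)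
    fix t assume t: "0 < t \<and> t < \<rho> / (norm v + 1)"
    then have "t * (norm v + 1) < \<rho>" by (simp add: pos_less_divide_eq add_nonneg_pos)
    then have "t * norm v < \<rho>" using t by (simp add: distrib_left)
    then show "q + t *\<^sub>R v \<in> ball q \<rho>" using t by (simp add: dist_norm)
  qed
  have "a \<bullet> v \<le> 0" if v: "v \<bullet> n < 0" for v
  proof -
    obtain d1 where d1: "d1 > 0" "\<And>t. 0 < t \<Longrightarrow> t < d1 \<Longrightarrow> q + t *\<^sub>R v \<in> ball (q - r *\<^sub>R n) r"
      using interior_ball_direction[OF n(1,2) v, of q] by blast
    obtain d2 where d2: "d2 > 0" "\<And>t. 0 < t \<Longrightarrow> t < d2 \<Longrightarrow> q + t *\<^sub>R v \<in> ball q \<rho>"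
      using small by blast
    define t where "t = min d1 d2 / 2"
    have t: "0 < t" "t < d1" "t < d2" using d1 d2 by (auto simp: t_def)
    have "q + t *\<^sub>R v \<in> W \<inter> \<Omega>" using d1(2)[OF t(1,2)] d2(2)[OF t(1,3)] n(3) \<rho> by auto
    then have "a \<bullet> (q + t *\<^sub>R v) \<le> a \<bullet> q" using a order_trans by blast
    then have "t * (a \<bullet> v) \<le> 0" by (simp add: inner_add_right)
    then show ?thesis using t by (simp add: mult_le_0_iff)
  qed
  from eq_scaleR_if_halfspace_nonpos[OF n(1) this] have an: "a = norm a *\<^sub>R n" .
  have le: "n \<bullet> (x - q) \<le> 0" if "x \<in> W \<inter> \<Omega>" for x
  proof -
    have "a \<bullet> (x - q) \<le> 0" using a(2)[OF that] a(3) by (simp add: inner_diff_right)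
    then have "norm a * (n \<bullet> (x - q)) \<le> 0" by (subst (asm) an) simp
    then show ?thesis using a(1) by (simp add: mult_le_0_iff)
  qed
  \<comment> \<open>Openness makes the inequality strict: a point attaining equality could be pushed
    along \<open>n\<close> within the set.\<close>
  have lt: "n \<bullet> (x - q) < 0" if x: "x \<in> W \<inter> \<Omega>" for x
  proof -
    have "open (W \<inter> \<Omega>)" using W(1) assms(1) by auto
    then obtain s where s: "s > 0" "cball x s \<subseteq> W \<inter> \<Omega>" using x open_contains_cball by blast
    have "x + s *\<^sub>R n \<in> cball x s" using n s by (simp add: dist_norm)
    then have "n \<bullet> (x + s *\<^sub>R n - q) \<le> 0" using s le by blast
    then have "n \<bullet> (x - q) + s \<le> 0" using n(1) by (simp add: inner_diff_right inner_add_right norm_eq_1)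
    then show ?thesis using s by simp
  qed
  have ne: "n \<bullet> e < 0"
  proof -
    obtain d where d: "d > 0" "\<And>t. 0 < t \<Longrightarrow> t < d \<Longrightarrow> q + t *\<^sub>R e \<in> ball q \<rho>" using small by blast
    have m: "q + (d/2) *\<^sub>R e \<in> ball q \<rho>" using d(1) by (intro d(2)) auto
    have "q + (d/2) *\<^sub>R e \<in> \<Omega>"
      using U(3)[of "q + (d/2) *\<^sub>R e"] m \<rho> d(1) e inv Gq by (auto simp: inner_add_left norm_eq_1)
    then have "n \<bullet> (q + (d/2) *\<^sub>R e - q) < 0" using m \<rho> by (intro lt) auto
    then show ?thesis using d(1) by (simp add: mult_less_0_iff)
  qed
  \<comment> \<open>Gradient of the function whose graph in direction \<open>e\<close> is the
    supporting hyperplane; \<open>D - e\<close> is a positive multiple of \<open>n\<close>.\<close>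
  define D where "D = e - (1 / (n \<bullet> e)) *\<^sub>R n"
  define c where "c = - (n \<bullet> e)"
  have c: "c > 0" using ne by (simp add: c_def)
  have t0: "q \<bullet> e + (y - q) \<bullet> D = y \<bullet> e + (n \<bullet> (y - q)) / c" for y
    using ne by (simp add: D_def c_def inner_diff_left inner_diff_right inner_commute field_simps)
  have t0_le: "\<bar>(n \<bullet> (y - q)) / c\<bar> \<le> norm (y - q) / c" for y
    using Cauchy_Schwarz_ineq2[of n "y - q"] n c by (simp add: divide_right_mono)
  have "(G has_derivative (\<lambda>h. h \<bullet> D)) (at q)"
    unfolding has_derivative_at_alt
  proof (intro conjI allI impI)
    show "bounded_linear (\<lambda>h. h \<bullet> D)" by (rule bounded_linear_inner_left)
    fix \<epsilon> :: real assume \<epsilon>: "\<epsilon> > 0"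
    define M where "M = 1 + 1 / c + \<epsilon>"
    have M: "M > 0" "M \<ge> 1 + 1 / c" using c \<epsilon> by (auto simp: M_def add_pos_pos)
    \<comment> \<open>\<open>M * norm (y - q)\<close> bounds the distance from \<open>q\<close> of
      the raised points considered below. The first entry keeps them in
      \<open>ball q \<rho>\<close>, the second makes the quadratic term of the sphere smaller than
      its linear gain.\<close>
    define d where "d = min (\<rho> / M) (2 * r * \<epsilon> * c / M\<^sup>2)"
    have d: "d > 0" using \<rho> M n(2) \<epsilon> c by (auto simp: d_def)
    have "norm (G y - G q - (y - q) \<bullet> D) \<le> \<epsilon> * norm (y - q)" if y: "norm (y - q) < d" for y
    proof (cases "y = q")
      case False
      let ?N = "norm (y - q)"
      have N: "?N > 0" using False by simp
      have N1: "M * ?N < \<rho>"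
        using y M by (simp add: d_def pos_less_divide_eq mult.commute)
      have N2: "M\<^sup>2 * ?N < 2 * r * \<epsilon> * c"
        using y M by (simp add: d_def pos_less_divide_eq mult.commute)
      \<comment> \<open>Height of the hyperplane over \<open>y\<close> in direction
        \<open>e\<close>.\<close>
      define s where "s = (n \<bullet> (y - q)) / c"
      have s: "\<bar>s\<bar> \<le> ?N / c" unfolding s_def by (rule t0_le)
      have w_le: "norm (y + t *\<^sub>R e - q) \<le> M * ?N" if "\<bar>t - s\<bar> \<le> \<epsilon> * ?N" for t
      proof -
        have "norm ((y - q) + t *\<^sub>R e) \<le> ?N + \<bar>t\<bar>" using norm_triangle_ineq[of "y - q" "t *\<^sub>R e"] e by simp
        also have "\<bar>t\<bar> \<le> \<bar>s\<bar> + \<epsilon> * ?N" using that by linarith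
        also have "?N + (\<bar>s\<bar> + \<epsilon> * ?N) \<le> M * ?N" using s by (simp add: M_def algebra_simps)
        finally show ?thesis by (simp add: algebra_simps)
      qed
      have inball: "y + t *\<^sub>R e \<in> ball q \<rho>" if "\<bar>t - s\<bar> \<le> \<epsilon> * ?N" for t
        using w_le[OF that] N1 by (simp add: dist_norm norm_minus_commute)
      have nw: "n \<bullet> (y + t *\<^sub>R e - q) = c * (s - t)" for t
        using c by (simp add: s_def c_def inner_add_right inner_diff_right right_diff_distrib field_simps)
      \<comment> \<open>Otherwise the point of the hyperplane over \<open>y\<close> would belong to
        \<open>\<Omega>\<close>, against \<open>lt\<close>.\<close>
      have lower: "G y \<ge> y \<bullet> e + s"
      proof (rule ccontr)
        assume "\<not> G y \<ge> y \<bullet> e + s"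
        then have "G (y + s *\<^sub>R e) < (y + s *\<^sub>R e) \<bullet> e" using inv e by (simp add: inner_add_left norm_eq_1)
        moreover have "y + s *\<^sub>R e \<in> ball q \<rho>" by (rule inball) (use \<epsilon> N in simp)
        ultimately have "y + s *\<^sub>R e \<in> W \<inter> \<Omega>" using U(3) \<rho> by auto
        from lt[OF this] show False unfolding nw by simp
      qed
      \<comment> \<open>Raised by \<open>\<epsilon> * ?N\<close> above the hyperplane, the point
        lies inside the touching ball and hence in \<open>\<Omega>\<close>.\<close>
      have upper: "G y < y \<bullet> e + (s + \<epsilon> * ?N)"
      proof -
        let ?t = "s + \<epsilon> * ?N"
        let ?w = "y + ?t *\<^sub>R e - q"
        have in1: "y + ?t *\<^sub>R e \<in> ball q \<rho>" by (rule inball) (use \<epsilon> N in simp)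
        have w: "norm ?w \<le> M * ?N" by (rule w_le) (use \<epsilon> N in simp)
        have "(norm (r *\<^sub>R n + ?w))\<^sup>2 = r\<^sup>2 + 2 * r * (n \<bullet> ?w) + (norm ?w)\<^sup>2"
          by (rule power2_norm_scaleR_add[OF n(1)])
        also have "n \<bullet> ?w = - (c * \<epsilon> * ?N)" unfolding nw by simp
        also have "(norm ?w)\<^sup>2 \<le> (M * ?N)\<^sup>2" by (rule power_mono[OF w]) simp
        also have "(M * ?N)\<^sup>2 = (M\<^sup>2 * ?N) * ?N" by (simp add: power2_eq_square)
        also have "(M\<^sup>2 * ?N) * ?N < (2 * r * \<epsilon> * c) * ?N" by (rule mult_strict_right_mono[OF N2 N])
        finally have "(norm (r *\<^sub>R n + ?w))\<^sup>2 < r\<^sup>2" by (simp add: mult_ac)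
        then have "norm (r *\<^sub>R n + ?w) < r" by (rule power2_less_imp_less) (use n in simp)
        moreover have "dist (q - r *\<^sub>R n) (y + ?t *\<^sub>R e) = norm (r *\<^sub>R n + ?w)"
          unfolding dist_norm by (subst norm_minus_commute) (simp add: algebra_simps)
        ultimately have "y + ?t *\<^sub>R e \<in> \<Omega>" using n(3) by auto
        then have "G (y + ?t *\<^sub>R e) < (y + ?t *\<^sub>R e) \<bullet> e" using U(3) in1 \<rho> by auto
        then show ?thesis using inv e by (simp add: inner_add_left norm_eq_1)
      qed
      have "G y - G q - (y - q) \<bullet> D = G y - (y \<bullet> e + s)"
        using t0[of y] Gq by (simp add: s_def)
      then show ?thesis using lower upper by simp
    qed simp
    then show "\<exists>d>0. \<forall>y. norm (y - q) < d \<longrightarrow> norm (G y - G q - (y - q) \<bullet> D) \<le> \<epsilon> * norm (y - q)"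
      using d by blast
  qed
  then have der: "GDERIV G q :> D" by (simp add: gderiv_def)
  then have "n = (1 / norm (D - e)) *\<^sub>R (D - e)"
    by (rule normal_eq_if_gderiv[OF assms(1-3) _ n])
  then show ?thesis using assms(2-4) der unfolding outward_unit_normal_def by blast
qed

text \<open>An interior touching ball makes the boundary differentiable at the point of contact,
  so no almost-everywhere differentiability of the boundary is needed.\<close>

lemma interior_ball_outward_unit_normal:
  fixes \<Omega> :: "'a::euclidean_space set"
  assumes "open \<Omega>" "lipschitz_boundary \<Omega>" "locally_convex_or_C11 \<Omega>" "q \<in> frontier \<Omega>"
    and r: "r > 0" "ball p r \<subseteq> \<Omega>" "dist p q = r"
  shows "outward_unit_normal \<Omega> q ((1 / r) *\<^sub>R (q - p))"
proof -
  let ?n = "(1 / r) *\<^sub>R (q - p)"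
  have n: "norm ?n = 1" "r > 0" "ball (q - r *\<^sub>R ?n) r \<subseteq> \<Omega>"
    using r by (auto simp: dist_norm norm_minus_commute)
  obtain W where W: "open W" "q \<in> W" "convex (W \<inter> \<Omega>) \<or> (\<forall>q\<in>W \<inter> frontier \<Omega>. C11_boundary_at \<Omega> q)"
    using assms(3,4) by (auto simp: locally_convex_or_C11_def)
  obtain e G L where "epigraph_near \<Omega> q e G" "L-lipschitz_on UNIV G"
    using assms(2,4) by (auto simp: lipschitz_boundary_def)
  then show ?thesis
    using W convex_boundary_normal[OF assms(1,4) _ _ W(1,2) _ n] C11_boundary_normal[OF assms(1,4) _ n] assms(4)
    by blast
qed

text \<open>If a step of length \<open>h\<close> in direction \<open>e\<close> ends at a point whose nearest boundary point lies
  backwards, the squared distance to the complement drops by at most \<open>h\<^sup>2\<close>; cutting a segment into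
  \<open>N\<close> steps of length \<open>t / N\<close>, the total loss tends to \<open>0\<close>.\<close>

lemma translation_invariant_if_interior_normals_nonpos:
  fixes \<Omega> :: "'a::euclidean_space set"
  assumes op: "open \<Omega>" and e: "norm e = 1"
    and normals: "\<And>p q r. r > 0 \<Longrightarrow> ball p r \<subseteq> \<Omega> \<Longrightarrow> q \<in> frontier \<Omega> \<Longrightarrow> dist p q = r \<Longrightarrow> (q - p) \<bullet> e \<le> 0"
    and p: "p \<in> \<Omega>" and t: "t \<ge> 0"
  shows "p + t *\<^sub>R e \<in> \<Omega>"
proof (cases "\<Omega> = UNIV")
  case False
  define d where "d = (\<lambda>x. infdist x (- \<Omega>))"
  have cl: "closed (- \<Omega>)" and ne: "- \<Omega> \<noteq> {}" using op False by auto
  have dpos: "d x > 0" if "x \<in> \<Omega>" for x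
    using infdist_pos_not_in_closed[OF cl ne, of x] that by (simp add: d_def)
  have ball: "y \<in> \<Omega>" if "dist x y < d x" for x y
    using that infdist_le[of y "- \<Omega>" x] by (force simp: d_def)
  have step: "(d x)\<^sup>2 \<le> (d (x + h *\<^sub>R e))\<^sup>2 + h\<^sup>2" if "x + h *\<^sub>R e \<in> \<Omega>" "h \<ge> 0" for x h
  proof -
    let ?y = "x + h *\<^sub>R e"
    obtain q where q: "q \<in> - \<Omega>" "d ?y = dist ?y q"
      using infdist_attains_inf[OF cl ne, of ?y] by (auto simp: d_def)
    have sub: "ball ?y (d ?y) \<subseteq> \<Omega>" using ball by auto
    have "q \<in> cball ?y (d ?y)" using q by simp
    then have "q \<in> closure \<Omega>"
      using closure_mono[OF sub] dpos[OF that(1)] by (auto simp: closure_ball)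
    then have "q \<in> frontier \<Omega>" using q(1) op by (simp add: frontier_def interior_open)
    from normals[OF dpos[OF that(1)] sub this] q(2) have le: "(q - ?y) \<bullet> e \<le> 0" by simp
    have "d x \<le> dist x q" unfolding d_def by (rule infdist_le[OF q(1)])
    then have "(d x)\<^sup>2 \<le> (dist x q)\<^sup>2" by (rule power_mono) (simp add: d_def infdist_nonneg)
    also have "\<dots> = (norm ((?y - q) - h *\<^sub>R e))\<^sup>2" by (simp add: dist_norm algebra_simps)
    also have "\<dots> = (norm (?y - q))\<^sup>2 - 2 * h * ((?y - q) \<bullet> e) + h\<^sup>2"
      using e by (simp only: power2_norm_eq_inner inner_diff_left inner_diff_right)
        (simp add: norm_eq_1 inner_commute power2_eq_square algebra_simps)
    also have "\<dots> \<le> (norm (?y - q))\<^sup>2 + h\<^sup>2"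
      using le that(2) mult_nonneg_nonpos[OF that(2) le] by (simp add: inner_diff_left algebra_simps)
    finally show ?thesis by (simp add: q(2) dist_norm)
  qed
  define d0 where "d0 = (d p)\<^sup>2"
  have d0: "d0 > 0" using dpos[OF p] by (simp add: d0_def)
  \<comment> \<open>With this \<open>N\<close> and \<open>h = t / N\<close>,
    \<open>(N + 1) h^2 \<le> 2 t^2 / N < d0\<close>. The steps lose at most \<open>N h^2\<close> in
    total, so more than \<open>h^2\<close> always remains and the next step stays inside.\<close>
  obtain N where N1: "2 * t\<^sup>2 < real N * d0" using reals_Archimedean3[OF d0] by blast
  have "N \<noteq> 0" using N1 by (intro notI) simp
  then have N: "2 * t\<^sup>2 < real N * d0" "N > 0" using N1 by auto
  define h where "h = t / real N"
  have h0: "h \<ge> 0" using t by (simp add: h_def)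
  have "(real N + 1) * h\<^sup>2 \<le> 2 * real N * h\<^sup>2" using N(2) by (intro mult_right_mono) auto
  also have "\<dots> = 2 * t\<^sup>2 / real N" using N(2) by (simp add: h_def power2_eq_square)
  also have "\<dots> < d0" using N by (simp add: pos_divide_less_eq mult.commute)
  finally have h: "(real N + 1) * h\<^sup>2 < d0" .
  have "k \<le> N \<Longrightarrow> p + (real k * h) *\<^sub>R e \<in> \<Omega> \<and> (d (p + (real k * h) *\<^sub>R e))\<^sup>2 \<ge> d0 - real k * h\<^sup>2" for k
  proof (induction k)
    case 0
    then show ?case using p by (simp add: d0_def)
  next
    case (Suc k)
    let ?x = "p + (real k * h) *\<^sub>R e"
    have x: "?x \<in> \<Omega>" "(d ?x)\<^sup>2 \<ge> d0 - real k * h\<^sup>2" using Suc by auto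
    have eq: "p + (real (Suc k) * h) *\<^sub>R e = ?x + h *\<^sub>R e" by (simp add: algebra_simps)
    have "(real k + 1) * h\<^sup>2 \<le> (real N + 1) * h\<^sup>2" using Suc.prems by (intro mult_right_mono) auto
    then have "h\<^sup>2 < (d ?x)\<^sup>2" using h x(2) by (simp add: distrib_right)
    then have "h < d ?x" by (rule power2_less_imp_less) (simp add: d_def infdist_nonneg)
    then have in': "?x + h *\<^sub>R e \<in> \<Omega>" using e h0 by (intro ball[of ?x]) (simp add: dist_norm)
    then show ?case unfolding eq using step[OF in' h0] x(2) by (simp add: distrib_right)
  qed
  from this[of N] show ?thesis using N(2) by (simp add: h_def)
qed simp

section \<open>The resolvent estimate\<close>

text \<open>A ball inside \<open>\<Omega>\<close> that touches the boundary at \<open>q\<close>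
  makes the radial direction the outward normal there, so the sign condition applies to
  \<open>q - p\<close>. It says nothing where \<open>fst q = 0\<close>, but such a point lies behind
  the centre.\<close>

lemma forward_invariant_domain_if_normals:
  fixes \<Omega> :: "(real \<times> 'b::euclidean_space) set"
  assumes "open \<Omega>" "lipschitz_boundary \<Omega>" "locally_convex_or_C11 \<Omega>"
    and normals: "\<And>p \<nu>. outward_unit_normal \<Omega> p \<nu> \<Longrightarrow> fst p * fst \<nu> \<le> 0"
    and pos: "\<And>p. p \<in> \<Omega> \<Longrightarrow> fst p > 0"
  shows "forward_invariant_domain \<Omega>"
proof
  fix p t assume p: "p \<in> \<Omega>" and t: "0 \<le> (t :: real)"
  have "p + t *\<^sub>R (1, 0) \<in> \<Omega>"
  proof (rule translation_invariant_if_interior_normals_nonpos[OF assms(1) _ _ p t])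
    fix p q :: "real \<times> 'b" and r :: real
    assume r: "r > 0" "ball p r \<subseteq> \<Omega>" and q: "q \<in> frontier \<Omega>" "dist p q = r"
    have "p \<in> \<Omega>" using r by auto
    then have "fst p > 0" by (rule pos)
    have "fst q - fst p \<le> 0"
    proof (cases "fst q > 0")
      case True
      have "fst q * ((1 / r) * (fst q - fst p)) \<le> 0"
        using normals[OF interior_ball_outward_unit_normal[OF assms(1-3) q(1) r q(2)]] by simp
      then show ?thesis using True r(1) by (simp add: mult_le_0_iff zero_less_divide_iff divide_le_0_iff)
    qed (use \<open>fst p > 0\<close> in simp)
    then show "(q - p) \<bullet> (1, 0) \<le> 0" by (simp add: inner_prod_def)
  qed (simp add: norm_prod_def)
  then show "p + (t, 0) \<in> \<Omega>" by simp
qed (use assms in auto)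

theorem theorem1:
  fixes \<Omega> :: "(real \<times> (real ^ 'm)) set"
    and \<delta> :: real
    and z :: complex
  assumes "open \<Omega>"
    and "emeasure lborel \<Omega> = \<infinity>"
    and "lipschitz_boundary \<Omega>"
    and "locally_convex_or_C11 \<Omega>"
    and "\<And>p \<nu>. outward_unit_normal \<Omega> p \<nu> \<Longrightarrow> fst p * fst \<nu> \<le> 0"
    and "\<And>p. p \<in> \<Omega> \<Longrightarrow> fst p > 0"
    and "0 < \<delta>" and "\<delta> \<le> 1"
    and "z \<notin> \<real>\<^sub>\<ge>\<^sub>0"
  shows "L2_opnorm (vol \<Omega>)
           (\<lambda>f p. complex_of_real ((1 + fst p) powr (- ((3 + \<delta>) / 2))) *
              dirichlet_resolvent \<Omega> z
                (\<lambda>q. complex_of_real ((1 + fst q) powr (- ((3 + \<delta>) / 2))) * f q) p)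
         \<le> ennreal (3 / \<delta> * (1 + sqrt (cmod z)))"
proof -
  interpret forward_invariant_domain \<Omega>
    by (rule forward_invariant_domain_if_normals) (use assms in auto)
  define a where "a = - (3 + \<delta>) / 2"
  have a: "- ((3 + \<delta>) / 2) = a" "a \<le> 0"
    using \<open>0 < \<delta>\<close> unfolding a_def by (simp_all only: minus_divide_left) simp
  define C where "C = 3 / \<delta> * (1 + sqrt (cmod z))"
  let ?R = "\<lambda>f. mult_wt a (dirichlet_resolvent \<Omega> z (mult_wt a f))"
  have "?R f \<in> L2 (vol \<Omega>) \<and> L2_norm (vol \<Omega>) (?R f) \<le> C * L2_norm (vol \<Omega>) f" if f: "f \<in> L2 (vol \<Omega>)" for f
  proof -
    have F: "mult_wt a f \<in> L2 (vol \<Omega>)" by (rule mult_wt_L2_vol(1)[OF f a(2)])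
    have "\<exists>u. weak_solution z u (mult_wt a f)"
      using solvable_resolvent_set[OF \<open>z \<notin> \<real>\<^sub>\<ge>\<^sub>0\<close>] F unfolding solvable_def by blast
    \<comment> \<open>Existence lets the \<open>SOME\<close> in the resolvent pick an actual
      solution, to which the estimate applies.\<close>
    then have "weak_solution z (dirichlet_resolvent \<Omega> z (mult_wt a f)) (mult_wt a f)"
      unfolding weak_solution_iff[OF F] dirichlet_resolvent_def neg_dirichlet_laplacian_def by (rule someI_ex)
    then show ?thesis
      using mult_wt_L2_vol(1)[OF weak_solution_L2 a(2)] weighted_resolvent_estimate[OF \<open>0 < \<delta>\<close> \<open>\<delta> \<le> 1\<close> f]
      unfolding C_def a_def by blast
  qed
  moreover have "0 \<le> C" using \<open>0 < \<delta>\<close> by (simp add: C_def)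
  ultimately show ?thesis
    unfolding a(1) L2_opnorm_def C_def[symmetric]
    by (intro Inf_lower) (auto simp: mult_wt_def wt_def)
qed

end
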